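(* Let $k$ be a field of positive characteristic. Then for every integer $n \ge 3$ the affine space $\mathbb{A}^n_k$ is not cancellative; that is, for every integer $n \ge 3$ there exists a finitely generated $k$-algebra $A$ such that the polynomial ring $A[X]$ in one variable over $A$ is isomorphic, as a $k$-algebra, to the polynomial ring $k[X_1, \dots, X_{n+1}]$, but $A$ is not isomorphic, as a $k$-algebra, to the polynomial ring $k[X_1, \dots, X_n]$.
   Context: The Zariski Cancellation Problem for affine spaces over a field $k$ asks whether $\mathbb{A}^n_k$ is cancellative: if $\mathbb{V}$ is an affine $k$-variety with $\mathbb{V} \times \mathbb{A}^1_k \cong \mathbb{A}^{n+1}_k$, does it follow that $\mathbb{V} \cong \mathbb{A}^n_k$? Equivalently, if $A$ is an affine (i.e. finitely generated) $k$-algebra such that $A[X] \cong k[X_1,\dots,X_{n+1}]$, does it follow that $A \cong k[X_1,\dots,X_n]$? The space $\mathbb{A}^n_k$ is not cancellative when the answer is negative. *)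

theory Defs
  imports
    "HOL-Algebra.UnivPoly"
    "HOL-Algebra.Generated_Rings"
    "HOL-Algebra.Multiplicative_Group"
    "HOL-Algebra.QuotRing"
    "HOL-Algebra.Indexed_Polynomials"
begin

text \<open>The characteristic is the additive order of \<open>1\<close>; \<^const>\<open>group.ord\<close> is \<open>0\<close> for elements of
  infinite order, so this is \<open>0\<close> exactly in characteristic zero.\<close>

definition ring_characteristic :: "('a, 'm) ring_scheme \<Rightarrow> nat" where
  "ring_characteristic R = group.ord (add_monoid R) \<one>\<^bsub>R\<^esub>"

text \<open>Commutative \<open>K\<close>-algebras are those of the library locale \<^locale>\<open>algebra\<close>; the smallest
  \<open>K\<close>-subalgebra containing \<open>S\<close> is the subring generated by \<open>S\<close> and the scalars \<open>c \<cdot> 1\<close>.\<close>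

definition finitely_generated_algebra ::
    "('k, 'm) ring_scheme \<Rightarrow> ('k, 'a, 'n) module_scheme \<Rightarrow> bool" where
  "finitely_generated_algebra K A \<longleftrightarrow>
     algebra K A \<and>
     (\<exists>S. finite S \<and> S \<subseteq> carrier A \<and>
        generate_ring A ((\<lambda>c. c \<odot>\<^bsub>A\<^esub> \<one>\<^bsub>A\<^esub>) ` carrier K \<union> S) = carrier A)"

definition algebra_isomorphic ::
    "('k, 'm) ring_scheme \<Rightarrow> ('k, 'a, 'n) module_scheme \<Rightarrow> ('k, 'b, 'l) module_scheme \<Rightarrow> bool" where
  "algebra_isomorphic K A B \<longleftrightarrow>
     (\<exists>h \<in> ring_iso A B.
        \<forall>c \<in> carrier K. \<forall>x \<in> carrier A. h (c \<odot>\<^bsub>A\<^esub> x) = c \<odot>\<^bsub>B\<^esub> h x)"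

text \<open>\<open>A[X]\<close> as an algebra over the base ring of \<open>A\<close>. The scalar multiplication of \<^term>\<open>UP A\<close>
  itself has scalars in \<open>A\<close>, so it is replaced here by the coefficientwise action of the base ring.\<close>

definition poly_algebra :: "('k, 'a, 'n) module_scheme \<Rightarrow> ('k, nat \<Rightarrow> 'a) module" where
  "poly_algebra A =
     \<lparr> carrier = carrier (UP A),
       monoid.mult = monoid.mult (UP A),
       one = \<one>\<^bsub>UP A\<^esub>,
       zero = \<zero>\<^bsub>UP A\<^esub>,
       add = ring.add (UP A),
       smult = (\<lambda>c p i. c \<odot>\<^bsub>A\<^esub> p i) \<rparr>"

text \<open>\<open>K[X\<^sub>0, \<dots>, X\<^sub>n\<^sub>-\<^sub>1]\<close>: the library provides the set of polynomials, as coefficient functions on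
  monomials (multisets of variable indices), and their addition; the product is convolution.\<close>

definition mpoly_algebra :: "('k, 'm) ring_scheme \<Rightarrow> nat \<Rightarrow> ('k, nat multiset \<Rightarrow> 'k) module" where
  "mpoly_algebra K n =
     \<lparr> carrier = ring.indexed_pset K {..<n} (carrier K),
       monoid.mult = (\<lambda>p q m. \<Oplus>\<^bsub>K\<^esub>d \<in> {d. d \<subseteq># m}. p d \<otimes>\<^bsub>K\<^esub> q (m - d)),
       one = ring.indexed_const K \<one>\<^bsub>K\<^esub>,
       zero = ring.indexed_const K \<zero>\<^bsub>K\<^esub>,
       add = ring.indexed_padd K,
       smult = (\<lambda>c p m. c \<otimes>\<^bsub>K\<^esub> p m) \<rparr>"

end

theory Submission
  imports Defs "HOL-Library.Poly_Mapping" "HOL-Computational_Algebra.Computational_Algebra" "HOL-Algebra.Exponent"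
begin

text \<open>
  Following Asanuma and Gupta, let \<open>A = k[X\<^sub>1, \<dots>, X\<^sub>m, Y, Z, T] / ((X\<^sub>1 \<cdots> X\<^sub>m)\<^sup>s Y - f(Z, T))\<close> with \<open>f = 0\<close> a line
  that is not a coordinate. Since the line becomes rectifiable in space, \<open>A[V]\<close> is a polynomial ring.

  Suppose \<open>A\<close> were a polynomial ring. The translations of its variables are exponential maps
  \<open>A \<rightarrow> A[U]\<close> whose rings of constants generate \<open>A\<close>, so one of them fixes an element outside
  \<open>k[X, Z, T]\<close>. Passing to leading forms for a generic weight gives a nontrivial multihomogeneous
  exponential map on \<open>k[X, Y, Z, T] / ((X\<^sub>1 \<cdots> X\<^sub>m)\<^sup>s Y - g\<^sup>p)\<close>, with \<open>g = Z\<^sup>q - T\<^sup>s\<close>, that fixes \<open>Y\<close>.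
  If \<open>g\<close> were fixed, \<open>T\<close> would divide its own derivative. Otherwise exactly one \<open>X\<^sub>i\<close> moves, and
  multihomogeneity forces the first index at which \<open>Z\<close> or \<open>T\<close> moves to be divisible by \<open>s\<close>; but
  this index is a power of \<open>p\<close>, and \<open>s = p + 1\<close>.
\<close>

section \<open>Laurent polynomials and weights\<close>

text \<open>Since \<open>y\<close> is a quotient by a monomial, \<open>A\<close> is handled as a
  subring of the Laurent polynomials: it is then visibly a domain, and weights on Laurent monomials
  induce its filtrations. The line is that of Segre and Nagata, parametrized by \<open>u\<close> as
  \<open>(u + u^(s p), u^(p^3))\<close>. The choice \<open>s = p + 1\<close> serves three ends:
  \<open>s\<close> is prime to \<open>p\<close>; \<open>s\<close> equals \<open>1\<close> in
  characteristic \<open>p\<close>, so the first-order term of \<open>t^s\<close> is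
  \<open>t^(s-1)\<close> times that of \<open>t\<close>; and \<open>s\<close> is at most
  \<open>q = p^2\<close>. In characteristic \<open>p\<close> a single derivation carries too little
  information, so all coefficients of an exponential map are used: the degree in \<open>U\<close> is
  a degree function, and the composition law of the coefficients controls where the first one sits.
  The generic weight has components independent over the integers, so one real filtration sees the
  whole multidegree. The main obstacle is that degrees drop in sums, so the degree of
  \<open>g\<close> has no evident lower bound. Two situations are safe: only constants among the
  forms in \<open>Z, T\<close> are fixed, or \<open>z^q\<close> and \<open>t^s\<close> have
  different degrees. The remaining resonant case is excluded by factoring a fixed form.\<close>

type_synonym expo = "nat \<Rightarrow>\<^sub>0 int"
type_synonym 'f laurent = "expo \<Rightarrow>\<^sub>0 'f"

abbreviation lk :: "('a \<Rightarrow>\<^sub>0 'b::zero) \<Rightarrow> 'a \<Rightarrow> 'b" where "lk \<equiv> Poly_Mapping.lookup"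
abbreviation supp :: "('a \<Rightarrow>\<^sub>0 'b::zero) \<Rightarrow> 'a set" where "supp \<equiv> Poly_Mapping.keys"
abbreviation cf :: "'a::zero poly \<Rightarrow> nat \<Rightarrow> 'a" where "cf \<equiv> Polynomial.coeff"

definition lmon :: "expo \<Rightarrow> 'f::field laurent" where "lmon \<mu> = Poly_Mapping.single \<mu> 1"
definition sc :: "'f \<Rightarrow> 'f::field laurent" where "sc c = Poly_Mapping.single 0 c"
definition unit_exp :: "nat \<Rightarrow> int \<Rightarrow> expo" where "unit_exp l k = Poly_Mapping.single l k"
definition xvar :: "nat \<Rightarrow> 'f::field laurent" where "xvar l = lmon (unit_exp l 1)"

lemma lk_unit_exp: "lk (unit_exp l k) i = (if i = l then k else 0)"
  by (simp add: unit_exp_def lookup_single when_def)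

lemma unit_exp_add: "unit_exp l a + unit_exp l b = unit_exp l (a + b)"
  by (simp add: unit_exp_def single_add)

lemma unit_exp_0 [simp]: "unit_exp l 0 = 0"
  by (simp add: unit_exp_def)

lemma lmon_mult: "lmon \<mu> * lmon \<nu> = lmon (\<mu> + \<nu>)"
  by (simp add: lmon_def mult_single)

lemma lmon_0 [simp]: "lmon 0 = 1"
  by (simp add: lmon_def)

lemma lmon_nonzero [simp]: "lmon \<mu> \<noteq> 0"
  by (metis keys_single lmon_def keys_zero insert_not_empty zero_neq_one)

lemma supp_lmon [simp]: "supp (lmon \<mu> :: 'f::field laurent) = {\<mu>}"
  by (simp add: lmon_def)

lemma sc_0 [simp]: "sc 0 = 0" and sc_1 [simp]: "sc 1 = 1"
  and sc_add: "sc (a + b) = sc a + sc b" and sc_mult: "sc (a * b) = sc a * sc b"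
  by (simp_all add: sc_def single_add mult_single)

lemma sc_eq_0_iff [simp]: "sc c = 0 \<longleftrightarrow> c = 0"
  by (metis lookup_single_eq lookup_zero sc_0 sc_def)

lemma sc_power: "sc (c ^ n) = sc c ^ n"
  by (induction n) (simp_all add: sc_mult)

lemma sc_sum: "sc (sum h A) = (\<Sum>i\<in>A. sc (h i))"
  by (induction A rule: infinite_finite_induct) (simp_all add: sc_add)

lemma supp_sc: "supp (sc c) = (if c = 0 then {} else {0})"
  by (simp add: sc_def)

lemma sc_mult_lmon: "sc c * lmon \<mu> = Poly_Mapping.single \<mu> c"
  by (simp add: sc_def lmon_def mult_single)

lemma lk_sc_mult: "lk (sc c * a) \<mu> = c * lk a \<mu>"
  unfolding sc_def by (simp flip: mult_map_scale_conv_mult add: map.rep_eq when_def)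

lemma laurent_expand: "a = (\<Sum>\<mu>\<in>supp a. sc (lk a \<mu>) * lmon \<mu>)"
proof (rule poly_mapping_eqI)
  fix \<nu>
  show "lk a \<nu> = lk (\<Sum>\<mu>\<in>supp a. sc (lk a \<mu>) * lmon \<mu>) \<nu>"
    by (auto simp: lookup_sum sc_mult_lmon lookup_single when_def in_keys_iff)
qed

lemma lk_lmon_mult: "lk (lmon \<mu> * a) \<nu> = lk a (\<nu> - \<mu>)"
proof -
  have "lk (lmon \<mu> * a) \<nu> = lk (\<Sum>\<nu>\<in>supp a. Poly_Mapping.single (\<mu> + \<nu>) (lk a \<nu>)) \<nu>"
    by (subst (1) laurent_expand[of a]) (simp add: sum_distrib_left sc_def lmon_def mult_single)
  also have "\<dots> = (\<Sum>x\<in>supp a. if x = \<nu> - \<mu> then lk a x else 0)"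
    unfolding lookup_sum lookup_single when_def by (intro sum.cong) (auto simp: algebra_simps)
  also have "\<dots> = lk a (\<nu> - \<mu>)"
    by (simp add: in_keys_iff)
  finally show ?thesis .
qed

lemma supp_lmon_mult: "supp (lmon \<mu> * a) = (\<lambda>\<nu>. \<mu> + \<nu>) ` supp a"
proof (rule Set.set_eqI)
  fix \<nu>
  have "\<nu> \<in> supp (lmon \<mu> * a) \<longleftrightarrow> \<nu> - \<mu> \<in> supp a" by (simp add: in_keys_iff lk_lmon_mult)
  also have "\<dots> \<longleftrightarrow> \<nu> \<in> (\<lambda>\<nu>. \<mu> + \<nu>) ` supp a"
    by (metis (no_types, lifting) add_diff_cancel_left' diff_add_cancel add.commute image_iff)
  finally show "\<nu> \<in> supp (lmon \<mu> * a) \<longleftrightarrow> \<nu> \<in> (\<lambda>\<nu>. \<mu> + \<nu>) ` supp a" .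
qed

lemma supp_minus: "supp (a - b :: 'a \<Rightarrow>\<^sub>0 'b::ab_group_add) \<subseteq> supp a \<union> supp b"
  by (auto simp: in_keys_iff lookup_minus)

lemma xvar_power: "xvar l ^ n = lmon (unit_exp l (int n))"
  by (induction n) (simp_all add: xvar_def lmon_mult unit_exp_add add.commute)

lemma xvar_nonzero [simp]: "xvar l \<noteq> 0"
  by (simp add: xvar_def)

lemma supp_add_prod: "\<mu> \<in> supp (a * b) \<Longrightarrow> \<exists>\<alpha>\<in>supp a. \<exists>\<beta>\<in>supp b. \<mu> = \<alpha> + \<beta>"
  using subsetD[OF keys_mult] by blast

lemma CHAR_laurent [simp]: "CHAR('f::field laurent) = CHAR('f)"
proof (rule CHAR_eqI)
  have of_nat: "(of_nat n :: 'f laurent) = sc (of_nat n)" for n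
    by (simp add: sc_def)
  show "of_nat CHAR('f) = (0 :: 'f laurent)"
    unfolding of_nat by simp
  show "CHAR('f) dvd n" if "of_nat n = (0 :: 'f laurent)" for n
    using that unfolding of_nat by (simp add: of_nat_eq_0_iff_char_dvd)
qed

lift_definition restr :: "('a \<Rightarrow> bool) \<Rightarrow> ('a \<Rightarrow>\<^sub>0 'b::zero) \<Rightarrow> 'a \<Rightarrow>\<^sub>0 'b" is
  "\<lambda>P a \<mu>. if P \<mu> then a \<mu> else 0"
  by (erule rev_finite_subset) auto

lemma lk_restr: "lk (restr P a) \<mu> = (if P \<mu> then lk a \<mu> else 0)"
  by transfer simp

lemma supp_restr: "supp (restr P a) = {\<mu> \<in> supp a. P \<mu>}"
  by (auto simp: in_keys_iff lk_restr split: if_splits)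

lemma restr_add: "restr P (a + b) = restr P a + restr P (b :: 'a \<Rightarrow>\<^sub>0 'b::monoid_add)"
  by (rule poly_mapping_eqI) (simp add: lk_restr lookup_add)

lemma restr_0 [simp]: "restr P 0 = 0"
  by (rule poly_mapping_eqI) (simp add: lk_restr)

lemma restr_minus: "restr P (a - b) = restr P a - restr P (b :: 'a \<Rightarrow>\<^sub>0 'b::ab_group_add)"
  by (rule poly_mapping_eqI) (simp add: lk_restr lookup_minus)

lemma restr_sum: "restr P (sum h A) = (\<Sum>i\<in>A. restr P (h i :: 'a \<Rightarrow>\<^sub>0 'b::comm_monoid_add))"
  by (induction A rule: infinite_finite_induct) (simp_all add: restr_add)

lemma restr_sc_mult: "restr P (sc c * a) = sc c * restr P a"
  by (rule poly_mapping_eqI) (simp add: lk_restr lk_sc_mult)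

lemma restr_all: "(\<And>\<mu>. \<mu> \<in> supp a \<Longrightarrow> P \<mu>) \<Longrightarrow> restr P a = a"
  by (rule poly_mapping_eqI) (auto simp: lk_restr in_keys_iff)

lemma restr_none: "(\<And>\<mu>. \<mu> \<in> supp a \<Longrightarrow> \<not> P \<mu>) \<Longrightarrow> restr P a = 0"
  by (rule poly_mapping_eqI) (auto simp: lk_restr in_keys_iff)

lemma restr_split: "a = restr P a + restr (\<lambda>\<mu>. \<not> P \<mu>) (a :: 'a \<Rightarrow>\<^sub>0 'b::monoid_add)"
  by (rule poly_mapping_eqI) (simp add: lk_restr lookup_add)

section \<open>Weight filtrations and leading parts\<close>

definition below :: "(expo \<Rightarrow> real) \<Rightarrow> real \<Rightarrow> 'f::field laurent set" where
  "below w \<gamma> = {a. \<forall>\<mu>\<in>supp a. w \<mu> \<le> \<gamma>}"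

definition top_part :: "(expo \<Rightarrow> real) \<Rightarrow> real \<Rightarrow> 'f::field laurent \<Rightarrow> 'f laurent" where
  "top_part w \<gamma> a = restr (\<lambda>\<mu>. w \<mu> = \<gamma>) a"

locale weight =
  fixes w :: "expo \<Rightarrow> real"
  assumes w_add: "w (\<mu> + \<nu>) = w \<mu> + w \<nu>"
begin

lemma w_0: "w 0 = 0"
  using w_add[of 0 0] by simp

lemma below_add: "a \<in> below w \<gamma> \<Longrightarrow> b \<in> below w \<gamma> \<Longrightarrow> a + b \<in> below w \<gamma>"
  using keys_add[of a b] by (auto simp: below_def)

lemma below_mult: "a \<in> below w \<gamma> \<Longrightarrow> b \<in> below w \<gamma>' \<Longrightarrow> a * b \<in> below w (\<gamma> + \<gamma>')"
  using keys_mult[of a b] by (fastforce simp: below_def w_add)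

lemma below_0 [simp]: "0 \<in> below w \<gamma>" by (simp add: below_def)

lemma below_sum: "(\<And>i. i \<in> I \<Longrightarrow> h i \<in> below w \<gamma>) \<Longrightarrow> sum h I \<in> below w \<gamma>"
  by (induction I rule: infinite_finite_induct) (auto intro: below_add)

lemma below_sc: "sc c \<in> below w 0"
  by (simp add: below_def supp_sc w_0)

lemma below_mono: "a \<in> below w \<gamma> \<Longrightarrow> \<gamma> \<le> \<gamma>' \<Longrightarrow> a \<in> below w \<gamma>'"
  by (fastforce simp: below_def)

lemma below_power: "a \<in> below w \<gamma> \<Longrightarrow> a ^ n \<in> below w (real n * \<gamma>)"
proof (induction n)
  case 0
  show ?case using below_sc[of 1] by simp
next
  case (Suc n)
  then show ?case using below_mult[of a \<gamma> "a ^ n" "real n * \<gamma>"] by (simp add: algebra_simps)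
qed

lemma below_diff: "a \<in> below w \<gamma> \<Longrightarrow> b \<in> below w \<gamma> \<Longrightarrow> a - b \<in> below w \<gamma>"
  using supp_minus[of a b] by (auto simp: below_def)

lemma below_lmon: "lmon \<mu> \<in> below w (w \<mu>)" by (simp add: below_def)

text \<open>Split each factor into its part of extreme weight and a remainder of strictly smaller
  weight; every mixed product falls below \<open>\<gamma> + \<gamma>'\<close>. The bounds need not
  be attained, so vanishing top parts require no separate case.\<close>

lemma top_part_mult:
  assumes a: "a \<in> below w \<gamma>" and b: "b \<in> below w \<gamma>'"
  shows "top_part w (\<gamma> + \<gamma>') (a * b) = top_part w \<gamma> a * top_part w \<gamma>' b"
proof -
  define a1 a2 b1 b2 where "a1 = top_part w \<gamma> a" and "a2 = restr (\<lambda>\<mu>. w \<mu> \<noteq> \<gamma>) a"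
    and "b1 = top_part w \<gamma>' b" and "b2 = restr (\<lambda>\<mu>. w \<mu> \<noteq> \<gamma>') b"
  note defs = a1_def a2_def b1_def b2_def
  have ab: "a = a1 + a2" "b = b1 + b2"
    unfolding defs top_part_def by (rule restr_split)+
  have k: "w \<mu> = \<gamma>" if "\<mu> \<in> supp a1" for \<mu> using that by (simp add: defs top_part_def supp_restr)
  have k2: "w \<mu> < \<gamma>" if "\<mu> \<in> supp a2" for \<mu>
    using that a by (force simp: defs supp_restr below_def)
  have l: "w \<mu> = \<gamma>'" if "\<mu> \<in> supp b1" for \<mu> using that by (simp add: defs top_part_def supp_restr)
  have l2: "w \<mu> < \<gamma>'" if "\<mu> \<in> supp b2" for \<mu>
    using that b by (force simp: defs supp_restr below_def)
  have e: "a * b = a1 * b1 + (a1 * b2 + a2 * b1 + a2 * b2)"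
    by (simp add: ab algebra_simps)
  have 1: "top_part w (\<gamma> + \<gamma>') (a1 * b1) = a1 * b1"
    unfolding top_part_def using k l by (intro restr_all) (force dest!: supp_add_prod simp: w_add)
  have "w \<mu> < \<gamma> + \<gamma>'" if "\<mu> \<in> supp (a1 * b2) \<union> supp (a2 * b1) \<union> supp (a2 * b2)" for \<mu>
    using that k k2 l l2 by (fastforce dest!: supp_add_prod simp: w_add)
  then have "w \<mu> < \<gamma> + \<gamma>'" if "\<mu> \<in> supp (a1 * b2 + a2 * b1 + a2 * b2)" for \<mu>
    using that keys_add[of "a1 * b2 + a2 * b1" "a2 * b2"] keys_add[of "a1 * b2" "a2 * b1"] by blast
  then have 2: "top_part w (\<gamma> + \<gamma>') (a1 * b2 + a2 * b1 + a2 * b2) = 0"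
    unfolding top_part_def by (intro restr_none) fastforce
  have "top_part w (\<gamma> + \<gamma>') (a * b) = top_part w (\<gamma> + \<gamma>') (a1 * b1)
      + top_part w (\<gamma> + \<gamma>') (a1 * b2 + a2 * b1 + a2 * b2)"
    unfolding e top_part_def by (rule restr_add)
  then show ?thesis
    using 1 2 by (simp add: a1_def b1_def)
qed

lemma top_part_power:
  assumes "a \<in> below w \<gamma>"
  shows "top_part w (real n * \<gamma>) (a ^ n) = top_part w \<gamma> a ^ n"
proof (induction n)
  case 0
  show ?case by (auto simp: top_part_def w_0 intro!: restr_all)
next
  case (Suc n)
  have "top_part w (\<gamma> + real n * \<gamma>) (a * a ^ n) = top_part w \<gamma> a * top_part w (real n * \<gamma>) (a ^ n)"
    by (intro top_part_mult assms below_power)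
  then show ?case using Suc by (simp add: algebra_simps)
qed

lemma top_part_strict: "a \<in> below w \<gamma>' \<Longrightarrow> \<gamma>' < \<gamma> \<Longrightarrow> top_part w \<gamma> a = 0"
  unfolding top_part_def by (rule restr_none) (auto simp: below_def)

text \<open>The support is finite, so a bound that no exponent attains can be lowered. This later
  makes leading coefficients independent of the chosen lift.\<close>

lemma below_strict:
  assumes "a \<in> below w \<gamma>" "top_part w \<gamma> a = 0"
  shows "\<exists>\<gamma>'<\<gamma>. a \<in> below w \<gamma>'"
proof (cases "a = 0")
  case True
  then show ?thesis by (intro exI[of _ "\<gamma> - 1"]) simp
next
  case False
  then have ne: "supp a \<noteq> {}" by simp
  have lt: "w \<mu> < \<gamma>" if "\<mu> \<in> supp a" for \<mu>
  proof -
    have "\<not> (w \<mu> = \<gamma>)"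
      using assms(2) that unfolding top_part_def by (metis (mono_tags, lifting) in_keys_iff lk_restr lookup_zero)
    then show ?thesis using assms(1) that by (force simp: below_def)
  qed
  show ?thesis
    using ne lt by (intro exI[of _ "Max (w ` supp a)"]) (auto simp: below_def)
qed

text \<open>Leading form for the weight extended by giving the polynomial variable weight
  \<open>- lam\<close>: the coefficient at \<open>j\<close> is then measured at level
  \<open>\<gamma> + j lam\<close>.\<close>

definition top_poly :: "real \<Rightarrow> real \<Rightarrow> 'f::field laurent poly \<Rightarrow> 'f laurent poly" where
  "top_poly lam \<gamma> P = (\<Sum>j\<le>Polynomial.degree P. Polynomial.monom (top_part w (\<gamma> + real j * lam) (cf P j)) j)"

lemma cf_top_poly: "cf (top_poly lam \<gamma> P) j = top_part w (\<gamma> + real j * lam) (cf P j)"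
  by (auto simp: top_poly_def coeff_sum coeff_eq_0 top_part_def)

lemma top_poly_mult:
  assumes a: "\<And>j. cf P j \<in> below w (\<gamma> + real j * lam)" and b: "\<And>j. cf Q j \<in> below w (\<gamma>' + real j * lam)"
  shows "top_poly lam (\<gamma> + \<gamma>') (P * Q) = top_poly lam \<gamma> P * top_poly lam \<gamma>' Q"
proof (rule poly_eqI)
  fix n
  have "top_part w (\<gamma> + \<gamma>' + real n * lam) (cf P i * cf Q (n - i))
      = top_part w (\<gamma> + real i * lam) (cf P i) * top_part w (\<gamma>' + real (n - i) * lam) (cf Q (n - i))"
    if "i \<le> n" for i
  proof -
    have "\<gamma> + \<gamma>' + real n * lam = (\<gamma> + real i * lam) + (\<gamma>' + real (n - i) * lam)"
      using that by (simp add: algebra_simps of_nat_diff)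
    then show ?thesis using top_part_mult[OF a b] by metis
  qed
  then show "cf (top_poly lam (\<gamma> + \<gamma>') (P * Q)) n = cf (top_poly lam \<gamma> P * top_poly lam \<gamma>' Q) n"
    unfolding cf_top_poly coeff_mult top_part_def restr_sum
    by (intro sum.cong) (simp_all add: top_part_def cf_top_poly)
qed

lemma top_poly_add: "top_poly lam \<gamma> (P + Q) = top_poly lam \<gamma> P + top_poly lam \<gamma> Q"
  by (rule poly_eqI) (simp add: cf_top_poly top_part_def restr_add)

end

text \<open>Frobenius is additive, so a \<open>q\<close>-th power acts on each coefficient
  separately and stretches the indices by \<open>q\<close>.\<close>

lemma coeff_prime_power:
  fixes P :: "'f::field laurent poly"
  assumes p: "prime CHAR('f)" and q: "q = CHAR('f) ^ k"
  shows "cf (P ^ q) i = (if q dvd i then cf P (i div q) ^ q else 0)"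
proof -
  have q0: "q > 0" using p q by (simp add: prime_gt_0_nat)
  have "P ^ q = (\<Sum>j\<le>Polynomial.degree P. Polynomial.monom (cf P j) j) ^ q"
    by (simp add: poly_as_sum_of_monoms)
  also have "\<dots> = (\<Sum>j\<le>Polynomial.degree P. Polynomial.monom (cf P j) j ^ q)"
    by (rule freshmans_dream_sum') (use p q in simp_all)
  also have "\<dots> = (\<Sum>j\<le>Polynomial.degree P. Polynomial.monom (cf P j ^ q) (j * q))"
    by (simp add: monom_power mult.commute)
  finally have "cf (P ^ q) i = (\<Sum>j\<le>Polynomial.degree P. if j * q = i then cf P j ^ q else 0)"
    by (simp add: coeff_sum)
  also have "\<dots> = (if q dvd i then cf P (i div q) ^ q else 0)"
  proof (cases "q dvd i")
    case True
    then obtain j where j: "i = j * q" by (metis dvd_def mult.commute)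
    then have "i div q = j" using q0 by simp
    then show ?thesis using j q0 by (simp add: coeff_eq_0 power_0_left)
  next
    case False
    then show ?thesis by (auto intro!: sum.neutral)
  qed
  finally show ?thesis .
qed

text \<open>A power rule for the lowest nonconstant coefficient, which replaces the derivative: a
  product of two nonconstant coefficients first appears at index \<open>2 i\<close>.\<close>

lemma coeff_power_first:
  fixes P :: "'a::comm_ring_1 poly"
  assumes "i > 0" "\<And>j. 0 < j \<Longrightarrow> j < i \<Longrightarrow> cf P j = 0"
  shows "cf (P ^ n) 0 = cf P 0 ^ n \<and> (\<forall>j. 0 < j \<longrightarrow> j < i \<longrightarrow> cf (P ^ n) j = 0) \<and>
         cf (P ^ n) i = of_nat n * cf P 0 ^ (n - 1) * cf P i"
proof (induction n)
  case 0
  then show ?case using assms(1) by simp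
next
  case (Suc n)
  have z: "cf (P * P ^ n) j = cf P 0 * cf (P ^ n) j + cf P j * cf (P ^ n) 0" if "0 < j" "j \<le> i" for j
  proof -
    have "cf (P * P ^ n) j = (\<Sum>k\<in>{0,j}. cf P k * cf (P ^ n) (j - k))"
      unfolding coeff_mult by (rule sum.mono_neutral_right) (use that assms in auto)
    then show ?thesis using that by simp
  qed
  have "cf (P ^ Suc n) j = 0" if "0 < j" "j < i" for j
    using z[of j] that Suc assms by simp
  moreover have "cf (P ^ Suc n) i = of_nat (Suc n) * cf P 0 ^ (Suc n - 1) * cf P i"
    using z[of i] Suc assms(1) by (cases n) (simp_all add: algebra_simps)
  ultimately show ?case using Suc by (simp add: coeff_mult)
qed

section \<open>Leading forms\<close>

locale asanuma =
  fixes m p :: nat and fld :: "'f::field itself"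
  assumes p: "prime p" and CHAR: "CHAR('f) = p" and m_pos: "m > 0"
begin

definition s :: nat where "s = p + 1"
definition q :: nat where "q = p ^ 2"

text \<open>The variables with index below \<open>m\<close> are the paper's \<open>X\<^sub>i\<close>; \<open>m\<close> and \<open>m + 1\<close> are \<open>Z\<close> and \<open>T\<close>. The
  non-trivial line is \<open>f = Z\<^bsup>p\<^sup>3\<^esup> - T - T\<^bsup>p (p + 1)\<^esup> = g\<^sup>p - T\<close>, and \<open>g\<^sup>p\<close> is its leading form when \<open>Z\<close> and \<open>T\<close>
  have weights \<open>s\<close> and \<open>q\<close>; so \<open>yh\<close> is the leading form of \<open>y = f / (X\<^sub>1 \<cdots> X\<^sub>m)\<^sup>s\<close>.\<close>

definition zz :: "'f laurent" where "zz = xvar m"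
definition tt :: "'f laurent" where "tt = xvar (m + 1)"
definition gg :: "'f laurent" where "gg = zz ^ q - tt ^ s"
definition Xexp :: expo where "Xexp = (\<Sum>l<m. unit_exp l (int s))"
definition Xinv :: "'f laurent" where "Xinv = lmon (- Xexp)"
definition yh :: "'f laurent" where "yh = Xinv * gg ^ p"

definition xexps :: "expo set" where
  "xexps = {a. (\<forall>l. lk a l \<ge> 0) \<and> (\<forall>l\<ge>m. lk a l = 0)}"

definition pol :: "'f laurent set" where
  "pol = {c. \<forall>\<mu>\<in>supp c. (\<forall>l. lk \<mu> l \<ge> 0) \<and> (\<forall>l. l \<noteq> m \<longrightarrow> l \<noteq> m + 1 \<longrightarrow> lk \<mu> l = 0)}"

definition wt :: "expo \<Rightarrow> int" where
  "wt \<mu> = int s * lk \<mu> m + int q * lk \<mu> (m + 1)"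

definition form :: "int \<Rightarrow> 'f laurent set" where
  "form W = {c \<in> pol. \<forall>\<mu>\<in>supp c. wt \<mu> = W}"

text \<open>All multihomogeneous elements of \<open>k[X, yh, Z, T]\<close> have this shape: within
  one multidegree, exponents of \<open>yh\<close> can be traded by
  \<open>lmon Xexp * yh = gg ^ p\<close>, which is absorbed into \<open>c\<close>. The set is closed
  under products and contains \<open>0\<close>.\<close>

definition homog :: "'f laurent set" where
  "homog = {lmon a * yh ^ j * c | a j c W. a \<in> xexps \<and> c \<in> form W}"

text \<open>Position \<open>m\<close> carries the joint weight of \<open>Z\<close> and
  \<open>T\<close>, since \<open>gg\<close> is homogeneous only for that combination; all later
  positions stay \<open>0\<close>.\<close>

definition mdeg :: "expo \<Rightarrow> nat \<Rightarrow> int" where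
  "mdeg \<mu> l = (if l < m then lk \<mu> l else if l = m then wt \<mu> else 0)"

text \<open>On \<open>homog\<close> all exponents of the support share one degree, so any choice
  will do; at \<open>0\<close> the value is arbitrary.\<close>

definition kd :: "'f laurent \<Rightarrow> nat \<Rightarrow> int" where
  "kd b = mdeg (SOME \<mu>. \<mu> \<in> supp b)"

lemma CHAR_prime: "prime CHAR('f)" using p CHAR by simp

lemma p2: "p \<ge> 2" using p by (simp add: prime_ge_2_nat)

lemma s_ge: "s \<ge> 2" and q_pos: "q > 0" and s_le_q: "s \<le> q"
proof -
  show "s \<ge> 2" using p2 by (simp add: s_def)
  show "q > 0" using p2 unfolding q_def by (intro zero_less_power) linarith
  have "p + 1 \<le> 2 * p" using p2 by simp
  also have "\<dots> \<le> p * p" using p2 by (rule mult_right_mono) simp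
  finally have "s \<le> q" unfolding s_def q_def power2_eq_square .
  then show "s \<le> q" .
qed

lemma of_nat_s: "(of_nat s :: 'f laurent) = 1"
proof -
  have "(of_nat p :: 'f laurent) = 0"
    by (metis CHAR CHAR_laurent of_nat_CHAR)
  then show ?thesis by (simp add: s_def)
qed

lemma q_CHAR: "q = CHAR('f) ^ 2"
  by (simp add: q_def CHAR)

lemma coprime_s_p: "coprime s p"
  by (simp add: s_def)

lemma coprime_s_q: "coprime s q"
  unfolding q_def using coprime_s_p by (simp add: coprime_power_right_iff)

lemma wt_add: "wt (a + b) = wt a + wt b"
  by (simp add: wt_def lookup_add algebra_simps)

lemma mdeg_add: "mdeg (a + b) l = mdeg a l + mdeg b l"
  by (simp add: mdeg_def lookup_add wt_add)

lemma lk_Xexp: "lk Xexp l = (if l < m then int s else 0)"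
  by (simp add: Xexp_def lookup_sum lk_unit_exp)

lemma pol_add: "a \<in> pol \<Longrightarrow> b \<in> pol \<Longrightarrow> a + b \<in> pol"
  unfolding pol_def using keys_add[of a b] by blast

lemma pol_mult: "a \<in> pol \<Longrightarrow> b \<in> pol \<Longrightarrow> a * b \<in> pol"
  unfolding pol_def by (fastforce dest!: supp_add_prod simp: lookup_add)

lemma pol_sc [simp]: "sc c \<in> pol"
  by (simp add: pol_def supp_sc)

lemma pol_0 [simp]: "0 \<in> pol" and pol_1 [simp]: "1 \<in> pol"
  using pol_sc[of 0] pol_sc[of 1] by simp_all

lemma pol_minus: "a \<in> pol \<Longrightarrow> b \<in> pol \<Longrightarrow> a - b \<in> pol"
  unfolding pol_def using supp_minus[of a b] by blast

lemma pol_power: "a \<in> pol \<Longrightarrow> a ^ n \<in> pol"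
  by (induction n) (auto intro: pol_mult)

lemma form_pol: "c \<in> form W \<Longrightarrow> c \<in> pol"
  by (simp add: form_def)

lemma form_add: "a \<in> form W \<Longrightarrow> b \<in> form W \<Longrightarrow> a + b \<in> form W"
  using keys_add[of a b] by (auto simp: form_def pol_add)

lemma form_minus: "a \<in> form W \<Longrightarrow> b \<in> form W \<Longrightarrow> a - b \<in> form W"
  using supp_minus[of a b] by (auto simp: form_def pol_minus)

lemma form_mult: "a \<in> form W \<Longrightarrow> b \<in> form W' \<Longrightarrow> a * b \<in> form (W + W')"
  unfolding form_def by (auto simp: pol_mult wt_add dest!: supp_add_prod)

lemma form_0 [simp]: "0 \<in> form W"
  by (simp add: form_def)

lemma form_sc [simp]: "sc c \<in> form 0"
  by (simp add: form_def supp_sc wt_def)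

lemma form_1 [simp]: "1 \<in> form 0"
  using form_sc[of 1] by simp

lemma form_sc_mult: "a \<in> form W \<Longrightarrow> sc c * a \<in> form W"
  using form_mult[OF form_sc] by simp

lemma form_power: "a \<in> form W \<Longrightarrow> a ^ n \<in> form (int n * W)"
proof (induction n)
  case (Suc n)
  then show ?case using form_mult[of a W "a ^ n" "int n * W"] by (simp add: algebra_simps)
qed simp

lemma form_sum: "(\<And>i. i \<in> I \<Longrightarrow> h i \<in> form W) \<Longrightarrow> sum h I \<in> form W"
  by (induction I rule: infinite_finite_induct) (auto intro: form_add)

lemma form_zz: "zz \<in> form (int s)" and form_tt: "tt \<in> form (int q)"
  by (simp_all add: form_def pol_def zz_def tt_def xvar_def wt_def lk_unit_exp)

lemma form_zq: "zz ^ q \<in> form (int (q * s))" and form_ts: "tt ^ s \<in> form (int (q * s))"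
  using form_power[OF form_zz, of q] form_power[OF form_tt, of s] by (simp_all add: mult.commute)

lemma form_gg: "gg \<in> form (int (q * s))"
  unfolding gg_def by (intro form_minus form_zq form_ts)

lemma homogI: "a \<in> xexps \<Longrightarrow> c \<in> form W \<Longrightarrow> lmon a * yh ^ j * c \<in> homog"
  by (auto simp: homog_def)

lemma homogE:
  assumes "b \<in> homog"
  obtains a j c W where "a \<in> xexps" "c \<in> form W" "b = lmon a * yh ^ j * c"
  using assms by (auto simp: homog_def)

lemma xexps_0 [simp]: "0 \<in> xexps" by (simp add: xexps_def)

lemma xexps_add: "a \<in> xexps \<Longrightarrow> b \<in> xexps \<Longrightarrow> a + b \<in> xexps"
  by (simp add: xexps_def lookup_add)

lemma homog_form: "c \<in> form W \<Longrightarrow> c \<in> homog"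
  using homogI[of 0 c W 0] by simp

lemma homog_lmon: "a \<in> xexps \<Longrightarrow> lmon a \<in> homog"
  using homogI[of a 1 0 0] by simp

lemma homog_yh: "yh \<in> homog"
  using homogI[of 0 1 0 1] by simp

lemma homog_yh_power: "yh ^ j \<in> homog"
  using homogI[of 0 1 0 j] by simp

lemma homog_mult: "b \<in> homog \<Longrightarrow> b' \<in> homog \<Longrightarrow> b * b' \<in> homog"
proof -
  assume "b \<in> homog" "b' \<in> homog"
  then obtain a j c W a' j' c' W' where *: "a \<in> xexps" "c \<in> form W" "b = lmon a * yh ^ j * c"
     "a' \<in> xexps" "c' \<in> form W'" "b' = lmon a' * yh ^ j' * c'" by (metis homogE)
  then have "b * b' = lmon (a + a') * yh ^ (j + j') * (c * c')"
    by (simp add: power_add algebra_simps flip: lmon_mult)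
  then show ?thesis using * by (metis form_mult homogI xexps_add)
qed

lemma homog_power: "b \<in> homog \<Longrightarrow> b ^ n \<in> homog"
  using homog_form[OF form_1] by (induction n) (auto intro: homog_mult)

lemma gg_nonzero: "gg \<noteq> 0"
proof
  assume "gg = 0"
  then have "zz ^ q = tt ^ s" by (simp add: gg_def)
  then have "unit_exp m (int q) = unit_exp (m + 1) (int s)"
    unfolding zz_def tt_def xvar_power by (metis singletonD singletonI supp_lmon)
  then have "lk (unit_exp m (int q)) m = lk (unit_exp (m + 1) (int s)) m" by simp
  then show False using q_pos by (simp add: lk_unit_exp)
qed

lemma zz_nonzero [simp]: "zz \<noteq> 0" and tt_nonzero [simp]: "tt \<noteq> 0"
  by (simp_all add: zz_def tt_def)

lemma yh_nonzero: "yh \<noteq> 0"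
  using gg_nonzero by (simp add: yh_def Xinv_def)

lemma lmon_Xexp_yh: "lmon Xexp * yh = gg ^ p"
  by (simp add: yh_def Xinv_def mult.assoc[symmetric] lmon_mult)

text \<open>A relation, so that \<open>0\<close> is homogeneous of every degree and products need no
  nonvanishing hypothesis.\<close>

definition hdeg :: "'f laurent \<Rightarrow> (nat \<Rightarrow> int) \<Rightarrow> bool" where
  "hdeg b \<theta> \<longleftrightarrow> (\<forall>\<mu>\<in>supp b. mdeg \<mu> = \<theta>)"

lemma hdeg_mult: "hdeg a \<theta> \<Longrightarrow> hdeg b \<theta>' \<Longrightarrow> hdeg (a * b) (\<lambda>l. \<theta> l + \<theta>' l)"
  unfolding hdeg_def by (auto simp: mdeg_add dest!: supp_add_prod)

lemma hdeg_form: "c \<in> form W \<Longrightarrow> hdeg c (\<lambda>l. if l = m then W else 0)"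
  by (auto simp: hdeg_def form_def pol_def mdeg_def)

lemma hdeg_lmon: "hdeg (lmon \<mu>) (mdeg \<mu>)"
  by (simp add: hdeg_def)

lemma hdeg_power: "hdeg a \<theta> \<Longrightarrow> hdeg (a ^ n) (\<lambda>l. int n * \<theta> l)"
proof (induction n)
  case 0
  have "mdeg 0 = (\<lambda>l. 0)" by (auto simp: mdeg_def wt_def)
  then show ?case by (simp add: hdeg_def)
next
  case (Suc n)
  have "hdeg (a * a ^ n) (\<lambda>l. \<theta> l + int n * \<theta> l)"
    by (intro hdeg_mult Suc)
  then show ?case by (simp add: algebra_simps)
qed

lemma kd_eq: "hdeg b \<theta> \<Longrightarrow> b \<noteq> 0 \<Longrightarrow> kd b = \<theta>"
  unfolding kd_def hdeg_def by (metis keys_eq_empty some_in_eq)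

lemma hdeg_yh: "hdeg yh (\<lambda>l. if l < m then - int s else if l = m then int (p * q * s) else 0)"
proof -
  have "gg ^ p \<in> form (int (p * q * s))"
    using form_power[OF form_gg, of p] by (simp add: algebra_simps)
  from hdeg_mult[OF hdeg_lmon hdeg_form[OF this], of "- Xexp"]
  show ?thesis unfolding yh_def Xinv_def
    by (rule back_subst[where P = "hdeg _"]) (auto simp: fun_eq_iff mdeg_def wt_def lk_Xexp)
qed

text \<open>The degree of \<open>lmon a * yh ^ j * c\<close>. If \<open>a\<close> vanishes at some
  \<open>l < m\<close>, the entry there is a nonpositive multiple of \<open>s\<close>; the
  divisibility arguments rest on this.\<close>

definition bdeg :: "expo \<Rightarrow> nat \<Rightarrow> int \<Rightarrow> nat \<Rightarrow> int" where
  "bdeg a j W l = (if l < m then lk a l - int s * int j else if l = m then int (p * q * s) * int j + W else 0)"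

lemma hdeg_homog:
  assumes "a \<in> xexps" "c \<in> form W"
  shows "hdeg (lmon a * yh ^ j * c) (bdeg a j W)"
proof -
  have "hdeg (lmon a * yh ^ j * c) (\<lambda>l. mdeg a l + int j * (if l < m then - int s else if l = m then int (p * q * s) else 0)
     + (if l = m then W else 0))"
    by (intro hdeg_mult hdeg_power hdeg_lmon hdeg_yh hdeg_form assms)
  then show ?thesis
    by (rule back_subst[where P = "hdeg _"])
       (use assms in \<open>auto simp: fun_eq_iff mdeg_def wt_def bdeg_def xexps_def\<close>)
qed

lemma kd_homog:
  assumes "a \<in> xexps" "c \<in> form W" "lmon a * yh ^ j * c \<noteq> 0"
  shows "kd (lmon a * yh ^ j * c) = bdeg a j W"
  using hdeg_homog[OF assms(1,2)] assms(3) by (rule kd_eq)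

lemma hdeg_kd: "b \<in> homog \<Longrightarrow> hdeg b (kd b)"
  by (metis hdeg_homog homogE kd_eq hdeg_def keys_zero empty_iff)

lemma kd_power: "a \<in> homog \<Longrightarrow> a \<noteq> 0 \<Longrightarrow> kd (a ^ n) = (\<lambda>l. int n * kd a l)"
  by (intro kd_eq hdeg_power hdeg_kd) auto

lemma kd_form: "c \<in> form W \<Longrightarrow> c \<noteq> 0 \<Longrightarrow> kd c = (\<lambda>l. if l = m then W else 0)"
  by (intro kd_eq hdeg_form)

text \<open>The weight \<open>- deg\<^sub>k\<close> has top component at \<open>0\<close>: this sets the \<open>k\<close>-th variable to zero.\<close>

definition spec :: "nat \<Rightarrow> 'f laurent \<Rightarrow> 'f laurent" where
  "spec k = top_part (\<lambda>\<mu>. - real_of_int (lk \<mu> k)) 0"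

lemma weight_neg: "weight (\<lambda>\<mu>. - real_of_int (lk \<mu> k))"
  by standard (simp add: lookup_add)

definition nonneg :: "nat \<Rightarrow> 'f laurent set" where
  "nonneg k = below (\<lambda>\<mu>. - real_of_int (lk \<mu> k)) 0"

lemma nonneg_iff: "a \<in> nonneg k \<longleftrightarrow> (\<forall>\<mu>\<in>supp a. lk \<mu> k \<ge> 0)"
  by (simp add: nonneg_def below_def)

lemma spec_mult: "a \<in> nonneg k \<Longrightarrow> b \<in> nonneg k \<Longrightarrow> spec k (a * b) = spec k a * spec k b"
  using weight.top_part_mult[OF weight_neg, of a k 0 b 0] by (simp add: spec_def nonneg_def)

lemma nonneg_mult: "a \<in> nonneg k \<Longrightarrow> b \<in> nonneg k \<Longrightarrow> a * b \<in> nonneg k"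
  using weight.below_mult[OF weight_neg, of a k 0 b 0] by (simp add: nonneg_def)

lemma spec_power: "a \<in> nonneg k \<Longrightarrow> spec k (a ^ n) = spec k a ^ n"
  using weight.top_part_power[OF weight_neg, of a k 0 n] by (simp add: spec_def nonneg_def)

lemma nonneg_power: "a \<in> nonneg k \<Longrightarrow> a ^ n \<in> nonneg k"
  using weight.below_power[OF weight_neg, of a k 0 n] by (simp add: nonneg_def)

lemma spec_0: "spec k 0 = 0" by (simp add: spec_def top_part_def)
lemma spec_sum: "spec k (sum h I) = (\<Sum>i\<in>I. spec k (h i))" by (simp add: spec_def top_part_def restr_sum)
lemma spec_sc_mult: "spec k (sc c * a) = sc c * spec k a" by (simp add: spec_def top_part_def restr_sc_mult)
lemma spec_minus: "spec k (a - b) = spec k a - spec k b" by (simp add: spec_def top_part_def restr_minus)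

lemma spec_lmon: "spec k (lmon \<mu>) = (if lk \<mu> k = 0 then lmon \<mu> else 0)"
  by (auto simp: spec_def top_part_def intro!: restr_all restr_none)

lemma pol_nonneg: "c \<in> pol \<Longrightarrow> c \<in> nonneg k"
  by (auto simp: pol_def nonneg_iff)

lemma lmon_nonneg: "lk \<mu> k \<ge> 0 \<Longrightarrow> lmon \<mu> \<in> nonneg k"
  by (simp add: nonneg_iff)

lemma yh_nonneg: "k \<ge> m \<Longrightarrow> yh \<in> nonneg k"
  unfolding yh_def Xinv_def
  by (intro nonneg_mult nonneg_power lmon_nonneg pol_nonneg form_pol[OF form_gg]) (simp add: lk_Xexp)

text \<open>On \<open>z = 0\<close> or \<open>t = 0\<close> exactly one of the two monomials of
  \<open>gg\<close> survives.\<close>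

lemma spec_yh: "k = m \<or> k = m + 1 \<Longrightarrow> spec k yh \<noteq> 0"
proof -
  assume k: "k = m \<or> k = m + 1"
  have "spec k gg \<noteq> 0"
    using k s_ge q_pos unfolding gg_def zz_def tt_def xvar_power spec_minus spec_lmon
    by (auto simp: lk_unit_exp)
  moreover have "spec k yh = lmon (- Xexp) * spec k gg ^ p"
    unfolding yh_def Xinv_def using k
    using pol_nonneg[OF form_pol[OF form_gg], of k] lmon_nonneg[of "- Xexp" k]
    by (auto simp: spec_mult spec_power nonneg_power spec_lmon lk_Xexp)
  ultimately show ?thesis by simp
qed

lemma homog_nonneg: "k \<ge> m \<Longrightarrow> b \<in> homog \<Longrightarrow> b \<in> nonneg k"
  by (elim homogE) (auto simp: nonneg_mult nonneg_power yh_nonneg lmon_nonneg pol_nonneg form_pol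
     xexps_def)

lemma form_divide:
  assumes c: "c \<in> form W" and k: "k = m \<or> k = m + 1" and sp: "spec k c = 0"
  shows "\<exists>W' c1. c1 \<in> form W' \<and> c = xvar k * c1"
proof -
  define c1 where "c1 = lmon (- unit_exp k 1) * c"
  have e: "c = xvar k * c1" by (simp add: c1_def xvar_def mult.assoc[symmetric] lmon_mult)
  have pos: "lk \<mu> k \<ge> 1" if "\<mu> \<in> supp c" for \<mu>
  proof -
    have "lk (spec k c) \<mu> = 0" using sp by simp
    then have "lk \<mu> k \<noteq> 0" using that by (auto simp: spec_def top_part_def lk_restr)
    moreover have "lk \<mu> k \<ge> 0" using that form_pol[OF c] by (auto simp: pol_def)
    ultimately show ?thesis by linarith
  qed
  have "c1 \<in> form (W - wt (unit_exp k 1))"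
  proof -
    have st: "\<exists>\<nu>\<in>supp c. \<mu> = \<nu> - unit_exp k 1" if "\<mu> \<in> supp c1" for \<mu>
      using that unfolding c1_def supp_lmon_mult by auto
    show ?thesis
      using pos c k unfolding form_def pol_def
      by (fastforce dest!: st simp: lookup_minus lk_unit_exp wt_def algebra_simps)
  qed
  then show ?thesis using e by blast
qed

text \<open>The factors \<open>lmon a\<close> and \<open>yh\<close> survive the specialization, so
  the vanishing comes from the form \<open>c\<close>, which is then divisible by the
  variable.\<close>

lemma homog_divide:
  assumes b: "b \<in> homog" and k: "k = m \<or> k = m + 1" and sp: "spec k b = 0"
  shows "\<exists>b1\<in>homog. b = xvar k * b1"
proof -
  obtain a j c W where *: "a \<in> xexps" "c \<in> form W" "b = lmon a * yh ^ j * c" using b by (rule homogE)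
  have "spec k b = lmon a * spec k yh ^ j * spec k c"
    unfolding *(3) using * k
    using yh_nonneg[of k] lmon_nonneg[of a k] pol_nonneg[OF form_pol[OF *(2)], of k]
    by (auto simp: spec_mult spec_power nonneg_mult nonneg_power xexps_def spec_lmon)
  then have "spec k c = 0" using sp spec_yh[OF k] by simp
  then obtain W' c1 where "c1 \<in> form W'" "c = xvar k * c1" using form_divide[OF *(2) k] by blast
  then show ?thesis using * homogI[of a c1 W' j] by (auto simp: mult_ac)
qed

lemma lmon_prod:
  assumes "a \<in> xexps"
  shows "lmon a = (\<Prod>l<m. xvar l ^ nat (lk a l) :: 'f laurent)"
proof -
  have "(lmon a :: 'f laurent) = (\<Prod>l<n. xvar l ^ nat (lk a l))"
    if "a \<in> xexps" "\<forall>l\<ge>n. lk a l = 0" for n a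
    using that
  proof (induction n arbitrary: a)
    case 0
    then have "a = 0" by (intro poly_mapping_eqI) auto
    then show ?case by simp
  next
    case (Suc n)
    define b where "b = a - unit_exp n (lk a n)"
    have b: "b \<in> xexps" "\<forall>l\<ge>n. lk b l = 0" "\<And>l. l < n \<Longrightarrow> lk b l = lk a l"
      using Suc.prems by (auto simp: b_def xexps_def lookup_minus lk_unit_exp)
    have "(lmon a :: 'f laurent) = lmon b * xvar n ^ nat (lk a n)"
      using Suc.prems by (simp add: xvar_power lmon_mult b_def xexps_def)
    then show ?case using Suc.IH[OF b(1,2)] b(3) by simp
  qed
  then show ?thesis using assms by (auto simp: xexps_def)
qed

lemma lmon_pol:
  assumes "lmon \<mu> \<in> pol"
  shows "lmon \<mu> = zz ^ nat (lk \<mu> m) * tt ^ nat (lk \<mu> (m + 1))"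
proof -
  have "\<mu> = unit_exp m (lk \<mu> m) + unit_exp (m + 1) (lk \<mu> (m + 1))"
    using assms by (intro poly_mapping_eqI) (auto simp: lookup_add lk_unit_exp pol_def)
  moreover have "lk \<mu> m \<ge> 0" "lk \<mu> (m + 1) \<ge> 0" using assms by (auto simp: pol_def)
  ultimately show ?thesis by (simp add: zz_def tt_def xvar_power lmon_mult)
qed

end

section \<open>Homogeneous exponential maps\<close>

lemma exists_first_nonzero:
  assumes "Polynomial.degree P > 0"
  shows "\<exists>i>0. cf P i \<noteq> 0 \<and> (\<forall>j. 0 < j \<longrightarrow> j < i \<longrightarrow> cf P j = 0)"
proof -
  define i where "i = (LEAST i. i > 0 \<and> cf P i \<noteq> 0)"
  have "Polynomial.degree P > 0 \<and> cf P (Polynomial.degree P) \<noteq> 0"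
    using assms by (metis degree_0 leading_coeff_neq_0 less_irrefl)
  from LeastI[of "\<lambda>i. i > 0 \<and> cf P i \<noteq> 0", OF this]
  have "i > 0 \<and> cf P i \<noteq> 0" unfolding i_def .
  moreover have "cf P j = 0" if "0 < j" "j < i" for j
    using not_less_Least[of j "\<lambda>i. i > 0 \<and> cf P i \<noteq> 0"] that unfolding i_def by blast
  ultimately show ?thesis by blast
qed

text \<open>Only one nonzero summand reaches the maximal degree, so its leading coefficient cannot
  be cancelled.\<close>

lemma degree_sum_ge:
  fixes F :: "'i \<Rightarrow> 'a::comm_ring_1 poly"
  assumes "finite I" "i \<in> I" "F i \<noteq> 0" "inj_on (\<lambda>i. Polynomial.degree (F i)) {i \<in> I. F i \<noteq> 0}"
  shows "Polynomial.degree (sum F I) \<ge> Polynomial.degree (F i)"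
proof -
  define J where "J = {i \<in> I. F i \<noteq> 0}"
  have J: "finite J" "i \<in> J" using assms by (auto simp: J_def)
  define d where "d = Max ((\<lambda>i. Polynomial.degree (F i)) ` J)"
  have "d \<in> (\<lambda>i. Polynomial.degree (F i)) ` J" unfolding d_def using J by (intro Max_in) auto
  then obtain k where k: "k \<in> J" "d = Polynomial.degree (F k)" by auto
  have le: "Polynomial.degree (F l) \<le> d" if "l \<in> J" for l
    unfolding d_def using J that by (intro Max_ge) auto
  have lt: "Polynomial.degree (F l) < d" if "l \<in> J" "l \<noteq> k" for l
  proof -
    have "Polynomial.degree (F l) \<noteq> Polynomial.degree (F k)"
      using assms(4) that k(1) by (auto simp: inj_on_def J_def)
    then show ?thesis using le[OF that(1)] k(2) by linarith
  qed
  have "cf (sum F I) d = (\<Sum>l\<in>J. cf (F l) d)"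
    unfolding coeff_sum J_def by (rule sum.mono_neutral_right) (use assms in auto)
  also have "\<dots> = cf (F k) d + (\<Sum>l\<in>J - {k}. cf (F l) d)"
    by (rule sum.remove[OF J(1) k(1)])
  also have "(\<Sum>l\<in>J - {k}. cf (F l) d) = 0"
    by (rule sum.neutral) (use lt in \<open>auto intro: coeff_eq_0\<close>)
  finally have "cf (sum F I) d \<noteq> 0"
    using k by (auto simp: J_def)
  then have "Polynomial.degree (sum F I) \<ge> d" by (rule le_degree)
  then show ?thesis using le[OF J(2)] by simp
qed

text \<open>The coefficients of \<open>\<Phi>\<close> form an iterative higher derivation. The pair
  \<open>j0\<close>, \<open>\<Delta>\<close> encodes a rational slope without denominators: the
  coefficient at \<open>j\<close> shifts the degree by \<open>j \<Delta> / j0\<close>. Since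
  \<open>\<Phi>\<close> is controlled only on \<open>homog\<close>, additivity is restricted to
  forms of one weight.\<close>

locale homog_exp = asanuma m p fld for m p :: nat and fld :: "'f::field itself" +
  fixes \<Phi> :: "'f laurent \<Rightarrow> 'f laurent poly" and j0 :: nat and \<Delta> :: "nat \<Rightarrow> int"
  assumes \<Phi>_homog: "b \<in> homog \<Longrightarrow> cf (\<Phi> b) j \<in> homog"
    and \<Phi>_0: "b \<in> homog \<Longrightarrow> cf (\<Phi> b) 0 = b"
    and j0_pos: "j0 > 0"
    and \<Phi>_deg: "b \<in> homog \<Longrightarrow> cf (\<Phi> b) j \<noteq> 0 \<Longrightarrow> l \<le> m \<Longrightarrow>
        int j0 * (kd (cf (\<Phi> b) j) l - kd b l) = int j * \<Delta> l"
    and \<Phi>_add: "c \<in> form W \<Longrightarrow> c' \<in> form W \<Longrightarrow> \<Phi> (c + c') = \<Phi> c + \<Phi> c'"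
    and \<Phi>_mult: "b \<in> homog \<Longrightarrow> b' \<in> homog \<Longrightarrow> \<Phi> (b * b') = \<Phi> b * \<Phi> b'"
    and \<Phi>_sc: "\<Phi> (sc k) = [:sc k:]"
    and \<Phi>_iter: "b \<in> homog \<Longrightarrow> cf (\<Phi> (cf (\<Phi> b) j)) i = of_nat (i + j choose i) * cf (\<Phi> b) (i + j)"
    and \<Phi>_yh: "\<Phi> yh = [:yh:]"
    and \<Phi>_nontriv: "\<exists>b\<in>homog. \<Phi> b \<noteq> [:b:]"
begin

section \<open>The degree function of an exponential map\<close>

definition dg :: "'f laurent \<Rightarrow> nat" where "dg b = Polynomial.degree (\<Phi> b)"

lemma \<Phi>_nonzero: "b \<in> homog \<Longrightarrow> b \<noteq> 0 \<Longrightarrow> \<Phi> b \<noteq> 0"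
  using \<Phi>_0 by fastforce

lemma \<Phi>_zero: "\<Phi> 0 = 0"
  using \<Phi>_sc[of 0] by simp

lemma \<Phi>_one: "\<Phi> 1 = 1"
  using \<Phi>_sc[of 1] by (simp add: one_pCons)

lemma dg_mult: "b \<in> homog \<Longrightarrow> b' \<in> homog \<Longrightarrow> b \<noteq> 0 \<Longrightarrow> b' \<noteq> 0 \<Longrightarrow> dg (b * b') = dg b + dg b'"
  by (simp add: dg_def \<Phi>_mult degree_mult_eq \<Phi>_nonzero)

lemma \<Phi>_power: "b \<in> homog \<Longrightarrow> \<Phi> (b ^ n) = \<Phi> b ^ n"
  by (induction n) (simp_all add: \<Phi>_one \<Phi>_mult homog_power)

lemma dg_power: "b \<in> homog \<Longrightarrow> b \<noteq> 0 \<Longrightarrow> dg (b ^ n) = n * dg b"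
  by (induction n) (simp_all add: dg_mult homog_power, simp add: dg_def \<Phi>_one)

lemma dg_sc [simp]: "dg (sc c) = 0"
  by (simp add: dg_def \<Phi>_sc)

lemma homog_sc: "sc c \<in> homog"
  by (rule homog_form[OF form_sc])

lemma dg_sc_mult: "c \<noteq> 0 \<Longrightarrow> b \<in> homog \<Longrightarrow> dg (sc c * b) = dg b"
  by (cases "b = 0") (simp_all add: dg_mult homog_sc)

lemma dg_0_iff: "b \<in> homog \<Longrightarrow> dg b = 0 \<longleftrightarrow> \<Phi> b = [:b:]"
  by (metis \<Phi>_0 degree_eq_zeroE degree_pCons_0 dg_def coeff_pCons_0)

definition lead :: "'f laurent \<Rightarrow> 'f laurent" where "lead b = cf (\<Phi> b) (dg b)"

lemma lead_nonzero: "b \<in> homog \<Longrightarrow> b \<noteq> 0 \<Longrightarrow> lead b \<noteq> 0"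
  using \<Phi>_nonzero by (simp add: lead_def dg_def)

lemma lead_homog: "b \<in> homog \<Longrightarrow> lead b \<in> homog"
  by (simp add: lead_def \<Phi>_homog)

text \<open>By the composition law the top coefficient of \<open>\<Phi> u\<close>, for
  \<open>u = cf (\<Phi> b) j\<close>, is a binomial multiple of the coefficient of
  \<open>\<Phi> b\<close> at \<open>dg u + j\<close>, which is therefore nonzero. For
  \<open>j = dg b\<close> it follows that leading coefficients are fixed.\<close>

lemma dg_coeff: "b \<in> homog \<Longrightarrow> cf (\<Phi> b) j \<noteq> 0 \<Longrightarrow> dg (cf (\<Phi> b) j) + j \<le> dg b"
proof -
  assume b: "b \<in> homog" "cf (\<Phi> b) j \<noteq> 0"
  let ?u = "cf (\<Phi> b) j"
  have "cf (\<Phi> ?u) (dg ?u) \<noteq> 0"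
    using \<Phi>_nonzero[OF \<Phi>_homog[OF b(1)] b(2)] by (simp add: dg_def)
  then have "cf (\<Phi> b) (dg ?u + j) \<noteq> 0"
    unfolding \<Phi>_iter[OF b(1)] by auto
  then show ?thesis unfolding dg_def by (intro le_degree)
qed

lemma dg_lead: "b \<in> homog \<Longrightarrow> b \<noteq> 0 \<Longrightarrow> dg (lead b) = 0"
  using dg_coeff[of b "dg b"] lead_nonzero[of b] by (simp add: lead_def)

text \<open>When \<open>dg (a * b) = 0\<close> this is the factorial closedness of the ring of
  constants.\<close>

lemma dg_dvd_le: "a \<in> homog \<Longrightarrow> b \<in> homog \<Longrightarrow> a * b \<noteq> 0 \<Longrightarrow> dg a \<le> dg (a * b)"
  by (auto simp: dg_mult)

lemma homog_zz: "zz \<in> homog" and homog_tt: "tt \<in> homog" and homog_gg: "gg \<in> homog"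
  by (rule homog_form[OF form_zz] homog_form[OF form_tt] homog_form[OF form_gg])+

lemma unit_exp_xexps: "l < m \<Longrightarrow> k \<ge> 0 \<Longrightarrow> unit_exp l k \<in> xexps"
  by (auto simp: xexps_def lk_unit_exp)

lemma homog_var: "l < m \<Longrightarrow> xvar l \<in> homog"
  unfolding xvar_def by (intro homog_lmon unit_exp_xexps) auto

lemma dg_lmon:
  assumes "a \<in> xexps"
  shows "dg (lmon a) = (\<Sum>l<m. nat (lk a l) * dg (xvar l))"
proof -
  have "dg (\<Prod>l<n. xvar l ^ nat (lk a l)) = (\<Sum>l<n. nat (lk a l) * dg (xvar l)) \<and>
        (\<Prod>l<n. xvar l ^ nat (lk a l)) \<in> homog" if "n \<le> m" for n
    using that
  proof (induction n)
    case 0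
    show ?case using homog_form[OF form_1] dg_sc[of 1] by simp
  next
    case (Suc n)
    then show ?case
      by (simp add: dg_mult homog_mult homog_power homog_var dg_power)
  qed
  then show ?thesis using lmon_prod[OF assms] by simp
qed

lemma dg_xexp_ge:
  assumes a: "a \<in> xexps" and l: "l < m" "lk a l > 0"
  shows "dg (xvar l) \<le> dg (lmon a)"
proof -
  have "1 * dg (xvar l) \<le> nat (lk a l) * dg (xvar l)" using l by (intro mult_right_mono) auto
  then have "dg (xvar l) \<le> nat (lk a l) * dg (xvar l)" by simp
  also have "\<dots> \<le> (\<Sum>l<m. nat (lk a l) * dg (xvar l))"
    using l by (intro member_le_sum) auto
  finally show ?thesis using dg_lmon[OF a] by simp
qed

lemma dg_yh: "dg yh = 0" by (simp add: dg_def \<Phi>_yh)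

lemma dg_decomp:
  assumes "a \<in> xexps" "c \<in> form W" "c \<noteq> 0"
  shows "dg (lmon a * yh ^ j * c) = dg (lmon a) + dg c"
  using assms dg_yh yh_nonzero
  by (simp add: dg_mult homog_mult homog_lmon homog_yh_power homog_form[OF assms(2)] dg_power[OF homog_yh])

lemma \<Phi>_form_sum:
  assumes "finite I" "\<And>i. i \<in> I \<Longrightarrow> h i \<in> form W"
  shows "\<Phi> (sum h I) = (\<Sum>i\<in>I. \<Phi> (h i))"
  using assms
proof (induction I rule: finite_induct)
  case (insert i I)
  then show ?case using \<Phi>_add[of "h i" W "sum h I"] form_sum[of I h W] by simp
qed (simp add: \<Phi>_zero)

lemma \<Phi>_form:
  assumes "c \<in> form W"
  shows "\<Phi> c = (\<Sum>\<mu>\<in>supp c. [:sc (lk c \<mu>):] * (\<Phi> zz ^ nat (lk \<mu> m) * \<Phi> tt ^ nat (lk \<mu> (m + 1))))"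
proof -
  have mf: "lmon \<mu> \<in> form W" if "\<mu> \<in> supp c" for \<mu>
    using assms that by (auto simp: form_def pol_def)
  have "\<Phi> c = \<Phi> (\<Sum>\<mu>\<in>supp c. sc (lk c \<mu>) * lmon \<mu>)"
    using laurent_expand[of c] by simp
  also have "\<dots> = (\<Sum>\<mu>\<in>supp c. \<Phi> (sc (lk c \<mu>) * lmon \<mu>))"
    by (intro \<Phi>_form_sum[of _ _ W] form_sc_mult mf) auto
  also have "\<dots> = (\<Sum>\<mu>\<in>supp c. [:sc (lk c \<mu>):] * (\<Phi> zz ^ nat (lk \<mu> m) * \<Phi> tt ^ nat (lk \<mu> (m + 1))))"
    by (intro sum.cong refl)
      (simp add: lmon_pol[OF form_pol[OF mf]] \<Phi>_mult homog_sc homog_mult homog_power homog_zz homog_tt \<Phi>_sc \<Phi>_power)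
  finally show ?thesis .
qed

lemma form_induct_ker:
  assumes "dg zz = 0" "dg tt = 0" "c \<in> form W"
  shows "dg c = 0"
proof -
  have "Polynomial.degree (\<Phi> zz ^ i * \<Phi> tt ^ j) = 0" for i j
    using assms(1,2) dg_mult[of "zz ^ i" "tt ^ j"] dg_power[OF homog_zz, of i] dg_power[OF homog_tt, of j]
    by (simp add: homog_power homog_zz homog_tt \<Phi>_power \<Phi>_mult dg_def)
  then have "Polynomial.degree ([:sc (lk c \<mu>):] * (\<Phi> zz ^ i * \<Phi> tt ^ j)) \<le> 0" for \<mu> i j
    by simp
  then show ?thesis unfolding dg_def \<Phi>_form[OF assms(3)]
    by (metis (no_types, lifting) degree_sum_le finite_keys le_zero_eq)
qed

text \<open>If \<open>zz\<close> and \<open>tt\<close> are fixed, so is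
  \<open>gg ^ p = lmon Xexp * yh\<close>; factorial closedness then fixes every \<open>X\<close>
  variable, and nothing is left to move.\<close>

lemma not_all_zero:
  assumes "dg zz = 0" "dg tt = 0"
  shows False
proof -
  have "dg gg = 0"
    by (rule form_induct_ker[OF assms form_gg])
  then have X0: "dg (lmon Xexp) = 0"
    using dg_mult[OF homog_lmon homog_yh, of Xexp] dg_power[OF homog_gg, of p] yh_nonzero gg_nonzero
    by (simp add: lmon_Xexp_yh xexps_def lk_Xexp)
  have xv: "\<Phi> (xvar l) = [:xvar l:]" if "l < m" for l
  proof -
    have "dg (xvar l) \<le> dg (lmon Xexp)"
      using that s_ge by (intro dg_xexp_ge) (auto simp: xexps_def lk_Xexp)
    then show ?thesis using X0 dg_0_iff[OF homog_var[OF that]] by simp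
  qed
  have xe: "dg (lmon a) = 0" if "a \<in> xexps" for a
    unfolding dg_lmon[OF that] using xv dg_0_iff[OF homog_var] by simp
  have "\<Phi> b = [:b:]" if b: "b \<in> homog" for b
  proof -
    obtain a j c W where *: "a \<in> xexps" "c \<in> form W" "b = lmon a * yh ^ j * c" using b by (rule homogE)
    have "\<Phi> b = [:lmon a:] * [:yh:] ^ j * [:c:]"
      unfolding *(3) using * xe[OF *(1)] form_induct_ker[OF assms *(2)] dg_0_iff[OF homog_lmon[OF *(1)]] dg_0_iff[OF homog_form[OF *(2)]]
      by (simp add: \<Phi>_mult homog_mult homog_lmon homog_yh_power homog_form[OF *(2)] \<Phi>_power[OF homog_yh] \<Phi>_yh)
    then show ?thesis unfolding *(3) by (simp add: poly_const_pow)
  qed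
  then show False using \<Phi>_nontriv by blast
qed

text \<open>If \<open>z\<^sup>q - \<mu> t\<^sup>s\<close> were fixed, comparing the first nonzero coefficients of \<open>\<Phi> z\<close> and \<open>\<Phi> t\<close>
  would make \<open>t\<close> divide a coefficient of \<open>\<Phi> t\<close>, which has smaller degree.\<close>

lemma no_curve:
  assumes \<mu>: "\<mu> \<noteq> 0" and ker: "dg (zz ^ q - sc \<mu> * tt ^ s) = 0"
  shows False
proof (cases "dg tt = 0")
  case True
  define h where "h = zz ^ q - sc \<mu> * tt ^ s"
  have hf: "h \<in> form (int (q * s))" unfolding h_def by (intro form_minus form_zq form_sc_mult form_ts)
  have "\<Phi> (h + sc \<mu> * tt ^ s) = \<Phi> h + \<Phi> (sc \<mu> * tt ^ s)"
    by (rule \<Phi>_add[OF hf form_sc_mult[OF form_ts]])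
  moreover have "\<Phi> h = [:h:]" using ker dg_0_iff[OF homog_form[OF hf]] by (simp add: h_def)
  moreover have "\<Phi> (sc \<mu> * tt ^ s) = [:sc \<mu> * tt ^ s:]"
    using dg_0_iff[OF homog_tt] True
    by (simp add: \<Phi>_mult homog_sc homog_power homog_tt \<Phi>_sc \<Phi>_power poly_const_pow)
  ultimately have "\<Phi> (zz ^ q) = [:zz ^ q:]" by (simp add: h_def)
  then have "dg (zz ^ q) = 0" by (simp add: dg_def)
  then have "dg zz = 0" using dg_power[OF homog_zz, of q] q_pos by simp
  then show False using True not_all_zero by blast
next
  case False
  define h where "h = zz ^ q - sc \<mu> * tt ^ s"
  have hf: "h \<in> form (int (q * s))" unfolding h_def by (intro form_minus form_zq form_sc_mult form_ts)
  have "\<Phi> (h + sc \<mu> * tt ^ s) = \<Phi> h + \<Phi> (sc \<mu> * tt ^ s)"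
    by (rule \<Phi>_add[OF hf form_sc_mult[OF form_ts]])
  moreover have "\<Phi> h = [:h:]" using ker dg_0_iff[OF homog_form[OF hf]] by (simp add: h_def)
  moreover have "\<Phi> (sc \<mu> * tt ^ s) = [:sc \<mu>:] * \<Phi> tt ^ s"
    by (simp add: \<Phi>_mult homog_sc homog_power homog_tt \<Phi>_sc \<Phi>_power)
  ultimately have e: "\<Phi> zz ^ q = [:h:] + [:sc \<mu>:] * \<Phi> tt ^ s"
    using \<Phi>_power[OF homog_zz, of q] by (simp add: h_def)
  obtain i where i: "i > 0" "cf (\<Phi> tt) i \<noteq> 0" "\<And>j. 0 < j \<Longrightarrow> j < i \<Longrightarrow> cf (\<Phi> tt) j = 0"
    using exists_first_nonzero[of "\<Phi> tt"] False unfolding dg_def by blast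
  define Dt where "Dt = cf (\<Phi> tt) i"
  have "cf (\<Phi> tt ^ s) i = of_nat s * cf (\<Phi> tt) 0 ^ (s - 1) * cf (\<Phi> tt) i"
    using coeff_power_first[OF i(1,3)] by blast
  \<comment> \<open>Here \<open>s = p + 1\<close> matters: the factor \<open>of_nat s\<close> is
    \<open>1\<close>, so the coefficient does not vanish.\<close>
  then have ct: "cf (\<Phi> tt ^ s) i = tt ^ (s - 1) * Dt"
    by (simp add: of_nat_s \<Phi>_0 homog_tt Dt_def)
  have "cf (\<Phi> zz ^ q) i = sc \<mu> * (tt ^ (s - 1) * Dt)"
    unfolding e using i(1) by (simp add: ct) (cases i, simp_all)
  then have eq0: "(if q dvd i then cf (\<Phi> zz) (i div q) ^ q else 0) = sc \<mu> * (tt ^ (s - 1) * Dt)"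
    unfolding coeff_prime_power[OF CHAR_prime q_CHAR] .
  define u where "u = cf (\<Phi> zz) (i div q)"
  have nz: "sc \<mu> * (tt ^ (s - 1) * Dt) \<noteq> 0" using \<mu> i(2) by (simp add: Dt_def)
  then have uq: "u ^ q = sc \<mu> * (tt ^ (s - 1) * Dt)"
    using eq0 unfolding u_def by (metis (full_types))
  have u: "u \<in> homog" unfolding u_def by (rule \<Phi>_homog[OF homog_zz])
  have Dt: "Dt \<in> homog" unfolding Dt_def by (rule \<Phi>_homog[OF homog_tt])
  \<comment> \<open>As \<open>s \<ge> 2\<close>, the right-hand side of \<open>uq\<close> vanishes
    on \<open>t = 0\<close>, hence so does \<open>u\<close>.\<close>
  have "spec (m + 1) u = 0"
  proof -
    have nn: "u \<in> nonneg (m + 1)" "Dt \<in> nonneg (m + 1)" "tt \<in> nonneg (m + 1)"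
      using u Dt homog_tt homog_nonneg by auto
    have "spec (m + 1) (u ^ q) = 0"
      unfolding uq using s_ge nn
      by (simp add: spec_sc_mult spec_mult nonneg_power spec_power)
        (simp add: tt_def xvar_def spec_lmon lk_unit_exp power_0_left)
    then show ?thesis using spec_power[OF nn(1)] by simp
  qed
  then obtain u1 where u1: "u1 \<in> homog" "u = tt * u1"
    using homog_divide[OF u, of "m + 1"] by (auto simp: tt_def)
  \<comment> \<open>Now \<open>t ^ q\<close> divides \<open>u ^ q\<close>, while the right-hand side
    of \<open>uq\<close> displays only \<open>t ^ (s - 1)\<close>. Since \<open>s - 1 < q\<close>,
    at least one factor \<open>t\<close> is left for \<open>Dt\<close>.\<close>
  have "tt ^ (s - 1) * (tt ^ (q - s + 1) * u1 ^ q) = tt ^ q * u1 ^ q"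
  proof -
    have "tt ^ (s - 1) * tt ^ (q - s + 1) = tt ^ q"
      using s_ge s_le_q unfolding power_add[symmetric] by (intro arg_cong[where f = "\<lambda>n. tt ^ n"]) linarith
    then show ?thesis by (simp only: mult.assoc[symmetric])
  qed
  also have "\<dots> = tt ^ (s - 1) * (sc \<mu> * Dt)"
    using uq unfolding u1(2) by (simp add: power_mult_distrib mult_ac)
  finally have e2: "tt ^ (q - s + 1) * u1 ^ q = sc \<mu> * Dt" by simp
  have "dg tt \<le> dg (sc \<mu> * Dt)"
  proof -
    have "sc \<mu> * Dt = tt * (tt ^ (q - s) * u1 ^ q)" using e2 by (simp add: mult_ac)
    moreover have "sc \<mu> * Dt \<noteq> 0" using nz by auto
    ultimately show ?thesis
      using dg_dvd_le[OF homog_tt, of "tt ^ (q - s) * u1 ^ q"] by (simp add: homog_mult homog_power homog_tt u1)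
  qed
  then have "dg tt \<le> dg Dt" using dg_sc_mult[OF \<mu> Dt] by simp
  moreover have "dg Dt + i \<le> dg tt" unfolding Dt_def using i by (intro dg_coeff homog_tt)
  ultimately show False using i(1) by simp
qed

section \<open>Which variables move\<close>

lemma dg_gg_pos: "dg gg > 0"
  using no_curve[of 1] by (auto simp: gg_def)

lemma X_xexps: "Xexp \<in> xexps"
  by (simp add: xexps_def lk_Xexp)

lemma dg_X: "dg (lmon Xexp) = s * (\<Sum>l<m. dg (xvar l))"
  unfolding dg_lmon[OF X_xexps] by (simp add: lk_Xexp sum_distrib_left)

lemma dg_X_gg: "dg (lmon Xexp) = p * dg gg"
  using dg_mult[OF homog_lmon homog_yh, of Xexp] dg_power[OF homog_gg, of p] yh_nonzero gg_nonzero X_xexps dg_yh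
  by (simp add: lmon_Xexp_yh)

text \<open>The element \<open>gg\<close> moves and \<open>yh\<close> does not, so the degree of
  \<open>gg ^ p\<close> must come from \<open>lmon Xexp\<close>.\<close>

lemma exists_moved: "\<exists>i<m. dg (xvar i) > 0"
proof (rule ccontr)
  assume "\<not> ?thesis"
  then have "dg (lmon Xexp) = 0" unfolding dg_X by auto
  then show False using dg_X_gg dg_gg_pos p2 by simp
qed

text \<open>Degrees add over the factors, so each factor of a fixed element is fixed; in particular
  no moved variable divides it.\<close>

lemma ker_shape:
  assumes "u \<in> homog" "u \<noteq> 0" "dg u = 0"
  shows "\<exists>a j c W. a \<in> xexps \<and> c \<in> form W \<and> u = lmon a * yh ^ j * c \<and> c \<noteq> 0 \<and> dg c = 0 \<and>
     (\<forall>l<m. dg (xvar l) > 0 \<longrightarrow> lk a l = 0) \<and> kd u = bdeg a j W"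
proof -
  obtain a j c W where *: "a \<in> xexps" "c \<in> form W" "u = lmon a * yh ^ j * c" using assms(1) by (rule homogE)
  have c: "c \<noteq> 0" using * assms by auto
  have d: "dg (lmon a) = 0" "dg c = 0" using dg_decomp[OF *(1,2) c, of j] assms(3) by (simp_all add: *(3))
  have "lk a l = 0" if "l < m" "dg (xvar l) > 0" for l
  proof -
    have "lk a l \<ge> 0" "\<not> lk a l > 0" using dg_xexp_ge[OF *(1) that(1)] d(1) that *(1) by (auto simp: xexps_def)
    then show ?thesis by linarith
  qed
  then show ?thesis using * c d kd_homog[OF *(1,2)] assms(2) by blast
qed

lemma kd_var: "l < m \<Longrightarrow> l' \<le> m \<Longrightarrow> kd (xvar l) l' = (if l' = l then 1 else 0)"
  unfolding xvar_def by (subst kd_eq[OF hdeg_lmon]) (auto simp: mdeg_def lk_unit_exp wt_def)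

lemma lead_deg: "b \<in> homog \<Longrightarrow> b \<noteq> 0 \<Longrightarrow> l \<le> m \<Longrightarrow>
    int j0 * (kd (lead b) l - kd b l) = int (dg b) * \<Delta> l"
  using \<Phi>_deg[of b "dg b" l] lead_nonzero[of b] by (simp add: lead_def)

lemma lead_shape:
  assumes "b \<in> homog" "b \<noteq> 0"
  shows "\<exists>a j c W. a \<in> xexps \<and> c \<in> form W \<and> lead b = lmon a * yh ^ j * c \<and> c \<noteq> 0 \<and> dg c = 0 \<and>
     (\<forall>l<m. dg (xvar l) > 0 \<longrightarrow> lk a l = 0) \<and> kd (lead b) = bdeg a j W"
  using ker_shape[OF lead_homog lead_nonzero dg_lead] assms by blast

text \<open>The leading coefficients of two moved variables are fixed, so neither variable divides
  them and their degrees at \<open>i\<close> and \<open>l\<close> are \<open>- s\<close> times an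
  exponent of \<open>yh\<close>. Both degree shifts are proportional to the same
  \<open>\<Delta>\<close>, which is impossible for nonnegative exponents.\<close>

lemma unique_moved:
  assumes i: "i < m" "dg (xvar i) > 0" and l: "l < m" "dg (xvar l) > 0"
  shows "i = l"
proof (rule ccontr)
  assume ne: "i \<noteq> l"
  obtain a j W where 1: "\<forall>l<m. dg (xvar l) > 0 \<longrightarrow> lk a l = 0" "kd (lead (xvar i)) = bdeg a j W"
    using lead_shape[OF homog_var[OF i(1)]] by auto
  obtain a' j' W' where 2: "\<forall>l<m. dg (xvar l) > 0 \<longrightarrow> lk a' l = 0" "kd (lead (xvar l)) = bdeg a' j' W'"
    using lead_shape[OF homog_var[OF l(1)]] by auto
  define J \<xi> \<eta> B B' where "J = int j0" and "\<xi> = int (dg (xvar i))" and "\<eta> = int (dg (xvar l))"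
    and "B = int s * int j" and "B' = int s * int j'"
  have e1: "J * (- B - 1) = \<xi> * \<Delta> i" "J * (- B) = \<xi> * \<Delta> l"
    using lead_deg[OF homog_var[OF i(1)], of i] lead_deg[OF homog_var[OF i(1)], of l] i l 1 ne
    by (simp_all add: kd_var bdeg_def J_def \<xi>_def B_def)
  have e2: "J * (- B' - 1) = \<eta> * \<Delta> l" "J * (- B') = \<eta> * \<Delta> i"
    using lead_deg[OF homog_var[OF l(1)], of i] lead_deg[OF homog_var[OF l(1)], of l] i l 2 ne
    by (simp_all add: kd_var bdeg_def J_def \<eta>_def B'_def)
  \<comment> \<open>Cross-multiplication eliminates \<open>\<Delta>\<close>: both sides equal
    \<open>\<xi> \<eta> \<Delta> i \<Delta> l\<close>.\<close>
  have "(J * (- B - 1)) * (J * (- B' - 1)) = (J * (- B)) * (J * (- B'))"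
    unfolding e1 e2 by (simp add: mult_ac)
  then have "J * J * (B + B' + 1) = 0" by (simp add: algebra_simps)
  moreover have "J > 0" "B \<ge> 0" "B' \<ge> 0" using j0_pos by (simp_all add: J_def B_def B'_def)
  ultimately show False by auto
qed

text \<open>This divisibility is incompatible with first nonzero coefficients sitting at powers of \<open>p\<close>.\<close>

lemma coeff_ker_dvd:
  assumes i: "i < m" "dg (xvar i) > 0" and b: "b \<in> homog" "b \<noteq> 0" "kd b i = 0"
    and u: "cf (\<Phi> b) l \<noteq> 0" "dg (cf (\<Phi> b) l) = 0"
  shows "s dvd l"
proof -
  obtain a j W where 1: "\<forall>l<m. dg (xvar l) > 0 \<longrightarrow> lk a l = 0" "kd (lead (xvar i)) = bdeg a j W"
    using lead_shape[OF homog_var[OF i(1)]] by auto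
  obtain a' j' W' where 2: "\<forall>l<m. dg (xvar l) > 0 \<longrightarrow> lk a' l = 0" "kd (cf (\<Phi> b) l) = bdeg a' j' W'"
    using ker_shape[OF \<Phi>_homog[OF b(1)] u] by auto
  \<comment> \<open>The lead of \<open>xvar i\<close> calibrates \<open>\<Delta> i\<close>: its
    shift is \<open>- s j - 1\<close>, prime to \<open>s\<close>, because \<open>xvar i\<close> has
    degree \<open>1\<close> at \<open>i\<close>. The shift of \<open>b\<close>, of degree
    \<open>0\<close> there, is a multiple of \<open>s\<close>.\<close>
  have e1: "int j0 * (- (int s * int j) - 1) = int (dg (xvar i)) * \<Delta> i"
    using lead_deg[OF homog_var[OF i(1)], of i] i 1 by (simp add: kd_var bdeg_def)
  have e2: "int j0 * (- (int s * int j')) = int l * \<Delta> i"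
    using \<Phi>_deg[OF b(1) u(1), of i] i 2 b by (simp add: bdeg_def)
  have "int j0 * (int (dg (xvar i)) * (- (int s * int j'))) = int (dg (xvar i)) * (int j0 * (- (int s * int j')))"
    by (simp add: algebra_simps)
  also have "\<dots> = int l * (int (dg (xvar i)) * \<Delta> i)" unfolding e2 by (simp add: algebra_simps)
  also have "\<dots> = int j0 * (int l * (- (int s * int j) - 1))" unfolding e1[symmetric] by (simp add: algebra_simps)
  finally have "int (dg (xvar i)) * (- (int s * int j')) = int l * (- (int s * int j) - 1)"
    using j0_pos by (subst (asm) mult_left_cancel) auto
  then have "int l = int s * (int (dg (xvar i)) * int j' - int l * int j)" by (simp add: algebra_simps)
  then have "int s dvd int l" by (metis dvd_triv_left)
  then show ?thesis by simp
qed

text \<open>Write \<open>i = p ^ k * u\<close> with \<open>u\<close> prime to \<open>p\<close>. If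
  \<open>u > 1\<close>, composing the coefficient at \<open>p ^ k\<close> with that at
  \<open>i - p ^ k\<close> gives the one at \<open>i\<close> times a binomial prime to
  \<open>p\<close>, although the coefficient at \<open>p ^ k\<close> is zero.\<close>

lemma first_coeff_power:
  assumes b: "b \<in> homog" and i: "i > 0" "cf (\<Phi> b) i \<noteq> 0" "\<And>j. 0 < j \<Longrightarrow> j < i \<Longrightarrow> cf (\<Phi> b) j = 0"
  shows "\<exists>k. i = p ^ k"
proof -
  define k where "k = multiplicity p i"
  obtain u where u: "i = p ^ k * u" "\<not> p dvd u"
    using multiplicity_decompose'[of i p] i(1) p unfolding k_def by (metis gr_implies_not0 not_prime_unit)
  have u0: "u > 0" using u(1) i(1) by (cases u) auto
  show ?thesis
  proof (cases "u = 1")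
    case True
    then show ?thesis using u by auto
  next
    case False
    define j where "j = p ^ k"
    have j: "0 < j" "j < i" using u u0 False p2 by (auto simp: j_def)
    have "of_nat (i - j + j choose (i - j)) * cf (\<Phi> b) (i - j + j) = cf (\<Phi> (cf (\<Phi> b) j)) (i - j)"
      using \<Phi>_iter[OF b] by simp
    also have "\<dots> = 0" using i(3)[OF j] by (simp add: \<Phi>_zero)
    finally have "of_nat (i choose (i - j)) = (0 :: 'f laurent)" using j i(2) by simp
    then have "p dvd (i choose j)"
      using j by (simp add: of_nat_eq_0_iff_char_dvd CHAR binomial_symmetric[of j i])
    \<comment> \<open>The binomial count known from the combinatorial proof of Sylow's
      theorem.\<close>
    moreover have "multiplicity p (i choose j) = multiplicity p u"
      unfolding u(1) j_def by (rule const_p_fac[OF u0 p])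
    moreover have "multiplicity p u = 0" using u(2) by (rule not_dvd_imp_multiplicity_0)
    moreover have "i choose j \<noteq> 0" using j by simp
    ultimately show ?thesis
      using p by (metis multiplicity_eq_zero_iff not_prime_unit)
  qed
qed

section \<open>Lower bounds for the degrees of forms\<close>

definition m0 :: nat where
  "m0 = (if dg zz = 0 then dg tt else if dg tt = 0 then dg zz else min (dg zz) (dg tt))"

lemma m0_pos: "m0 > 0" and m0_le: "dg zz > 0 \<Longrightarrow> m0 \<le> dg zz" "dg tt > 0 \<Longrightarrow> m0 \<le> dg tt"
  and m0_eq: "m0 = dg zz \<or> m0 = dg tt"
proof -
  have "dg zz > 0 \<or> dg tt > 0" using not_all_zero by blast
  then show "m0 > 0" "dg zz > 0 \<Longrightarrow> m0 \<le> dg zz" "dg tt > 0 \<Longrightarrow> m0 \<le> dg tt" "m0 = dg zz \<or> m0 = dg tt"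
    by (auto simp: m0_def min_def)
qed

text \<open>What remains of the naive expectation that a form has the largest degree of its
  monomials: a moving form costs at least one moving variable, and \<open>gg\<close> at least
  \<open>s\<close> of them, as \<open>s \<le> q\<close>.\<close>

definition no_cancellation :: bool where
  "no_cancellation \<longleftrightarrow> (\<forall>W. \<forall>c\<in>form W. c \<noteq> 0 \<longrightarrow> dg c = 0 \<or> dg c \<ge> m0) \<and> dg gg \<ge> s * m0"

text \<open>Take whichever of \<open>zz\<close>, \<open>tt\<close> has degree \<open>m0\<close>. Its
  first nonzero coefficient has degree below \<open>m0\<close>, too small to contain a moving form
  or the moved \<open>X\<close> variable, so it is fixed. Then \<open>s\<close> divides its index,
  which is a power of \<open>p\<close>.\<close>

lemma contradiction_if_no_cancellation:
  assumes no_cancellation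
  shows False
proof -
  note nc = assms[unfolded no_cancellation_def]
  obtain b W where b: "b \<in> form W" "b \<noteq> 0" "dg b = m0"
    using m0_eq form_zz form_tt zz_nonzero tt_nonzero by metis
  have bh: "b \<in> homog" using b homog_form by blast
  obtain i where i: "i < m" "dg (xvar i) > 0" using exists_moved by blast
  obtain l where l: "l > 0" "cf (\<Phi> b) l \<noteq> 0" "\<And>j. 0 < j \<Longrightarrow> j < l \<Longrightarrow> cf (\<Phi> b) j = 0"
    using exists_first_nonzero[of "\<Phi> b"] b m0_pos by (auto simp: dg_def)
  define u where "u = cf (\<Phi> b) l"
  have u: "u \<in> homog" "u \<noteq> 0" "dg u < m0"
    using \<Phi>_homog[OF bh] dg_coeff[OF bh l(2)] l b(3) by (auto simp: u_def)
  obtain a j c W' where *: "a \<in> xexps" "c \<in> form W'" "u = lmon a * yh ^ j * c" using u(1) by (rule homogE)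
  have c: "c \<noteq> 0" using * u by auto
  have d: "dg (lmon a) + dg c < m0" using dg_decomp[OF *(1,2) c, of j] u(3) by (simp add: *(3))
  have c0: "dg c = 0" proof -
    have "dg c = 0 \<or> m0 \<le> dg c" using nc *(2) c by blast
    then show ?thesis using d by linarith
  qed
  \<comment> \<open>Only \<open>xvar i\<close> moves among the \<open>X\<close> variables, so it
    carries the whole degree of \<open>gg ^ p\<close>; this makes it cost at least
    \<open>m0\<close>.\<close>
  have xi: "s * dg (xvar i) = p * dg gg"
  proof -
    have "(\<Sum>l<m. dg (xvar l)) = (\<Sum>l\<in>{i}. dg (xvar l))"
      by (rule sum.mono_neutral_right) (use i unique_moved in auto)
    then show ?thesis using dg_X dg_X_gg by simp
  qed
  have "s * m0 \<le> p * dg gg"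
    using nc p2 by (metis One_nat_def Suc_leI le_trans mult_le_mono1 nat_mult_1 p prime_gt_0_nat)
  then have "m0 \<le> dg (xvar i)" using xi s_ge by (metis mult_le_cancel1 not_numeral_le_zero gr0I)
  then have ai: "lk a i = 0"
  proof -
    assume "m0 \<le> dg (xvar i)"
    then have "lk a i \<ge> 0" "\<not> lk a i > 0" using dg_xexp_ge[OF *(1) i(1)] d *(1) by (auto simp: xexps_def)
    then show ?thesis by linarith
  qed
  have "nat (lk a l) * dg (xvar l) = 0" if "l < m" for l
    using unique_moved[OF i that] ai by (cases "dg (xvar l) = 0") auto
  then have "dg (lmon a) = 0"
    unfolding dg_lmon[OF *(1)] by (auto intro!: sum.neutral)
  then have "dg u = 0" using dg_decomp[OF *(1,2) c, of j] c0 by (simp add: *(3))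
  then have "s dvd l"
    using coeff_ker_dvd[OF i bh b(2) _ l(2)] i kd_form[OF b(1,2)] by (simp add: u_def)
  moreover obtain k where "l = p ^ k" using first_coeff_power[OF bh l] by blast
  moreover have "coprime s (p ^ k)" using coprime_s_p by simp
  ultimately have "s = 1" by (metis coprime_absorb_left nat_dvd_1_iff_1)
  then show False using s_ge by simp
qed

text \<open>If no nonconstant form is fixed, multihomogeneity forces the degree of a form to be
  proportional to its weight.\<close>

lemma no_cancellation_if_ker_trivial:
  assumes triv: "\<And>W c. c \<in> form W \<Longrightarrow> c \<noteq> 0 \<Longrightarrow> dg c = 0 \<Longrightarrow> W = 0"
  shows no_cancellation
proof -
  obtain i where i: "i < m" "dg (xvar i) > 0" using exists_moved by blast
  \<comment> \<open>As \<open>yh\<close> has degree \<open>- s\<close> at \<open>i\<close> and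
    \<open>p q s\<close> at \<open>m\<close>, this combination of the two coordinates vanishes on
    \<open>yh\<close>, so the unknown exponent \<open>j\<close> drops out.\<close>
  define E where "E = \<Delta> m + int (p * q) * \<Delta> i"
  have E: "int j0 * W = - int (dg c) * E" if c: "c \<in> form W" "c \<noteq> 0" for c W
  proof -
    obtain a j c' W' where *: "\<forall>l<m. dg (xvar l) > 0 \<longrightarrow> lk a l = 0" "kd (lead c) = bdeg a j W'"
      "c' \<in> form W'" "c' \<noteq> 0" "dg c' = 0"
      using lead_shape[OF homog_form[OF c(1)] c(2)] by blast
    have "W' = 0" using triv * by blast
    then have "int j0 * (int (p * q * s) * int j - W) = int (dg c) * \<Delta> m"
      using lead_deg[OF homog_form[OF c(1)] c(2), of m] * kd_form[OF c] by (simp add: bdeg_def)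
    moreover have "int j0 * (- (int s * int j)) = int (dg c) * \<Delta> i"
      using lead_deg[OF homog_form[OF c(1)] c(2), of i] i * kd_form[OF c] by (simp add: bdeg_def)
    moreover have "int (dg c) * E = int (dg c) * \<Delta> m + int (p * q) * (int (dg c) * \<Delta> i)"
      by (simp add: E_def algebra_simps)
    ultimately have "int (dg c) * E = int j0 * (int (p * q * s) * int j - W) + int (p * q) * (int j0 * (- (int s * int j)))"
      by simp
    then show ?thesis by (simp add: algebra_simps)
  qed
  \<comment> \<open>The constant \<open>E\<close> is common to all forms; comparison with
    \<open>zz\<close>, of weight \<open>s\<close>, eliminates it.\<close>
  have Wd: "W * int (dg zz) = int s * int (dg c)" if c: "c \<in> form W" "c \<noteq> 0" for c W
  proof -
    have "int j0 * W * (int (dg zz) * E) = (- int (dg c) * E) * (int (dg zz) * E)"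
      using E[OF c] by simp
    also have "\<dots> = int (dg c) * E * (- int (dg zz) * E)" by simp
    also have "\<dots> = int (dg c) * E * (int j0 * int s)" using E[OF form_zz] by simp
    finally have "int j0 * E * (W * int (dg zz)) = int j0 * E * (int s * int (dg c))" by (simp add: algebra_simps)
    moreover have "E \<noteq> 0" using E[OF form_zz] j0_pos s_ge by auto
    ultimately show ?thesis using j0_pos by simp
  qed
  have z0: "dg zz > 0" using triv[OF form_zz] s_ge by fastforce
  have ge: "k * m0 \<le> dg c" if c: "c \<in> form W" "c \<noteq> 0" "W \<ge> int s * int k" for c W k
  proof -
    have "int s * (int k * int (dg zz)) \<le> W * int (dg zz)"
      using mult_right_mono[OF c(3), of "int (dg zz)"] by (simp add: mult.assoc)
    also have "\<dots> = int s * int (dg c)" by (rule Wd[OF c(1,2)])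
    finally have "int k * int (dg zz) \<le> int (dg c)" using s_ge by simp
    then have "k * dg zz \<le> dg c" by (simp flip: of_nat_mult)
    moreover have "k * m0 \<le> k * dg zz" using m0_le(1)[OF z0] by simp
    ultimately show ?thesis by linarith
  qed
  have "dg c = 0 \<or> m0 \<le> dg c" if c: "c \<in> form W" "c \<noteq> 0" for c W
  proof (cases "W = 0")
    case True
    then show ?thesis using Wd[OF c] s_ge by simp
  next
    case False
    obtain \<mu> where \<mu>: "\<mu> \<in> supp c" using c(2) by fastforce
    then have W: "W = int s * lk \<mu> m + int q * lk \<mu> (m + 1)" and nn: "lk \<mu> m \<ge> 0" "lk \<mu> (m + 1) \<ge> 0"
      using c(1) by (auto simp: form_def wt_def pol_def)
    have "int s * (lk \<mu> m + lk \<mu> (m + 1)) \<le> W"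
      unfolding W using s_le_q nn(2) mult_right_mono[of "int s" "int q" "lk \<mu> (m + 1)"] by (simp add: distrib_left)
    moreover have "lk \<mu> m + lk \<mu> (m + 1) \<ge> 1" using nn W False by (cases "lk \<mu> m = 0") auto
    then have "int s * 1 \<le> int s * (lk \<mu> m + lk \<mu> (m + 1))" by (intro mult_left_mono) auto
    ultimately show ?thesis using ge[OF c, of 1] by simp
  qed
  moreover have "s * m0 \<le> dg gg"
  proof (rule ge[OF form_gg gg_nonzero])
    have "s * s \<le> q * s" using s_le_q by simp
    then show "int s * int s \<le> int (q * s)" by (metis of_nat_le_iff of_nat_mult)
  qed
  ultimately show ?thesis unfolding no_cancellation_def by blast
qed

lemma supp_gg: "unit_exp m (int q) \<in> supp gg" "unit_exp (m + 1) (int s) \<in> supp gg"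
proof -
  have ne: "unit_exp m (int q) \<noteq> unit_exp (m + 1) (int s)"
  proof
    assume "unit_exp m (int q) = unit_exp (m + 1) (int s)"
    then have "lk (unit_exp m (int q)) m = lk (unit_exp (m + 1) (int s)) m" by simp
    then show False using q_pos by (simp add: lk_unit_exp)
  qed
  show "unit_exp m (int q) \<in> supp gg" "unit_exp (m + 1) (int s) \<in> supp gg"
    using ne unfolding in_keys_iff gg_def zz_def tt_def xvar_power lookup_minus lmon_def lookup_single when_def
    by (metis diff_zero zero_neq_one, metis diff_0 neg_equal_0_iff_equal zero_neq_one)
qed

text \<open>Two monomials of one weight differ by a multiple of \<open>(q, - s)\<close> in the
  exponents of \<open>z\<close> and \<open>t\<close>. Under the hypothesis their images have
  different degrees, so the largest one survives in the sum.\<close>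

lemma no_cancellation_if_generic:
  assumes ne: "q * dg zz \<noteq> s * dg tt"
  shows no_cancellation
proof -
  define dm where "dm \<mu> = nat (lk \<mu> m) * dg zz + nat (lk \<mu> (m + 1)) * dg tt" for \<mu> :: expo
  define F where "F c \<mu> = [:sc (lk c \<mu>):] * (\<Phi> zz ^ nat (lk \<mu> m) * \<Phi> tt ^ nat (lk \<mu> (m + 1)))" for c \<mu>
  have nz: "\<Phi> zz \<noteq> 0" "\<Phi> tt \<noteq> 0" by (simp_all add: \<Phi>_nonzero homog_zz homog_tt)
  have F: "F c \<mu> \<noteq> 0 \<and> Polynomial.degree (F c \<mu>) = dm \<mu>" if "\<mu> \<in> supp c" for c \<mu>
    using that nz by (simp add: F_def dm_def degree_mult_eq degree_power_eq dg_def in_keys_iff)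
  have inj: "inj_on dm (supp c)" if c: "c \<in> form W" for c W
  proof (rule inj_onI)
    fix \<mu> \<nu> assume \<mu>: "\<mu> \<in> supp c" and \<nu>: "\<nu> \<in> supp c" and eq: "dm \<mu> = dm \<nu>"
    have nn: "lk \<mu> m \<ge> 0" "lk \<mu> (m + 1) \<ge> 0" "lk \<nu> m \<ge> 0" "lk \<nu> (m + 1) \<ge> 0"
      and oth: "\<And>l. l \<noteq> m \<Longrightarrow> l \<noteq> m + 1 \<Longrightarrow> lk \<mu> l = 0 \<and> lk \<nu> l = 0"
      and W: "wt \<mu> = wt \<nu>"
      using c \<mu> \<nu> by (auto simp: form_def pol_def)
    define a b where "a = lk \<mu> m - lk \<nu> m" and "b = lk \<mu> (m + 1) - lk \<nu> (m + 1)"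
    have 1: "int s * a = - int q * b" using W by (simp add: wt_def a_def b_def algebra_simps)
    have "int (dm \<mu>) = int (dm \<nu>)" using eq by simp
    then have 2: "a * int (dg zz) = - b * int (dg tt)" using nn by (simp add: dm_def a_def b_def algebra_simps)
    have "b * (int q * int (dg zz)) = - (int s * a) * int (dg zz)" using 1 by (simp add: algebra_simps)
    also have "\<dots> = - int s * (a * int (dg zz))" by simp
    also have "\<dots> = b * (int s * int (dg tt))" unfolding 2 by simp
    finally have "b = 0 \<or> int (q * dg zz) = int (s * dg tt)" by simp
    then have "b = 0" using ne unfolding of_nat_eq_iff by blast
    then have "a = 0" using 1 s_ge by simp
    show "\<mu> = \<nu>"
    proof (rule poly_mapping_eqI)
      fix l show "lk \<mu> l = lk \<nu> l"
        using \<open>a = 0\<close> \<open>b = 0\<close> oth[of l] by (cases "l = m"; cases "l = m + 1") (simp_all add: a_def b_def)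
    qed
  qed
  have ge: "dm \<mu> \<le> dg c" if c: "c \<in> form W" and \<mu>: "\<mu> \<in> supp c" for c W \<mu>
  proof -
    have "inj_on (\<lambda>\<mu>. Polynomial.degree (F c \<mu>)) {\<mu> \<in> supp c. F c \<mu> \<noteq> 0}"
      using inj[OF c] F by (auto simp: inj_on_def)
    from degree_sum_ge[OF finite_keys \<mu> _ this] F[OF \<mu>]
    have "dm \<mu> \<le> Polynomial.degree (sum (F c) (supp c))" by simp
    moreover have "\<Phi> c = sum (F c) (supp c)" unfolding F_def by (rule \<Phi>_form[OF c])
    ultimately show ?thesis by (simp add: dg_def)
  qed
  have "dg c = 0 \<or> m0 \<le> dg c" if c: "c \<in> form W" "c \<noteq> 0" for c W
  proof (cases "\<exists>\<mu>\<in>supp c. dm \<mu> > 0")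
    case True
    then obtain \<mu> where \<mu>: "\<mu> \<in> supp c" "dm \<mu> > 0" by blast
    have le: "x \<le> n * x" if "n > 0" for n x :: nat using that by (cases n) auto
    have "m0 \<le> dm \<mu>"
    proof (cases "nat (lk \<mu> m) * dg zz > 0")
      case True
      then have "m0 \<le> dg zz" "nat (lk \<mu> m) > 0" using m0_le(1) by auto
      with le[of "nat (lk \<mu> m)" "dg zz"] show ?thesis unfolding dm_def by linarith
    next
      case False
      then have "nat (lk \<mu> (m + 1)) * dg tt > 0" using \<mu>(2) by (auto simp: dm_def)
      then have "m0 \<le> dg tt" "nat (lk \<mu> (m + 1)) > 0" using m0_le(2) by auto
      with le[of "nat (lk \<mu> (m + 1))" "dg tt"] show ?thesis unfolding dm_def by linarith
    qed
    then show ?thesis using ge[OF c(1) \<mu>(1)] by simp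
  next
    case False
    then have "Polynomial.degree (F c \<mu>) \<le> 0" if "\<mu> \<in> supp c" for \<mu> using F[OF that] that by auto
    then have "Polynomial.degree (\<Sum>\<mu>\<in>supp c. F c \<mu>) \<le> 0" by (intro degree_sum_le) auto
    then show ?thesis using \<Phi>_form[OF c(1)] by (simp add: dg_def F_def)
  qed
  moreover have "s * m0 \<le> dg gg"
  proof -
    have "q * dg zz \<le> dg gg" "s * dg tt \<le> dg gg"
      using ge[OF form_gg supp_gg(1)] ge[OF form_gg supp_gg(2)] by (simp_all add: dm_def lk_unit_exp)
    moreover have "s * dg zz \<le> q * dg zz" using s_le_q by simp
    ultimately have "s * dg zz \<le> dg gg" "s * dg tt \<le> dg gg" by linarith+
    then show ?thesis using m0_eq by metis
  qed
  ultimately show ?thesis unfolding no_cancellation_def by blast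
qed

lemma homog_supp:
  assumes "b \<in> homog" "\<mu> \<in> supp b" "l \<ge> m + 2"
  shows "lk \<mu> l = 0"
proof -
  have P: "\<forall>\<mu>\<in>supp (a * b). lk \<mu> l = 0" if "\<forall>\<mu>\<in>supp a. lk \<mu> l = 0" "\<forall>\<mu>\<in>supp b. lk \<mu> l = 0"
    for a b :: "'f laurent"
    using that by (fastforce dest!: supp_add_prod simp: lookup_add)
  have Pp: "\<forall>\<mu>\<in>supp (a ^ n). lk \<mu> l = 0" if "\<forall>\<mu>\<in>supp a. lk \<mu> l = 0" for a :: "'f laurent" and n
  proof (induction n)
    case (Suc n)
    show ?case unfolding power_Suc by (rule P[OF that Suc])
  qed simp
  have f: "\<forall>\<mu>\<in>supp c. lk \<mu> l = 0" if "c \<in> form W" for c W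
    using that assms(3) by (auto simp: form_def pol_def)
  have y: "\<forall>\<mu>\<in>supp yh. lk \<mu> l = 0"
    unfolding yh_def Xinv_def by (intro P Pp f[OF form_gg]) (use assms(3) in \<open>simp add: lk_Xexp\<close>)
  obtain a j c W where *: "a \<in> xexps" "c \<in> form W" "b = lmon a * yh ^ j * c" using assms(1) by (rule homogE)
  have "\<forall>\<mu>\<in>supp b. lk \<mu> l = 0"
    unfolding *(3) by (intro P Pp y f[OF *(2)]) (use *(1) assms(3) in \<open>simp add: xexps_def\<close>)
  then show ?thesis using assms(2) by blast
qed

text \<open>Once the exponent of \<open>z\<close> is \<open>0\<close>, the weight determines that of
  \<open>t\<close> and the multidegree all others: only one monomial is left in each degree.\<close>

lemma spec_homog:
  assumes "b \<in> homog" "b' \<in> homog" "kd b = kd b'" "spec m b \<noteq> 0"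
  shows "\<exists>\<nu> \<alpha> \<beta>. spec m b = sc \<alpha> * lmon \<nu> \<and> spec m b' = sc \<beta> * lmon \<nu>"
proof -
  have supp: "\<mu> \<in> supp u \<and> lk \<mu> m = 0" if "\<mu> \<in> supp (spec m u)" for \<mu> u
    using that by (auto simp: spec_def top_part_def supp_restr)
  obtain \<nu> where \<nu>: "\<nu> \<in> supp (spec m b)" using assms(4) by fastforce
  have uniq: "\<mu> = \<nu>" if \<mu>: "\<mu> \<in> supp (spec m u)" and u: "u \<in> homog" "kd u = kd b" for \<mu> u
  proof (rule poly_mapping_eqI)
    fix l
    have "mdeg \<mu> = mdeg \<nu>"
      using hdeg_kd[OF u(1)] hdeg_kd[OF assms(1)] supp[OF \<mu>] supp[OF \<nu>] u(2) by (simp add: hdeg_def)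
    then have md: "mdeg \<mu> l = mdeg \<nu> l" for l by simp
    consider "l < m" | "l = m" | "l = m + 1" | "l \<ge> m + 2" by linarith
    then show "lk \<mu> l = lk \<nu> l"
    proof cases
      case 1 then show ?thesis using md[of l] by (simp add: mdeg_def)
    next
      case 2 then show ?thesis using supp[OF \<mu>] supp[OF \<nu>] by simp
    next
      case 3 then show ?thesis using md[of m] supp[OF \<mu>] supp[OF \<nu>] q_pos by (simp add: mdeg_def wt_def)
    next
      case 4 then show ?thesis using homog_supp[OF u(1)] homog_supp[OF assms(1)] supp[OF \<mu>] supp[OF \<nu>] by simp
    qed
  qed
  have "a = sc (lk a \<nu>) * lmon \<nu>" if "supp a \<subseteq> {\<nu>}" for a :: "'f laurent"
    by (rule poly_mapping_eqI) (use that in \<open>auto simp: sc_mult_lmon lookup_single when_def in_keys_iff\<close>)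
  note single = this
  have "spec m u = sc (lk (spec m u) \<nu>) * lmon \<nu>" if "u \<in> homog" "kd u = kd b" for u
    by (rule single) (use uniq[OF _ that] in auto)
  from this[OF assms(1) refl] this[OF assms(2) assms(3)[symmetric]] show ?thesis by blast
qed

lemma spec_ker_nonzero:
  assumes "b \<in> homog" "b \<noteq> 0" "dg b = 0" "k = m \<or> k = m + 1" "dg (xvar k) > 0"
  shows "spec k b \<noteq> 0"
proof
  assume "spec k b = 0"
  then obtain b1 where b1: "b1 \<in> homog" "b = xvar k * b1" using homog_divide[OF assms(1,4)] by blast
  have "xvar k \<in> homog" using assms(4) homog_zz homog_tt by (auto simp: zz_def tt_def)
  then have "dg (xvar k) \<le> dg b" using dg_dvd_le b1 assms(2) by blast
  then show False using assms by simp
qed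

text \<open>In the resonant case the leading coefficients of \<open>z\<close> and \<open>t\<close> satisfy the fixed form \<open>c\<close>;
  setting \<open>z = 0\<close> turns this into a root \<open>\<mu>\<close> in the ground field, so \<open>z\<^sup>q - \<mu> t\<^sup>s\<close> divides \<open>c\<close>.\<close>

lemma resonant_False:
  assumes res: "q * dg zz = s * dg tt"
    and c: "c \<in> form W" "c \<noteq> 0" "dg c = 0" "W \<noteq> 0"
  shows False
proof -
  define N where "N = q * dg zz"
  have zpos: "dg zz > 0" and tpos: "dg tt > 0"
    using not_all_zero res q_pos s_ge by (metis gr0I mult_is_0 not_numeral_le_zero)+
  then have N: "N > 0" using q_pos by (simp add: N_def)
  have ch: "c \<in> homog" using c homog_form by blast
  have nn: "lk \<mu> m \<ge> 0" "lk \<mu> (m + 1) \<ge> 0" "int s * lk \<mu> m + int q * lk \<mu> (m + 1) = W"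
    and oth: "\<And>l. l \<noteq> m \<Longrightarrow> l \<noteq> m + 1 \<Longrightarrow> lk \<mu> l = 0" if "\<mu> \<in> supp c" for \<mu>
    using c(1) that by (auto simp: form_def wt_def pol_def)
  \<comment> \<open>Both \<open>z\<close> and \<open>t\<close> move, so neither divides the fixed
    form \<open>c\<close>, which thus contains a pure power of each. As \<open>s\<close> and
    \<open>q\<close> are coprime, \<open>W\<close> is a multiple of \<open>s q\<close>, and
    \<open>c\<close> becomes a binary form of degree \<open>M\<close> in \<open>z ^ q\<close> and
    \<open>t ^ s\<close>.\<close>
  have "spec m c \<noteq> 0" "spec (m + 1) c \<noteq> 0"
    using spec_ker_nonzero[OF ch c(2,3)] zpos tpos by (auto simp: zz_def tt_def)
  then obtain \<mu>1 \<mu>2 where "\<mu>1 \<in> supp (spec m c)" "\<mu>2 \<in> supp (spec (m + 1) c)" by fastforce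
  then have \<mu>1: "\<mu>1 \<in> supp c" "lk \<mu>1 m = 0" and \<mu>2: "\<mu>2 \<in> supp c" "lk \<mu>2 (m + 1) = 0"
    by (auto simp: spec_def top_part_def supp_restr)
  have cop: "coprime (int s) (int q)" using coprime_s_q by simp
  have "int s * lk \<mu>2 m = W" "int q * lk \<mu>1 (m + 1) = W"
    using nn(3)[OF \<mu>1(1)] nn(3)[OF \<mu>2(1)] \<mu>1(2) \<mu>2(2) by auto
  then have "int q dvd W" "int s dvd W" by (metis dvd_triv_left)+
  then have "int s * int q dvd W" using cop by (intro divides_mult) auto
  then obtain M' where M': "W = int s * int q * M'" by (elim dvdE)
  have "W \<ge> 0" using nn[OF \<mu>1(1)] \<mu>1(2) by (metis add_0 mult_nonneg_nonneg mult_zero_right of_nat_0_le_iff)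
  moreover have "\<not> int s * int q \<le> 0" using s_ge q_pos by (simp add: mult_le_0_iff)
  ultimately have "M' \<ge> 0" unfolding M' zero_le_mult_iff by blast
  then obtain M where "M' = int M" by (metis nonneg_int_cases)
  with M' have M: "W = int s * int q * int M" by simp
  have M0: "M > 0" using M c(4) by (cases M) auto
  define e where "e k = unit_exp m (int (q * k)) + unit_exp (m + 1) (int (s * (M - k)))" for k
  define ck where "ck k = lk c (e k)" for k
  have inj: "inj_on e {..M}"
  proof (rule inj_onI)
    fix k l assume "e k = e l"
    then have "lk (e k) m = lk (e l) m" by simp
    then have "int (q * k) = int (q * l)" by (simp add: e_def lookup_add lk_unit_exp del: of_nat_mult)
    then show "k = l" using q_pos by (metis of_nat_eq_iff mult_cancel1 less_irrefl)
  qed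
  have sub: "supp c \<subseteq> e ` {..M}"
  proof
    fix \<mu> assume \<mu>: "\<mu> \<in> supp c"
    have eq: "int s * lk \<mu> m = int q * (int s * int M - lk \<mu> (m + 1))"
      using nn(3)[OF \<mu>] M by (simp add: algebra_simps)
    then have "int q dvd int s * lk \<mu> m" by simp
    then have "int q dvd lk \<mu> m" using cop by (metis coprime_commute coprime_dvd_mult_right_iff)
    then obtain k' where k': "lk \<mu> m = int q * k'" by (elim dvdE)
    have "k' \<ge> 0" using nn(1)[OF \<mu>] k' q_pos by (simp add: zero_le_mult_iff)
    then obtain k where k: "k' = int k" by (metis nonneg_int_cases)
    have "int q * (int s * int k) = int q * (int s * int M - lk \<mu> (m + 1))"
      using eq k' k by (simp add: algebra_simps)
    then have "int s * int k = int s * int M - lk \<mu> (m + 1)" using q_pos by (subst (asm) mult_left_cancel) auto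
    then have t: "lk \<mu> (m + 1) = int s * (int M - int k)" by (simp add: algebra_simps)
    then have kM: "k \<le> M" using nn(2)[OF \<mu>] s_ge by (simp add: zero_le_mult_iff)
    have "\<mu> = e k"
    proof (rule poly_mapping_eqI)
      fix l show "lk \<mu> l = lk (e k) l"
        using k' k t kM oth[OF \<mu>, of l] by (cases "l = m"; cases "l = m + 1") (simp_all add: e_def lookup_add lk_unit_exp of_nat_diff)
    qed
    then show "\<mu> \<in> e ` {..M}" using kM by auto
  qed
  define G H where "G = zz ^ q" and "H = tt ^ s"
  have "c = (\<Sum>\<mu>\<in>e ` {..M}. sc (lk c \<mu>) * lmon \<mu>)"
    by (subst laurent_expand[of c], rule sum.mono_neutral_left) (use sub in \<open>auto simp: in_keys_iff\<close>)
  also have "\<dots> = (\<Sum>k\<le>M. sc (ck k) * lmon (e k))"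
    by (subst sum.reindex[OF inj]) (simp add: ck_def)
  also have "\<dots> = (\<Sum>k\<le>M. sc (ck k) * (G ^ k * H ^ (M - k)))"
  proof -
    have "lmon (e k) = G ^ k * H ^ (M - k)" for k
      unfolding G_def H_def power_mult[symmetric] unfolding zz_def tt_def xvar_power lmon_mult e_def ..
    then show ?thesis by simp
  qed
  finally have cs: "c = (\<Sum>k\<le>M. sc (ck k) * (G ^ k * H ^ (M - k)))" .
  have GH: "G ^ k * H ^ l \<in> form (int (q * s * (k + l)))" for k l
    using form_mult[OF form_power[OF form_zq, of k] form_power[OF form_ts, of l]]
    by (simp add: G_def H_def algebra_simps)
  have hG: "G \<in> homog" "H \<in> homog" by (auto simp: G_def H_def homog_power homog_zz homog_tt)
  define v v' where "v = lead zz" and "v' = lead tt"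
  have vh: "v \<in> homog" "v' \<in> homog" "v \<noteq> 0" "v' \<noteq> 0" "dg v = 0" "dg v' = 0"
    by (simp_all add: v_def v'_def lead_homog lead_nonzero dg_lead homog_zz homog_tt)
  \<comment> \<open>Resonance gives all these products the same degree \<open>M N\<close>, so the
    coefficient there is a product of leading coefficients.\<close>
  have lc: "cf (\<Phi> (G ^ k * H ^ (M - k))) (M * N) = (v ^ q) ^ k * (v' ^ s) ^ (M - k)" if "k \<le> M" for k
  proof -
    have "dg (G ^ k * H ^ (M - k)) = k * (q * dg zz) + (M - k) * (s * dg tt)"
      by (simp add: dg_mult homog_power hG dg_power G_def H_def homog_zz homog_tt)
    also have "\<dots> = (k + (M - k)) * N" by (simp add: N_def res flip: distrib_right)
    finally have "dg (G ^ k * H ^ (M - k)) = M * N" using that by simp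
    then have "cf (\<Phi> (G ^ k * H ^ (M - k))) (M * N) = Polynomial.lead_coeff (\<Phi> (G ^ k * H ^ (M - k)))"
      by (simp add: dg_def)
    also have "\<dots> = (Polynomial.lead_coeff (\<Phi> zz) ^ q) ^ k * (Polynomial.lead_coeff (\<Phi> tt) ^ s) ^ (M - k)"
      by (simp add: \<Phi>_mult homog_power hG \<Phi>_power homog_zz homog_tt G_def H_def lead_coeff_mult lead_coeff_power)
    finally show ?thesis by (simp add: v_def v'_def lead_def dg_def)
  qed
  have "\<Phi> c = (\<Sum>k\<le>M. \<Phi> (sc (ck k) * (G ^ k * H ^ (M - k))))"
    unfolding cs
  proof (rule \<Phi>_form_sum)
    show "sc (ck k) * (G ^ k * H ^ (M - k)) \<in> form (int (q * s * M))" if "k \<in> {..M}" for k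
      using form_sc_mult[OF GH[of k "M - k"]] that by simp
  qed simp
  also have "\<dots> = (\<Sum>k\<le>M. [:sc (ck k):] * \<Phi> (G ^ k * H ^ (M - k)))"
    by (simp add: \<Phi>_mult homog_sc homog_mult homog_power hG \<Phi>_sc)
  finally have "cf (\<Phi> c) (M * N) = (\<Sum>k\<le>M. sc (ck k) * ((v ^ q) ^ k * (v' ^ s) ^ (M - k)))"
    by (simp add: coeff_sum lc)
  moreover have "cf (\<Phi> c) (M * N) = 0"
    using c(3) M0 N by (intro coeff_eq_0) (simp add: dg_def)
  ultimately have rel: "(\<Sum>k\<le>M. sc (ck k) * ((v ^ q) ^ k * (v' ^ s) ^ (M - k))) = 0" by simp
  have vq: "v ^ q \<in> homog" "v' ^ s \<in> homog" using vh homog_power by auto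
  \<comment> \<open>Equal multidegrees, again by resonance, make \<open>v ^ q\<close> and
    \<open>v' ^ s\<close> scalar multiples of one monomial after \<open>z = 0\<close>.\<close>
  have kd: "kd (v ^ q) = kd (v' ^ s)"
  proof (rule ext)
    fix l
    show "kd (v ^ q) l = kd (v' ^ s) l"
    proof (cases "l \<le> m")
      case True
      have "int j0 * kd v l = int (dg zz) * \<Delta> l + int j0 * (if l = m then int s else 0)"
        using lead_deg[OF homog_zz zz_nonzero True] kd_form[OF form_zz zz_nonzero] by (simp add: v_def algebra_simps)
      moreover have "int j0 * kd v' l = int (dg tt) * \<Delta> l + int j0 * (if l = m then int q else 0)"
        using lead_deg[OF homog_tt tt_nonzero True] kd_form[OF form_tt tt_nonzero] by (simp add: v'_def algebra_simps)
      moreover have "int q * int (dg zz) = int s * int (dg tt)" using res by (metis of_nat_mult)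
      ultimately have "int q * (int j0 * kd v l) = int s * (int j0 * kd v' l)"
        by (simp add: distrib_left mult.assoc[symmetric])
      then have "int j0 * (int q * kd v l) = int j0 * (int s * kd v' l)" by (simp add: mult.left_commute)
      then show ?thesis using j0_pos vh by (simp add: kd_power)
    next
      case False
      have "kd b l = 0" if "b \<in> homog" "b \<noteq> 0" for b
        using that False by (elim homogE) (auto simp: kd_homog bdeg_def)
      then show ?thesis using vh by (simp add: kd_power)
    qed
  qed
  have spv: "spec m (v ^ q) = spec m v ^ q" "spec m (v' ^ s) = spec m v' ^ s"
    using homog_nonneg[of m] vh by (simp_all add: spec_power)
  have spnz: "spec m v \<noteq> 0" "spec m v' \<noteq> 0"
    using spec_ker_nonzero[of v m] spec_ker_nonzero[of v' m] vh zpos by (simp_all add: zz_def)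
  obtain \<nu> \<alpha> \<beta> where ab: "spec m (v ^ q) = sc \<alpha> * lmon \<nu>" "spec m (v' ^ s) = sc \<beta> * lmon \<nu>"
    using spec_homog[OF vq kd] spv spnz by auto
  have ab0: "\<alpha> \<noteq> 0" "\<beta> \<noteq> 0" using ab spv spnz by auto
  have nnv: "v ^ q \<in> nonneg m" "v' ^ s \<in> nonneg m" using vq homog_nonneg by auto
  have "0 = spec m (\<Sum>k\<le>M. sc (ck k) * ((v ^ q) ^ k * (v' ^ s) ^ (M - k)))"
    unfolding rel by (simp add: spec_0)
  also have "\<dots> = (\<Sum>k\<le>M. sc (ck k) * ((sc \<alpha> * lmon \<nu>) ^ k * (sc \<beta> * lmon \<nu>) ^ (M - k)))"
    by (simp add: spec_sum spec_sc_mult spec_mult nonneg_power nnv spec_power ab)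
  also have "\<dots> = (\<Sum>k\<le>M. sc (ck k * \<alpha> ^ k * \<beta> ^ (M - k)) * lmon \<nu> ^ M)"
  proof (rule sum.cong[OF refl])
    fix k assume "k \<in> {..M}"
    then have "(lmon \<nu> :: 'f laurent) ^ M = lmon \<nu> ^ k * lmon \<nu> ^ (M - k)" by (simp flip: power_add)
    then show "sc (ck k) * ((sc \<alpha> * lmon \<nu>) ^ k * (sc \<beta> * lmon \<nu>) ^ (M - k))
       = sc (ck k * \<alpha> ^ k * \<beta> ^ (M - k)) * lmon \<nu> ^ M"
      by (simp add: power_mult_distrib sc_mult sc_power mult_ac)
  qed
  also have "\<dots> = sc (\<Sum>k\<le>M. ck k * \<alpha> ^ k * \<beta> ^ (M - k)) * lmon \<nu> ^ M"
    by (simp add: sc_sum sum_distrib_right)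
  finally have root: "(\<Sum>k\<le>M. ck k * \<alpha> ^ k * \<beta> ^ (M - k)) = 0" by simp
  \<comment> \<open>A ratio of scalars in the ground field, hence a root there of the dehomogenized
    form; it yields the linear factor \<open>G - \<mu> H\<close> of \<open>c\<close>.\<close>
  define \<mu> where "\<mu> = \<alpha> / \<beta>"
  have \<mu>0: "\<mu> \<noteq> 0" using ab0 by (simp add: \<mu>_def)
  have "(\<Sum>k\<le>M. ck k * \<mu> ^ k) * \<beta> ^ M = (\<Sum>k\<le>M. ck k * \<alpha> ^ k * \<beta> ^ (M - k))"
    unfolding sum_distrib_right
  proof (rule sum.cong[OF refl])
    fix k assume "k \<in> {..M}"
    then have "\<beta> ^ M = \<beta> ^ k * \<beta> ^ (M - k)" by (simp flip: power_add)
    then show "ck k * \<mu> ^ k * \<beta> ^ M = ck k * \<alpha> ^ k * \<beta> ^ (M - k)"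
      using ab0 by (simp add: \<mu>_def power_divide)
  qed
  then have root': "(\<Sum>k\<le>M. ck k * \<mu> ^ k) = 0" using root ab0 by simp
  define Y where "Y = sc \<mu> * H"
  define S where "S k = (\<Sum>i<k. Y ^ (k - Suc i) * G ^ i)" for k
  define c' where "c' = (\<Sum>k\<le>M. sc (ck k) * (H ^ (M - k) * S k))"
  have "(\<Sum>k\<le>M. sc (ck k) * (Y ^ k * H ^ (M - k))) = (\<Sum>k\<le>M. sc (ck k * \<mu> ^ k) * H ^ M)"
  proof (rule sum.cong[OF refl])
    fix k assume "k \<in> {..M}"
    then have "H ^ M = H ^ k * H ^ (M - k)" by (simp flip: power_add)
    then show "sc (ck k) * (Y ^ k * H ^ (M - k)) = sc (ck k * \<mu> ^ k) * H ^ M"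
      by (simp add: Y_def power_mult_distrib sc_mult sc_power mult_ac)
  qed
  also have "\<dots> = sc (\<Sum>k\<le>M. ck k * \<mu> ^ k) * H ^ M" by (simp add: sc_sum sum_distrib_right)
  finally have "c = (\<Sum>k\<le>M. sc (ck k) * (G ^ k * H ^ (M - k))) - (\<Sum>k\<le>M. sc (ck k) * (Y ^ k * H ^ (M - k)))"
    using cs root' by simp
  also have "\<dots> = (\<Sum>k\<le>M. sc (ck k) * (H ^ (M - k) * (G ^ k - Y ^ k)))"
    by (simp add: sum_subtractf[symmetric] algebra_simps)
  also have "\<dots> = (G - Y) * c'"
  proof -
    have "G ^ k - Y ^ k = (G - Y) * S k" for k unfolding S_def by (rule power_diff_sumr2)
    then show ?thesis unfolding c'_def sum_distrib_left by (intro sum.cong) (simp_all only: mult_ac)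
  qed
  finally have fac: "c = (G - Y) * c'" .
  have Yf: "Y ^ i \<in> form (int (q * s * i))" for i
    using form_power[OF form_sc_mult[OF form_ts, of \<mu>], of i] by (simp add: Y_def H_def algebra_simps)
  have Gf: "G ^ i \<in> form (int (q * s * i))" "H ^ i \<in> form (int (q * s * i))" for i
    using GH[of i 0] GH[of 0 i] by simp_all
  have "c' \<in> form (int (q * s * (M - 1)))"
    unfolding c'_def
  proof (intro form_sum form_sc_mult)
    fix k assume k: "k \<in> {..M}"
    have "H ^ (M - k) * (Y ^ (k - Suc i) * G ^ i) \<in> form (int (q * s * (M - 1)))" if "i < k" for i
    proof -
      have "(M - k) + ((k - Suc i) + i) = M - 1" using that k by simp
      then have "q * s * (M - k) + (q * s * (k - Suc i) + q * s * i) = q * s * (M - 1)"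
        by (metis distrib_left)
      then show ?thesis
        using form_mult[OF Gf(2)[of "M - k"] form_mult[OF Yf[of "k - Suc i"] Gf(1)[of i]]]
        by (simp only: of_nat_add[symmetric])
    qed
    then show "H ^ (M - k) * S k \<in> form (int (q * s * (M - 1)))"
      unfolding S_def sum_distrib_left by (intro form_sum) auto
  qed
  then have c'h: "c' \<in> homog" by (rule homog_form)
  have "G - Y \<in> form (int (q * s))" using form_minus[OF Gf(1)[of 1] Yf[of 1]] by simp
  then have "G - Y \<in> homog" by (rule homog_form)
  then have "dg (G - Y) \<le> dg c" unfolding fac by (rule dg_dvd_le) (use c'h fac c in auto)
  then have "dg (zz ^ q - sc \<mu> * tt ^ s) = 0" using c(3) by (simp add: G_def Y_def H_def)
  then show False by (rule no_curve[OF \<mu>0])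
qed

theorem contradiction: False
proof -
  have no_cancellation
  proof (cases "\<forall>W. \<forall>c\<in>form W. c \<noteq> 0 \<longrightarrow> dg c = 0 \<longrightarrow> W = 0")
    case True
    then show ?thesis by (intro no_cancellation_if_ker_trivial) blast
  next
    case False
    then have "q * dg zz \<noteq> s * dg tt" using resonant_False by blast
    then show ?thesis by (rule no_cancellation_if_generic)
  qed
  then show False by (rule contradiction_if_no_cancellation)
qed

end

section \<open>The ring A and its weight filtrations\<close>

context asanuma
begin

definition ff :: "'f laurent" where "ff = gg ^ p - tt"
definition yy :: "'f laurent" where "yy = Xinv * ff"

text \<open>The ring \<open>A\<close> realized in the Laurent ring: \<open>yy\<close> is an actual
  fraction there, so the defining relation holds by computation, and induction reduces statements to
  single terms.\<close>

inductive_set ringA :: "'f laurent set" where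
  ringA_term: "a \<in> xexps \<Longrightarrow> c \<in> pol \<Longrightarrow> lmon a * yy ^ j * c \<in> ringA"
| ringA_add: "u \<in> ringA \<Longrightarrow> u' \<in> ringA \<Longrightarrow> u + u' \<in> ringA"

lemma ringA_pol: "c \<in> pol \<Longrightarrow> c \<in> ringA"
  using ringA_term[of 0 c 0] by simp

lemma ringA_sc [simp]: "sc k \<in> ringA" and ringA_0 [simp]: "0 \<in> ringA" and ringA_1 [simp]: "1 \<in> ringA"
  by (simp_all add: ringA_pol)

lemma zz_pol: "zz \<in> pol" and tt_pol: "tt \<in> pol" and ff_pol: "ff \<in> pol"
  unfolding ff_def by (intro pol_minus pol_power form_pol[OF form_zz] form_pol[OF form_tt] form_pol[OF form_gg])+

lemma ringA_zz: "zz \<in> ringA" and ringA_tt: "tt \<in> ringA" and ringA_yy: "yy \<in> ringA"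
  using ringA_pol zz_pol tt_pol ringA_term[of 0 1 1] by simp_all

lemma ringA_lmon: "a \<in> xexps \<Longrightarrow> lmon a \<in> ringA"
  using ringA_term[of a 1 0] by simp

lemma ringA_var: "l < m + 2 \<Longrightarrow> xvar l \<in> ringA"
proof -
  assume "l < m + 2"
  then consider "l < m" | "l = m" | "l = m + 1" by linarith
  then show ?thesis
  proof cases
    case 1
    then have "unit_exp l 1 \<in> xexps" by (simp add: xexps_def lk_unit_exp)
    then show ?thesis unfolding xvar_def by (rule ringA_lmon)
  qed (use ringA_zz ringA_tt in \<open>simp_all add: zz_def tt_def\<close>)
qed

lemma ringA_mult: "u \<in> ringA \<Longrightarrow> u' \<in> ringA \<Longrightarrow> u * u' \<in> ringA"
proof (induction rule: ringA.induct)
  case (ringA_term a c j)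
  from ringA_term(3) show ?case
  proof (induction rule: ringA.induct)
    case (ringA_term a' c' j')
    have "lmon a * yy ^ j * c * (lmon a' * yy ^ j' * c') = lmon (a + a') * yy ^ (j + j') * (c * c')"
      by (simp add: power_add mult_ac flip: lmon_mult)
    also have "\<dots> \<in> ringA"
      using ringA_term \<open>a \<in> xexps\<close> \<open>c \<in> pol\<close> by (intro ringA.ringA_term xexps_add pol_mult)
    finally show ?case .
  qed (simp add: distrib_left ringA.ringA_add)
qed (simp add: distrib_right ringA.ringA_add)

lemma ringA_minus: "u \<in> ringA \<Longrightarrow> u' \<in> ringA \<Longrightarrow> u - u' \<in> ringA"
proof -
  have "sc (-1) = (-1 :: 'f laurent)" by (simp add: sc_def single_uminus)
  then have "-1 \<in> ringA" by (metis ringA_sc)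
  then show "u \<in> ringA \<Longrightarrow> u' \<in> ringA \<Longrightarrow> u - u' \<in> ringA"
    using ringA_add[of u "-1 * u'"] ringA_mult[of "-1" u'] by simp
qed

lemma ringA_sum: "(\<And>i. i \<in> I \<Longrightarrow> h i \<in> ringA) \<Longrightarrow> sum h I \<in> ringA"
  by (induction I rule: infinite_finite_induct) (auto intro: ringA_add)

text \<open>An induction principle: a property stable under sums and products is checked on scalars,
  variables and \<open>yy\<close>. It also yields finite generation.\<close>

lemma ringA_generated:
  assumes T: "\<And>k. sc k \<in> T" "\<And>l. l < m + 2 \<Longrightarrow> xvar l \<in> T" "yy \<in> T"
    "\<And>u v. u \<in> T \<Longrightarrow> v \<in> T \<Longrightarrow> u + v \<in> T" "\<And>u v. u \<in> T \<Longrightarrow> v \<in> T \<Longrightarrow> u * v \<in> T"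
    and u: "u \<in> ringA"
  shows "u \<in> T"
  using u
proof (induction rule: ringA.induct)
  case (ringA_term a c j)
  have T1: "1 \<in> T" "0 \<in> T" using T(1)[of 1] T(1)[of 0] by simp_all
  have pw: "v ^ n \<in> T" if "v \<in> T" for v n by (induction n) (use that T T1 in auto)
  have pr: "(\<Prod>l<n. xvar l ^ e l) \<in> T" if "n \<le> m" for n e
    using that by (induction n) (use T T1 pw in auto)
  have sm: "sum h I \<in> T" if "\<And>i. i \<in> I \<Longrightarrow> h i \<in> T" for h and I :: "expo set"
    using that by (induction I rule: infinite_finite_induct) (use T T1 in auto)
  have "lmon a \<in> T" unfolding lmon_prod[OF ringA_term(1)] by (rule pr) simp
  moreover have "c \<in> T"
  proof (subst laurent_expand[of c], rule sm)
    fix \<mu> assume "\<mu> \<in> supp c"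
    then have "lmon \<mu> \<in> pol" using ringA_term(2) by (auto simp: pol_def)
    from lmon_pol[OF this] show "sc (lk c \<mu>) * lmon \<mu> \<in> T"
      using T(2)[of m] T(2)[of "m + 1"] by (auto simp: zz_def tt_def intro!: T(1,5) pw)
  qed
  ultimately show ?case using T(3) by (intro T(5) pw)
qed (rule T(4))

lemma supp_nonneg:
  assumes "u \<in> ringA" "k \<ge> m"
  shows "u \<in> nonneg k"
proof -
  have yy: "yy \<in> nonneg k"
    unfolding yy_def Xinv_def using assms(2)
    by (intro nonneg_mult lmon_nonneg pol_nonneg ff_pol) (simp add: lk_Xexp)
  show ?thesis using assms(1)
  proof (induction rule: ringA.induct)
    case (ringA_term a c j)
    then have "lmon a \<in> nonneg k" by (intro lmon_nonneg) (auto simp: xexps_def)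
    then show ?case using yy pol_nonneg[OF ringA_term(2)] by (simp add: nonneg_mult nonneg_power)
  next
    case (ringA_add u u')
    then show ?case using keys_add[of u u'] by (auto simp: nonneg_iff)
  qed
qed

section \<open>Decomposition of \<open>A\<close> by the exponents of the \<open>X\<close>
  variables\<close>

definition xpart :: "expo \<Rightarrow> nat \<Rightarrow> int" where
  "xpart \<mu> l = (if l < m then lk \<mu> l else 0)"

definition slice :: "(nat \<Rightarrow> int) \<Rightarrow> 'f laurent \<Rightarrow> 'f laurent" where
  "slice x = restr (\<lambda>\<mu>. xpart \<mu> = x)"

definition sliceA :: "(nat \<Rightarrow> int) \<Rightarrow> 'f laurent set" where
  "sliceA x = insert 0 {lmon a * yy ^ j * c | a j c. a \<in> xexps \<and> c \<in> pol \<and> (\<forall>l<m. lk a l - int s * int j = x l)}"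

lemma lmon_Xexp_yy: "lmon Xexp * yy = ff"
  by (simp add: yy_def Xinv_def mult.assoc[symmetric] lmon_mult)

text \<open>Two terms of equal \<open>X\<close>-degree differ by trading copies of \<open>yy\<close>
  against powers of \<open>lmon Xexp\<close>. As \<open>lmon Xexp * yy = ff\<close> is a polynomial
  in \<open>z, t\<close>, their sum is again a single term.\<close>

lemma sliceA_add:
  assumes "u \<in> sliceA x" "u' \<in> sliceA x"
  shows "u + u' \<in> sliceA x"
proof -
  have key: "u + u' \<in> sliceA x"
    if "u = lmon a * yy ^ j * c" "u' = lmon a' * yy ^ j' * c'" "a \<in> xexps" "a' \<in> xexps" "c \<in> pol" "c' \<in> pol"
      "\<forall>l<m. lk a l - int s * int j = x l" "\<forall>l<m. lk a' l - int s * int j' = x l" "j \<le> j'"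
    for u u' a a' j j' c c'
  proof -
    define d where "d = j' - j"
    have j': "j' = j + d" using that(9) by (simp add: d_def)
    have lX: "lmon (\<Sum>_<n. Xexp) = (lmon Xexp :: 'f laurent) ^ n" for n
      by (induction n) (simp_all add: lmon_mult[symmetric] mult.commute del: sum_constant)
    have lkX: "lk (\<Sum>_<n. Xexp) l = int n * lk Xexp l" for n l
      unfolding lookup_sum by simp
    \<comment> \<open>Equal \<open>X\<close>-degrees force the exponents to differ by exactly
      \<open>s d\<close> in each coordinate below \<open>m\<close>.\<close>
    have "a' = a + (\<Sum>_<d. Xexp)"
    proof (rule poly_mapping_eqI)
      fix l
      have "lk a l = x l + int s * int j" "lk a' l = x l + int s * int j'" if "l < m"
        using \<open>\<forall>l<m. lk a l - int s * int j = x l\<close> \<open>\<forall>l<m. lk a' l - int s * int j' = x l\<close> that by (auto simp: algebra_simps)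
      then show "lk a' l = lk (a + (\<Sum>_<d. Xexp)) l"
        using that(3,4) j' lkX by (cases "l < m") (auto simp: lookup_add lk_Xexp xexps_def algebra_simps simp del: sum_constant)
    qed
    then have "lmon a' = lmon a * (lmon Xexp :: 'f laurent) ^ d"
      by (simp only: lmon_mult[symmetric] lX)
    then have "u' = lmon a * lmon Xexp ^ d * yy ^ (j + d) * c'"
      unfolding that(2) j' by simp
    also have "\<dots> = lmon a * yy ^ j * (ff ^ d * c')"
      unfolding lmon_Xexp_yy[symmetric] by (simp add: power_add power_mult_distrib mult_ac)
    finally have "u + u' = lmon a * yy ^ j * (c + ff ^ d * c')"
      unfolding that(1) by (simp add: distrib_left)
    moreover have "c + ff ^ d * c' \<in> pol" using that by (intro pol_add pol_mult pol_power ff_pol)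
    ultimately show ?thesis using that(3,7) unfolding sliceA_def by blast
  qed
  show ?thesis
  proof (cases "u = 0 \<or> u' = 0")
    case True
    then show ?thesis using assms by auto
  next
    case False
    then obtain a j c a' j' c' where *: "u = lmon a * yy ^ j * c" "u' = lmon a' * yy ^ j' * c'" "a \<in> xexps" "a' \<in> xexps" "c \<in> pol" "c' \<in> pol"
      "\<forall>l<m. lk a l - int s * int j = x l" "\<forall>l<m. lk a' l - int s * int j' = x l"
      using assms unfolding sliceA_def by blast
    show ?thesis
    proof (cases "j \<le> j'")
      case True
      then show ?thesis using key[of u a j c u' a' j' c'] * by blast
    next
      case False
      then have "u' + u \<in> sliceA x" using key[of u' a' j' c' u a j c] * by simp
      then show ?thesis by (simp add: add.commute)
    qed
  qed
qed

lemma xpart_term: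
  assumes "a \<in> xexps" "c \<in> pol" "\<mu> \<in> supp (lmon a * yy ^ j * c)"
  shows "xpart \<mu> = (\<lambda>l. if l < m then lk a l - int s * int j else 0)"
proof -
  define Q where "Q x u \<longleftrightarrow> (\<forall>\<mu>\<in>supp u. xpart \<mu> = x)" for x and u :: "'f laurent"
  have Qm: "Q (\<lambda>l. x l + x' l) (u * u')" if "Q x u" "Q x' u'" for x x' u u'
    using that unfolding Q_def by (fastforce dest!: supp_add_prod simp: xpart_def lookup_add fun_eq_iff)
  have Qp: "Q (\<lambda>_. 0) c" if "c \<in> pol" for c
    using that by (auto simp: Q_def pol_def xpart_def fun_eq_iff)
  have Qy: "Q (\<lambda>l. (if l < m then - int s else 0) + 0) yy"
    unfolding yy_def Xinv_def by (rule Qm[OF _ Qp[OF ff_pol]]) (auto simp: Q_def xpart_def lk_Xexp fun_eq_iff)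
  have Qyp: "Q (\<lambda>l. if l < m then - int s * int j else 0) (yy ^ j)" for j
  proof (induction j)
    case 0
    show ?case by (auto simp: Q_def xpart_def fun_eq_iff)
  next
    case (Suc j)
    from Qm[OF Qy Suc] show ?case
      by (simp only: power_Suc) (erule back_subst[where P = "\<lambda>x. Q x _"], auto simp: fun_eq_iff algebra_simps)
  qed
  have "Q (xpart a) (lmon a)" by (simp add: Q_def)
  from Qm[OF Qm[OF this Qyp[of j]] Qp[OF assms(2)]]
  have "xpart \<mu> = (\<lambda>l. xpart a l + (if l < m then - int s * int j else 0) + 0)"
    using assms(3) unfolding Q_def by blast
  then show ?thesis by (auto simp: xpart_def fun_eq_iff)
qed

lemma slice_ringA: "u \<in> ringA \<Longrightarrow> slice x u \<in> sliceA x"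
proof (induction rule: ringA.induct)
  case (ringA_term a c j)
  define x' where "x' = (\<lambda>l. if l < m then lk a l - int s * int j else 0)"
  have x': "xpart \<mu> = x'" if "\<mu> \<in> supp (lmon a * yy ^ j * c)" for \<mu>
    using xpart_term[OF ringA_term that] by (simp add: x'_def)
  show ?case
  proof (cases "x = x'")
    case True
    have "slice x (lmon a * yy ^ j * c) = lmon a * yy ^ j * c"
      unfolding slice_def using x' True by (intro restr_all) auto
    also have "\<dots> \<in> sliceA x"
      using ringA_term unfolding sliceA_def by (auto simp: True x'_def)
    finally show ?thesis .
  next
    case False
    then have "slice x (lmon a * yy ^ j * c) = 0"
      unfolding slice_def using x' by (intro restr_none) auto
    then show ?thesis by (simp add: sliceA_def)
  qed
next
  case (ringA_add u u')
  then show ?case by (simp add: slice_def restr_add sliceA_add)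
qed

lemma sum_slices: "u = (\<Sum>x\<in>xpart ` supp u. slice x u)"
proof (rule poly_mapping_eqI)
  fix \<mu>
  have "lk (\<Sum>x\<in>xpart ` supp u. slice x u) \<mu> = (\<Sum>x\<in>xpart ` supp u. if x = xpart \<mu> then lk u \<mu> else 0)"
    by (simp add: lookup_sum slice_def lk_restr eq_commute)
  also have "\<dots> = lk u \<mu>"
    by (auto simp: in_keys_iff)
  finally show "lk u \<mu> = lk (\<Sum>x\<in>xpart ` supp u. slice x u) \<mu>" by simp
qed

end

text \<open>Moving negative coefficients to the other side and exponentiating equates two products
  of prime powers; unique factorization compares their exponents.\<close>

lemma ln_primes_independent:
  fixes \<pi> :: "nat \<Rightarrow> nat" and \<theta> :: "nat \<Rightarrow> int"
  assumes "finite I" "inj_on \<pi> I" "\<And>l. l \<in> I \<Longrightarrow> prime (\<pi> l)"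
    and sum0: "(\<Sum>l\<in>I. ln (real (\<pi> l)) * real_of_int (\<theta> l)) = 0" and k: "k \<in> I"
  shows "\<theta> k = 0"
proof -
  have pos: "\<pi> l > 0" if "l \<in> I" for l using assms(3)[OF that] by (rule prime_gt_0_nat)
  define P where "P h = (\<Prod>l\<in>I. \<pi> l ^ nat (h l))" for h :: "nat \<Rightarrow> int"
  have lnP: "ln (real (P h)) = (\<Sum>l\<in>I. real (nat (h l)) * ln (real (\<pi> l)))" for h
    using assms(1) pos by (simp add: P_def ln_prod ln_realpow)
  have "ln (real (P \<theta>)) - ln (real (P (\<lambda>l. - \<theta> l))) = (\<Sum>l\<in>I. ln (real (\<pi> l)) * real_of_int (\<theta> l))"
    unfolding lnP sum_subtractf[symmetric]
  proof (rule sum.cong[OF refl])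
    fix l
    have e: "real_of_int (\<theta> l) = real (nat (\<theta> l)) - real (nat (- \<theta> l))" by (cases "\<theta> l \<ge> 0") auto
    show "real (nat (\<theta> l)) * ln (real (\<pi> l)) - real (nat (- \<theta> l)) * ln (real (\<pi> l)) = ln (real (\<pi> l)) * real_of_int (\<theta> l)"
      unfolding e by (simp add: algebra_simps)
  qed
  then have "ln (real (P \<theta>)) = ln (real (P (\<lambda>l. - \<theta> l)))" using sum0 by simp
  moreover have "P h > 0" for h unfolding P_def using pos by (intro prod_pos) auto
  ultimately have eq: "P \<theta> = P (\<lambda>l. - \<theta> l)" by simp
  have mult: "multiplicity (\<pi> k) (P h) = nat (h k)" for h
  proof -
    have "P h = (\<Prod>r\<in>\<pi> ` I. r ^ nat (h (the_inv_into I \<pi> r)))"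
      unfolding P_def by (subst prod.reindex[OF assms(2)]) (simp add: the_inv_into_f_f[OF assms(2)])
    moreover have "multiplicity (\<pi> k) (\<Prod>r\<in>\<pi> ` I. r ^ nat (h (the_inv_into I \<pi> r))) = nat (h (the_inv_into I \<pi> (\<pi> k)))"
      using assms(1,3) k by (subst multiplicity_prod_prime_powers) auto
    ultimately show ?thesis by (simp add: the_inv_into_f_f[OF assms(2) k])
  qed
  \<comment> \<open>One of the two truncations is always \<open>0\<close>, so both are.\<close>
  have "nat (\<theta> k) = nat (- \<theta> k)" using mult[of \<theta>] mult[of "\<lambda>l. - \<theta> l"] eq by simp
  then show ?thesis by linarith
qed

text \<open>The weights are signed logarithms of distinct primes. The \<open>i\<close>-th is
  \<open>- ln P\<close> with \<open>P\<close> so large that the other coordinates cannot compensate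
  for it on the finite set \<open>S\<close>; since \<open>\<theta>0\<close> competes, a maximizer
  has a negative \<open>i\<close>-th entry. Positivity of \<open>\<beta> m\<close> keeps
  \<open>tt\<close> below \<open>gg ^ p\<close> in the leading form of \<open>f\<close>.\<close>

lemma exists_independent_weights:
  fixes S :: "(nat \<Rightarrow> int) set"
  assumes S: "finite S" "\<theta>0 \<in> S" "\<theta>0 i < 0" and i: "i < m"
  shows "\<exists>\<beta>. (\<forall>\<theta> :: nat \<Rightarrow> int. (\<Sum>l\<le>m. \<beta> l * real_of_int (\<theta> l)) = 0 \<longrightarrow> (\<forall>l\<le>m. \<theta> l = 0)) \<and> \<beta> m > 0 \<and>
    (\<forall>\<theta>\<in>S. (\<forall>\<theta>'\<in>S. (\<Sum>l\<le>m. \<beta> l * real_of_int (\<theta>' l)) \<le> (\<Sum>l\<le>m. \<beta> l * real_of_int (\<theta> l))) \<longrightarrow> \<theta> i < 0)"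
proof -
  define \<pi>0 :: "nat \<Rightarrow> nat" where "\<pi>0 = enumerate {p. prime p}"
  have \<pi>0: "prime (\<pi>0 l)" for l
    using enumerate_in_set[OF primes_infinite, of l] by (simp add: \<pi>0_def)
  have inj0: "inj \<pi>0"
    unfolding \<pi>0_def using strict_mono_enumerate[OF primes_infinite] by (rule strict_mono_imp_inj_on)
  define \<gamma> where "\<gamma> l = (if l = m then 1 else -1) * ln (real (\<pi>0 l))" for l
  define rest where "rest \<theta> = (\<Sum>l\<in>{..m} - {i}. \<gamma> l * real_of_int (\<theta> l))" for \<theta> :: "nat \<Rightarrow> int"
  define R where "R = Max ((\<lambda>\<theta>. \<bar>rest \<theta>\<bar>) ` S)"
  have R: "\<bar>rest \<theta>\<bar> \<le> R" if "\<theta> \<in> S" for \<theta> unfolding R_def using that S by simp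
  \<comment> \<open>Two values of \<open>rest\<close> on \<open>S\<close> differ by at most
    \<open>2 R\<close>; moreover \<open>P\<close> must avoid the primes already in use.\<close>
  obtain P where P: "prime P" "P > max (nat \<lceil>exp (2 * R)\<rceil>) (Max (\<pi>0 ` {..m}))"
    using bigger_prime by blast
  have "exp (2 * R) < real P"
  proof -
    have "exp (2 * R) \<le> real (nat \<lceil>exp (2 * R)\<rceil>)" by (rule real_nat_ceiling_ge)
    moreover have "real (nat \<lceil>exp (2 * R)\<rceil>) < real P"
      using P(2) unfolding of_nat_less_iff by (rule le_less_trans[OF max.cobounded1])
    ultimately show ?thesis by (rule le_less_trans)
  qed
  then have lnP: "ln (real P) > 2 * R"
    using ln_less_cancel_iff[of "exp (2 * R)" "real P"] prime_gt_0_nat[OF P(1)] by simp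
  define \<pi> where "\<pi> = \<pi>0(i := P)"
  define \<beta> where "\<beta> l = (if l = m then 1 else -1) * ln (real (\<pi> l))" for l
  have \<pi>: "prime (\<pi> l)" for l using \<pi>0 P(1) by (simp add: \<pi>_def)
  have "P \<noteq> \<pi>0 l" if "l \<le> m" for l
  proof -
    have "\<pi>0 l \<le> Max (\<pi>0 ` {..m})" using that by (intro Max_ge) auto
    also have "\<dots> < P" using P(2) by (rule le_less_trans[OF max.cobounded2])
    finally show ?thesis by simp
  qed
  then have inj: "inj_on \<pi> {..m}"
    unfolding \<pi>_def using inj_on_subset[OF inj0 subset_UNIV]
    by (intro inj_on_fun_updI) auto
  have ind: "\<theta> l = 0" if "(\<Sum>l\<le>m. \<beta> l * real_of_int (\<theta> l)) = 0" "l \<le> m" for \<theta> l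
  proof -
    define \<theta>' where "\<theta>' l = (if l = m then 1 else -1) * \<theta> l" for l
    have "(\<Sum>l\<le>m. ln (real (\<pi> l)) * real_of_int (\<theta>' l)) = (\<Sum>l\<le>m. \<beta> l * real_of_int (\<theta> l))"
      by (rule sum.cong) (auto simp: \<theta>'_def \<beta>_def)
    then have "(\<Sum>l\<le>m. ln (real (\<pi> l)) * real_of_int (\<theta>' l)) = 0" using that(1) by simp
    then have "\<theta>' l = 0" using ln_primes_independent[OF finite_atMost inj \<pi>] that(2) by simp
    then show ?thesis by (auto simp: \<theta>'_def split: if_splits)
  qed
  have W: "(\<Sum>l\<le>m. \<beta> l * real_of_int (\<theta> l)) = - ln (real P) * real_of_int (\<theta> i) + rest \<theta>" for \<theta>
  proof -
    have "(\<Sum>l\<le>m. \<beta> l * real_of_int (\<theta> l)) = \<beta> i * real_of_int (\<theta> i) + (\<Sum>l\<in>{..m} - {i}. \<beta> l * real_of_int (\<theta> l))"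
      using i by (intro sum.remove) auto
    also have "(\<Sum>l\<in>{..m} - {i}. \<beta> l * real_of_int (\<theta> l)) = rest \<theta>"
      unfolding rest_def by (rule sum.cong) (auto simp: \<beta>_def \<gamma>_def \<pi>_def)
    also have "\<beta> i = - ln (real P)" using i by (simp add: \<beta>_def \<pi>_def)
    finally show ?thesis .
  qed
  have P1: "ln (real P) > 0" using prime_gt_1_nat[OF P(1)] by simp
  have "\<theta> i < 0" if \<theta>: "\<theta> \<in> S" and mx: "\<forall>\<theta>'\<in>S. (\<Sum>l\<le>m. \<beta> l * real_of_int (\<theta>' l)) \<le> (\<Sum>l\<le>m. \<beta> l * real_of_int (\<theta> l))" for \<theta>
  proof (rule ccontr)
    assume "\<not> \<theta> i < 0"
    then have "ln (real P) * real_of_int (\<theta> i) \<ge> 0" using P1 by simp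
    moreover have "ln (real P) * real_of_int (\<theta>0 i) \<le> ln (real P) * (-1)"
      using S(3) P1 by (intro mult_left_mono) auto
    moreover have "- ln (real P) * real_of_int (\<theta>0 i) + rest \<theta>0 \<le> - ln (real P) * real_of_int (\<theta> i) + rest \<theta>"
      using mx S(2) unfolding W by blast
    ultimately have "ln (real P) \<le> rest \<theta> - rest \<theta>0" by linarith
    also have "\<dots> \<le> 2 * R" using R[OF \<theta>] R[OF S(2)] by linarith
    finally show False using lnP by linarith
  qed
  note mx = this
  have \<beta>m: "\<beta> m > 0" using prime_gt_1_nat[OF \<pi>[of m]] by (simp add: \<beta>_def)
  show ?thesis
  proof (intro exI[of _ \<beta>] conjI allI impI ballI)
    show "\<theta> l = 0" if "(\<Sum>l\<le>m. \<beta> l * real_of_int (\<theta> l)) = 0" "l \<le> m" for \<theta> l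
      by (rule ind[OF that])
    show "\<theta> i < 0" if "\<theta> \<in> S" "\<forall>\<theta>'\<in>S. (\<Sum>l\<le>m. \<beta> l * real_of_int (\<theta>' l)) \<le> (\<Sum>l\<le>m. \<beta> l * real_of_int (\<theta> l))" for \<theta>
      by (rule mx[OF that])
  qed (rule \<beta>m)
qed

lemma (in weight) top_part_sc_mult: "top_part w \<gamma> (sc c * a) = sc c * top_part w \<gamma> a"
  by (simp add: top_part_def restr_sc_mult)

lemma (in weight) exact_top: "(\<And>\<mu>. \<mu> \<in> supp a \<Longrightarrow> w \<mu> = \<gamma>) \<Longrightarrow> a \<in> below w \<gamma> \<and> top_part w \<gamma> a = a"
  by (auto simp: below_def top_part_def intro!: restr_all)

lemma (in weight) exists_order:
  assumes "a \<noteq> 0"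
  shows "\<exists>\<gamma>. a \<in> below w \<gamma> \<and> top_part w \<gamma> a \<noteq> 0"
proof -
  have ne: "supp a \<noteq> {}" using assms by simp
  define \<gamma> where "\<gamma> = Max (w ` supp a)"
  have "\<gamma> \<in> w ` supp a" unfolding \<gamma>_def using ne by (intro Max_in) auto
  then obtain \<mu> where "\<mu> \<in> supp a" "w \<mu> = \<gamma>" by auto
  then have "\<mu> \<in> supp (top_part w \<gamma> a)" by (simp add: top_part_def supp_restr)
  then have "top_part w \<gamma> a \<noteq> 0" by auto
  moreover have "a \<in> below w \<gamma>" unfolding below_def \<gamma>_def by (auto intro: Max_ge)
  ultimately show ?thesis by blast
qed

lemma (in weight) top_nonzero_le:
  assumes "a \<in> below w \<gamma>" "top_part w \<gamma>' a \<noteq> 0"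
  shows "\<gamma>' \<le> \<gamma>"
  using top_part_strict[OF assms(1), of \<gamma>'] assms(2) by force

section \<open>Homogenization\<close>

text \<open>A nontrivial action of the additive group on \<open>A\<close>;
  \<open>\<phi>_iter\<close> is the action law read on coefficients.\<close>

locale ring_exp = asanuma m p fld for m p :: nat and fld :: "'f::field itself" +
  fixes \<phi> :: "'f laurent \<Rightarrow> 'f laurent poly"
  assumes \<phi>_ringA: "a \<in> ringA \<Longrightarrow> cf (\<phi> a) j \<in> ringA"
    and \<phi>_0: "a \<in> ringA \<Longrightarrow> cf (\<phi> a) 0 = a"
    and \<phi>_add: "a \<in> ringA \<Longrightarrow> b \<in> ringA \<Longrightarrow> \<phi> (a + b) = \<phi> a + \<phi> b"
    and \<phi>_mult: "a \<in> ringA \<Longrightarrow> b \<in> ringA \<Longrightarrow> \<phi> (a * b) = \<phi> a * \<phi> b"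
    and \<phi>_sc: "\<phi> (sc k) = [:sc k:]"
    and \<phi>_iter: "a \<in> ringA \<Longrightarrow> cf (\<phi> (cf (\<phi> a) j)) i = of_nat (i + j choose i) * cf (\<phi> a) (i + j)"
    and \<phi>_nontriv: "\<exists>a\<in>ringA. \<phi> a \<noteq> [:a:]"

locale weighted_ring_exp = ring_exp m p fld \<phi> for m p :: nat and fld :: "'f::field itself" and \<phi> +
  fixes \<beta> :: "nat \<Rightarrow> real"
  assumes indep: "(\<Sum>l\<le>m. \<beta> l * real_of_int (\<theta> l)) = 0 \<Longrightarrow> l \<le> m \<Longrightarrow> \<theta> l = (0::int)"
    and \<beta>_pos: "\<beta> m > 0"
begin

definition WW :: "(nat \<Rightarrow> int) \<Rightarrow> real" where "WW \<theta> = (\<Sum>l\<le>m. \<beta> l * real_of_int (\<theta> l))"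
definition w :: "expo \<Rightarrow> real" where "w \<mu> = WW (mdeg \<mu>)"

lemma WW_add: "WW (\<lambda>l. \<theta> l + \<theta>' l) = WW \<theta> + WW \<theta>'"
  by (simp add: WW_def distrib_left sum.distrib)

sublocale weight w
  by standard (simp add: w_def WW_add mdeg_add[abs_def])

lemma WW_inj: "WW \<theta> = WW \<theta>' \<Longrightarrow> l \<le> m \<Longrightarrow> \<theta> l = \<theta>' l"
  using indep[of "\<lambda>l. \<theta> l - \<theta>' l" l] by (simp add: WW_def right_diff_distrib sum_subtractf)

lemma w_inj: "w \<mu> = w \<nu> \<Longrightarrow> mdeg \<mu> = mdeg \<nu>"
proof
  fix l
  assume "w \<mu> = w \<nu>"
  then show "mdeg \<mu> l = mdeg \<nu> l"
    using WW_inj[of "mdeg \<mu>" "mdeg \<nu>" l] by (cases "l \<le> m") (simp_all add: w_def, simp add: mdeg_def)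
qed

definition wtb :: "'f laurent \<Rightarrow> real" where "wtb b = WW (kd b)"

lemma homog_exact: "b \<in> homog \<Longrightarrow> b \<in> below w (wtb b) \<and> top_part w (wtb b) b = b"
  using hdeg_kd by (intro exact_top) (auto simp: hdeg_def w_def wtb_def)

lemma form_weight: "c \<in> form W \<Longrightarrow> \<mu> \<in> supp c \<Longrightarrow> w \<mu> = \<beta> m * real_of_int W"
proof -
  assume "c \<in> form W" "\<mu> \<in> supp c"
  then have "mdeg \<mu> = (\<lambda>l. if l = m then W else 0)" using hdeg_form by (auto simp: hdeg_def)
  then show ?thesis by (simp add: w_def WW_def if_distrib cong: if_cong)
qed

definition wy :: real where "wy = wtb yh"

text \<open>In \<open>ff = gg ^ p - tt\<close> the weight of \<open>tt\<close> is
  \<open>q \<beta> m\<close>, that of \<open>gg ^ p\<close> is \<open>p q s \<beta> m\<close>, and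
  \<open>\<beta> m > 0\<close>.\<close>

lemma yy_top: "yy \<in> below w wy \<and> top_part w wy yy = yh"
proof -
  have e: "yy = yh - Xinv * tt" by (simp add: yy_def yh_def ff_def right_diff_distrib)
  have 1: "yh \<in> below w wy" "top_part w wy yh = yh" using homog_exact[OF homog_yh] by (auto simp: wy_def)
  have wyv: "wy = w (- Xexp) + \<beta> m * real (p * q * s)"
  proof -
    have gp: "gg ^ p \<in> form (int (p * q * s))" using form_power[OF form_gg, of p] by (simp add: algebra_simps)
    have "supp (gg ^ p) \<noteq> {}" using gg_nonzero by simp
    then obtain \<mu> where \<mu>: "\<mu> \<in> supp (gg ^ p)" by blast
    have "w (- Xexp + \<mu>) = w (- Xexp) + \<beta> m * real (p * q * s)"
      unfolding w_add form_weight[OF gp \<mu>] by simp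
    moreover have "- Xexp + \<mu> \<in> supp yh" using \<mu> by (simp add: yh_def Xinv_def supp_lmon_mult)
    then have "w (- Xexp + \<mu>) = wy" using hdeg_kd[OF homog_yh] by (auto simp: hdeg_def w_def wy_def wtb_def)
    ultimately show ?thesis by simp
  qed
  have "Xinv * tt \<in> below w (w (- Xexp) + \<beta> m * real q)"
    unfolding Xinv_def
  proof (rule below_mult)
    show "tt \<in> below w (\<beta> m * real q)" using form_weight[OF form_tt] by (simp add: below_def)
  qed (rule below_lmon)
  moreover have "w (- Xexp) + \<beta> m * real q < wy"
  proof -
    have "2 * 2 \<le> p * s" using p2 s_ge by (rule mult_le_mono)
    then have "1 < p * s" by linarith
    then have "1 < real (p * s)" using of_nat_less_iff[of 1 "p * s", where 'a = real] by simp
    moreover have "0 < \<beta> m * real q" using \<beta>_pos q_pos by simp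
    ultimately have "\<beta> m * real q * 1 < \<beta> m * real q * real (p * s)" by (rule mult_strict_left_mono)
    then show ?thesis unfolding wyv by (simp add: mult_ac)
  qed
  ultimately have 2: "Xinv * tt \<in> below w wy" "top_part w wy (Xinv * tt) = 0"
    by (rule below_mono[OF _ less_imp_le], rule top_part_strict)
  show ?thesis
    using below_diff[OF 1(1) 2(1)] 1(2) 2(2) by (simp add: e top_part_def restr_minus)
qed

lemma term_top:
  assumes "a \<in> xexps" "c \<in> below w \<gamma>"
  shows "lmon a * yy ^ j * c \<in> below w (w a + real j * wy + \<gamma>)"
    and "top_part w (w a + real j * wy + \<gamma>) (lmon a * yy ^ j * c) = lmon a * yh ^ j * top_part w \<gamma> c"
proof -
  have 1: "lmon a \<in> below w (w a)" "top_part w (w a) (lmon a) = lmon a"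
    using exact_top[of "lmon a" "w a"] by auto
  have 2: "yy ^ j \<in> below w (real j * wy)" using below_power yy_top by blast
  show "lmon a * yy ^ j * c \<in> below w (w a + real j * wy + \<gamma>)"
    by (intro below_mult 1 2 assms)
  show "top_part w (w a + real j * wy + \<gamma>) (lmon a * yy ^ j * c) = lmon a * yh ^ j * top_part w \<gamma> c"
    unfolding top_part_mult[OF below_mult[OF 1(1) 2] assms(2)] top_part_mult[OF 1(1) 2]
      top_part_power[OF conjunct1[OF yy_top]] 1(2) conjunct2[OF yy_top] ..
qed

lemma slice_below: "u \<in> below w \<gamma> \<Longrightarrow> slice x u \<in> below w \<gamma>"
  by (auto simp: below_def slice_def supp_restr)

text \<open>By independence the top part has a single multidegree, hence lies in one slice; that
  slice is one term, whose top part is read off factor by factor. With \<open>exists_lift\<close>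
  this identifies the leading forms of \<open>A\<close> with the elements of
  \<open>homog\<close>.\<close>

lemma top_ringA:
  assumes u: "u \<in> ringA" "u \<in> below w \<gamma>"
  shows "top_part w \<gamma> u \<in> homog" and "top_part w \<gamma> u \<noteq> 0 \<Longrightarrow> wtb (top_part w \<gamma> u) = \<gamma>"
proof -
  define b where "b = top_part w \<gamma> u"
  have "b \<in> homog \<and> (b \<noteq> 0 \<longrightarrow> wtb b = \<gamma>)"
  proof (cases "b = 0")
    case True
    then show ?thesis using homog_form[OF form_0] by simp
  next
    case False
    then obtain \<nu> where \<nu>: "\<nu> \<in> supp b" by fastforce
    have wb: "w \<mu> = \<gamma>" "\<mu> \<in> supp u" if "\<mu> \<in> supp b" for \<mu>
      using that by (auto simp: b_def top_part_def supp_restr)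
    define x where "x = xpart \<nu>"
    have xp: "xpart \<mu> = x" if "\<mu> \<in> supp b" for \<mu>
    proof -
      have "mdeg \<mu> = mdeg \<nu>" using wb[OF that] wb[OF \<nu>] by (intro w_inj) simp
      then have "mdeg \<mu> l = mdeg \<nu> l" for l by simp
      then show ?thesis unfolding x_def xpart_def mdeg_def fun_eq_iff by metis
    qed
    have b_slice: "b = top_part w \<gamma> (slice x u)"
    proof (rule poly_mapping_eqI)
      fix \<mu> show "lk b \<mu> = lk (top_part w \<gamma> (slice x u)) \<mu>"
        using xp[of \<mu>] by (auto simp: b_def slice_def top_part_def lk_restr in_keys_iff)
    qed
    have sl: "slice x u \<in> sliceA x" "slice x u \<in> below w \<gamma>" "slice x u \<noteq> 0"
      using slice_ringA[OF u(1)] slice_below[OF u(2)] False b_slice by (auto simp: top_part_def)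
    then obtain a j c where *: "slice x u = lmon a * yy ^ j * c" "a \<in> xexps" "c \<in> pol"
      unfolding sliceA_def by blast
    then have "c \<noteq> 0" using sl(3) by auto
    then obtain \<gamma>c where c: "c \<in> below w \<gamma>c" "top_part w \<gamma>c c \<noteq> 0" using exists_order by blast
    let ?\<delta> = "w a + real j * wy + \<gamma>c"
    have t: "top_part w ?\<delta> (slice x u) = lmon a * yh ^ j * top_part w \<gamma>c c"
      unfolding *(1) by (rule term_top(2)[OF *(2) c(1)])
    \<comment> \<open>Both top parts are nonzero, so each of the two levels bounds the
      other.\<close>
    have "?\<delta> \<le> \<gamma>" using t c(2) yh_nonzero by (intro top_nonzero_le[OF sl(2)]) simp
    moreover have "\<gamma> \<le> ?\<delta>"
      using term_top(1)[OF *(2) c(1), of j] False b_slice by (intro top_nonzero_le[of "slice x u"]) (auto simp: *(1))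
    ultimately have \<delta>: "?\<delta> = \<gamma>" by simp
    have b: "b = lmon a * yh ^ j * top_part w \<gamma>c c" using t b_slice unfolding \<delta> by simp
    obtain \<mu> where \<mu>: "\<mu> \<in> supp (top_part w \<gamma>c c)" using c(2) by fastforce
    have "top_part w \<gamma>c c \<in> form (wt \<mu>)"
    proof -
      have "wt \<nu> = wt \<mu>" if "\<nu> \<in> supp (top_part w \<gamma>c c)" for \<nu>
      proof -
        have "w \<nu> = w \<mu>" using that \<mu> by (simp add: top_part_def supp_restr)
        then have "mdeg \<nu> m = mdeg \<mu> m" using w_inj by metis
        then show ?thesis by (simp add: mdeg_def)
      qed
      moreover have "top_part w \<gamma>c c \<in> pol" using *(3) by (simp add: pol_def top_part_def supp_restr)
      ultimately show ?thesis by (simp add: form_def)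
    qed
    then have bh: "b \<in> homog" unfolding b by (intro homogI *(2))
    have "wtb b = \<gamma>"
      using hdeg_kd[OF bh] \<nu> wb(1)[OF \<nu>] by (auto simp: hdeg_def wtb_def w_def)
    then show ?thesis using bh by simp
  qed
  then show "top_part w \<gamma> u \<in> homog" and "top_part w \<gamma> u \<noteq> 0 \<Longrightarrow> wtb (top_part w \<gamma> u) = \<gamma>"
    by (auto simp: b_def)
qed

lemma exists_lift:
  assumes "b \<in> homog" "b \<noteq> 0"
  shows "\<exists>u\<in>ringA. u \<in> below w (wtb b) \<and> top_part w (wtb b) u = b"
proof -
  obtain a j c W where *: "a \<in> xexps" "c \<in> form W" "b = lmon a * yh ^ j * c" using assms(1) by (rule homogE)
  have c: "c \<in> below w (\<beta> m * real_of_int W) \<and> top_part w (\<beta> m * real_of_int W) c = c"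
    using form_weight[OF *(2)] by (intro exact_top)
  define u where "u = lmon a * yy ^ j * c"
  let ?\<gamma> = "w a + real j * wy + \<beta> m * real_of_int W"
  have u: "u \<in> ringA" "u \<in> below w ?\<gamma>" "top_part w ?\<gamma> u = b"
    unfolding u_def *(3) using term_top[OF *(1), of c "\<beta> m * real_of_int W" j] c
      ringA_term[OF *(1) form_pol[OF *(2)]] by auto
  then have "wtb b = ?\<gamma>" using top_ringA(2)[OF u(1,2)] assms(2) by simp
  then show ?thesis using u by auto
qed

section \<open>Generators and the slope of an exponential map\<close>

definition gens :: "'f laurent set" where
  "gens = insert yy (xvar ` {..<m + 2})"

definition ord :: "'f laurent \<Rightarrow> real" where
  "ord b = (SOME \<gamma>. b \<in> below w \<gamma> \<and> top_part w \<gamma> b \<noteq> 0)"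

lemma ord: "b \<noteq> 0 \<Longrightarrow> b \<in> below w (ord b)" "b \<noteq> 0 \<Longrightarrow> top_part w (ord b) b \<noteq> 0"
  using someI_ex[OF exists_order, of b] by (simp_all add: ord_def)

lemma ord_eq: "b \<in> below w \<gamma> \<Longrightarrow> top_part w \<gamma> b \<noteq> 0 \<Longrightarrow> ord b = \<gamma>"
  using top_nonzero_le ord by (metis antisym_conv restr_0 top_part_def)

lemma gens_ringA: "b \<in> gens \<Longrightarrow> b \<in> ringA"
  by (auto simp: gens_def ringA_yy ringA_var)

lemma exists_moved_gen: "\<exists>b\<in>gens. \<exists>j>0. cf (\<phi> b) j \<noteq> 0"
proof (rule ccontr)
  assume no: "\<not> ?thesis"
  have fx: "\<phi> b = [:b:]" if "b \<in> gens" for b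
  proof (rule poly_eqI)
    fix j show "cf (\<phi> b) j = cf [:b:] j"
      using no that \<phi>_0[OF gens_ringA[OF that]] by (cases j) auto
  qed
  have "u \<in> {u \<in> ringA. \<phi> u = [:u:]}" if "u \<in> ringA" for u
    by (rule ringA_generated[OF _ _ _ _ _ that])
      (auto simp: fx gens_def \<phi>_sc \<phi>_add \<phi>_mult ringA_add ringA_mult ringA_var ringA_yy)
  then show False using \<phi>_nontriv by blast
qed

definition moves :: "('f laurent \<times> nat) set" where
  "moves = {(b, j). b \<in> gens \<and> j > 0 \<and> cf (\<phi> b) j \<noteq> 0}"

definition slope :: "'f laurent \<times> nat \<Rightarrow> real" where
  "slope x = (ord (cf (\<phi> (fst x)) (snd x)) - ord (fst x)) / real (snd x)"

text \<open>The maximum runs over finitely many coefficients of generators, and exists because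
  \<open>\<phi>\<close> moves some generator; \<open>ringA_good\<close> extends the bound to all of
  \<open>A\<close>.\<close>

definition lam :: real where "lam = Max (slope ` moves)"

lemma finite_moves: "finite moves"
proof -
  have "moves \<subseteq> (SIGMA b:gens. {..Polynomial.degree (\<phi> b)})"
    by (auto simp: moves_def intro: le_degree)
  moreover have "finite gens" by (simp add: gens_def)
  ultimately show ?thesis by (meson finite_SigmaI finite_atMost finite_subset)
qed

lemma slope_le: "x \<in> moves \<Longrightarrow> slope x \<le> lam"
  unfolding lam_def using finite_moves by (intro Max_ge) auto

lemma exists_max_move: "\<exists>x\<in>moves. slope x = lam"
proof -
  have "moves \<noteq> {}" using exists_moved_gen by (auto simp: moves_def)
  then have "lam \<in> slope ` moves" unfolding lam_def using finite_moves by (intro Max_in) auto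
  then show ?thesis by auto
qed

definition good :: "real \<Rightarrow> 'f laurent set" where
  "good \<gamma> = {a \<in> ringA. \<forall>j. cf (\<phi> a) j \<in> below w (\<gamma> + real j * lam)}"

lemma yy_nonzero: "yy \<noteq> 0"
  using yy_top yh_nonzero by (auto simp: top_part_def)

lemma good_gen: "b \<in> gens \<Longrightarrow> b \<in> good (ord b)"
proof -
  assume b: "b \<in> gens"
  have b0: "b \<noteq> 0" using b yy_nonzero by (auto simp: gens_def)
  have "cf (\<phi> b) j \<in> below w (ord b + real j * lam)" for j
  proof (cases "j = 0 \<or> cf (\<phi> b) j = 0")
    case True
    then show ?thesis using \<phi>_0[OF gens_ringA[OF b]] ord(1)[OF b0] by auto
  next
    case False
    then have "slope (b, j) \<le> lam" using b by (intro slope_le) (simp add: moves_def)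
    then have "ord (cf (\<phi> b) j) \<le> ord b + real j * lam"
      using False by (simp add: slope_def pos_divide_le_eq algebra_simps)
    then show ?thesis using ord(1)[of "cf (\<phi> b) j"] False by (blast intro: below_mono)
  qed
  then show ?thesis using gens_ringA[OF b] by (simp add: good_def)
qed

lemma good_mult: "a \<in> good \<gamma> \<Longrightarrow> b \<in> good \<gamma>' \<Longrightarrow> a * b \<in> good (\<gamma> + \<gamma>')"
proof -
  assume a: "a \<in> good \<gamma>" and b: "b \<in> good \<gamma>'"
  have "cf (\<phi> a * \<phi> b) j \<in> below w (\<gamma> + \<gamma>' + real j * lam)" for j
    unfolding coeff_mult
  proof (rule below_sum)
    fix i assume "i \<in> {..j}"
    then have e: "\<gamma> + \<gamma>' + real j * lam = (\<gamma> + real i * lam) + (\<gamma>' + real (j - i) * lam)"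
      by (simp add: of_nat_diff algebra_simps)
    show "cf (\<phi> a) i * cf (\<phi> b) (j - i) \<in> below w (\<gamma> + \<gamma>' + real j * lam)"
      unfolding e using a b by (intro below_mult) (auto simp: good_def)
  qed
  then show ?thesis using a b by (simp add: good_def \<phi>_mult ringA_mult)
qed

lemma good_add: "a \<in> good \<gamma> \<Longrightarrow> b \<in> good \<gamma> \<Longrightarrow> a + b \<in> good \<gamma>"
  by (simp add: good_def \<phi>_add ringA_add below_add)

lemma good_sc: "sc k \<in> good 0"
  using below_sc by (auto simp: good_def \<phi>_sc coeff_pCons split: nat.splits)

lemma good_mono: "a \<in> good \<gamma> \<Longrightarrow> \<gamma> \<le> \<gamma>' \<Longrightarrow> a \<in> good \<gamma>'"
  by (auto simp: good_def intro: below_mono)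

lemma good_power: "a \<in> good \<gamma> \<Longrightarrow> a ^ n \<in> good (real n * \<gamma>)"
proof (induction n)
  case 0
  show ?case using good_sc[of 1] by simp
next
  case (Suc n)
  then show ?case using good_mult[of a \<gamma> "a ^ n" "real n * \<gamma>"] by (simp add: algebra_simps)
qed

lemma good_0: "0 \<in> good \<gamma>"
  using \<phi>_sc[of 0] by (simp add: good_def)

lemma good_sum: "(\<And>i. i \<in> I \<Longrightarrow> h i \<in> good \<gamma>) \<Longrightarrow> sum h I \<in> good \<gamma>"
  by (induction I rule: infinite_finite_induct) (auto intro: good_add good_0)

lemma ord_var: "ord (xvar l) = w (unit_exp l 1)"
  using exact_top[of "xvar l" "w (unit_exp l 1)"] by (intro ord_eq) (auto simp: xvar_def)

lemma ord_yy: "ord yy = wy"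
  using yy_top yh_nonzero by (intro ord_eq) auto

lemma good_var: "l < m + 2 \<Longrightarrow> xvar l \<in> good (w (unit_exp l 1))"
  using good_gen[of "xvar l"] by (simp add: gens_def ord_var)

lemma w_unit_exp: "w (unit_exp l (int n)) = real n * w (unit_exp l 1)"
proof (induction n)
  case (Suc n)
  have "unit_exp l (int (Suc n)) = unit_exp l (int n) + unit_exp l 1" by (simp add: unit_exp_add add.commute)
  then show ?case using Suc by (simp only: w_add) (simp add: algebra_simps)
qed (simp add: w_0)

lemma good_lmon:
  assumes "\<forall>l. lk a l \<ge> 0" "\<forall>l\<ge>n. lk a l = 0" "n \<le> m + 2"
  shows "lmon a \<in> good (w a)"
  using assms
proof (induction n arbitrary: a)
  case 0
  then have "a = 0" by (intro poly_mapping_eqI) auto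
  then show ?case using good_sc[of 1] by (simp add: w_0)
next
  case (Suc n)
  define k where "k = nat (lk a n)"
  define b where "b = a - unit_exp n (int k)"
  have k: "lk a n = int k" using Suc.prems by (simp add: k_def)
  have b: "\<forall>l. lk b l \<ge> 0" "\<forall>l\<ge>n. lk b l = 0"
    using Suc.prems k by (auto simp: b_def lookup_minus lk_unit_exp)
  have a: "a = b + unit_exp n (int k)" by (simp add: b_def)
  have "lmon b \<in> good (w b)" using Suc.IH[OF b] Suc.prems by simp
  moreover have "xvar n ^ k \<in> good (w (unit_exp n (int k)))"
    unfolding w_unit_exp using Suc.prems by (intro good_power good_var) simp
  ultimately show ?case
    unfolding a w_add lmon_mult[symmetric] xvar_power by (rule good_mult)
qed

text \<open>The bound passes from generators to products and sums, but a sum could have smaller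
  order than its summands. This does not happen here: distinct slices share no exponents, and the
  order of a single term is the sum of the orders of its factors.\<close>

lemma ringA_good:
  assumes u: "u \<in> ringA" "u \<in> below w \<gamma>"
  shows "u \<in> good \<gamma>"
proof -
  have "slice x u \<in> good \<gamma>" for x
  proof (cases "slice x u = 0")
    case True
    then show ?thesis by (simp add: good_0)
  next
    case False
    then obtain a j c where *: "slice x u = lmon a * yy ^ j * c" "a \<in> xexps" "c \<in> pol"
      using slice_ringA[OF u(1), of x] unfolding sliceA_def by blast
    then have "c \<noteq> 0" using False by auto
    then obtain \<gamma>c where c: "c \<in> below w \<gamma>c" "top_part w \<gamma>c c \<noteq> 0" using exists_order by blast
    have "top_part w (w a + real j * wy + \<gamma>c) (slice x u) \<noteq> 0"
      unfolding *(1) term_top(2)[OF *(2) c(1)] using c(2) yh_nonzero by simp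
    from top_nonzero_le[OF slice_below[OF u(2)] this]
    have le: "w a + real j * wy + \<gamma>c \<le> \<gamma>" .
    have "c \<in> good \<gamma>c"
    proof (subst laurent_expand[of c], rule good_sum)
      fix \<mu> assume \<mu>: "\<mu> \<in> supp c"
      have "lmon \<mu> \<in> good (w \<mu>)"
        using \<mu> *(3) by (intro good_lmon[of _ "m + 2"]) (auto simp: pol_def)
      from good_mult[OF good_sc this] have "sc (lk c \<mu>) * lmon \<mu> \<in> good (w \<mu>)" by simp
      moreover have "w \<mu> \<le> \<gamma>c" using c(1) \<mu> by (simp add: below_def)
      ultimately show "sc (lk c \<mu>) * lmon \<mu> \<in> good \<gamma>c" by (rule good_mono)
    qed
    moreover have "lmon a \<in> good (w a)"
      using *(2) by (intro good_lmon[of _ m]) (auto simp: xexps_def)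
    moreover have "yy ^ j \<in> good (real j * wy)"
      using good_power[OF good_gen[of yy]] by (simp add: gens_def ord_yy)
    ultimately have "slice x u \<in> good (w a + real j * wy + \<gamma>c)"
      unfolding *(1) by (intro good_mult)
    then show ?thesis using le by (rule good_mono)
  qed
  then show ?thesis by (subst sum_slices[of u]) (rule good_sum)
qed

text \<open>The homogenization: \<open>lam\<close> is the largest slope by which \<open>\<phi>\<close> raises weights, and only the
  coefficients attaining it are kept.\<close>

definition TT :: "real \<Rightarrow> 'f laurent \<Rightarrow> 'f laurent poly" where
  "TT \<gamma> u = top_poly lam \<gamma> (\<phi> u)"

lemma cf_TT: "cf (TT \<gamma> u) j = top_part w (\<gamma> + real j * lam) (cf (\<phi> u) j)"
  by (simp add: TT_def cf_top_poly)

lemma below_coeff: "u \<in> ringA \<Longrightarrow> u \<in> below w \<gamma> \<Longrightarrow> cf (\<phi> u) j \<in> below w (\<gamma> + real j * lam)"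
  using ringA_good by (simp add: good_def)

text \<open>An element of strictly smaller weight has all its coefficients strictly below the
  threshold; hence \<open>TT \<gamma> u\<close> depends only on the leading form of
  \<open>u\<close>.\<close>

lemma TT_zero:
  assumes "u \<in> ringA" "u \<in> below w \<gamma>" "top_part w \<gamma> u = 0"
  shows "TT \<gamma> u = 0"
proof (rule poly_eqI)
  fix j
  obtain \<gamma>' where "\<gamma>' < \<gamma>" "u \<in> below w \<gamma>'" using below_strict assms by blast
  then have "cf (\<phi> u) j \<in> below w (\<gamma>' + real j * lam)" "\<gamma>' + real j * lam < \<gamma> + real j * lam"
    using below_coeff assms(1) by auto
  then show "cf (TT \<gamma> u) j = cf 0 j" by (simp add: cf_TT top_part_strict)
qed

lemma TT_add: "u \<in> ringA \<Longrightarrow> v \<in> ringA \<Longrightarrow> TT \<gamma> (u + v) = TT \<gamma> u + TT \<gamma> v"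
  by (simp add: TT_def \<phi>_add top_poly_add)

section \<open>The induced map on leading forms\<close>

definition lift :: "'f laurent \<Rightarrow> 'f laurent" where
  "lift b = (SOME u. u \<in> ringA \<and> u \<in> below w (wtb b) \<and> top_part w (wtb b) u = b)"

lemma lift:
  assumes "b \<in> homog" "b \<noteq> 0"
  shows "lift b \<in> ringA" "lift b \<in> below w (wtb b)" "top_part w (wtb b) (lift b) = b"
proof -
  have "\<exists>u. u \<in> ringA \<and> u \<in> below w (wtb b) \<and> top_part w (wtb b) u = b"
    using exists_lift[OF assms] by blast
  from someI_ex[OF this] show "lift b \<in> ringA" "lift b \<in> below w (wtb b)" "top_part w (wtb b) (lift b) = b"
    by (simp_all add: lift_def)
qed

definition \<Phi> :: "'f laurent \<Rightarrow> 'f laurent poly" where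
  "\<Phi> b = (if b = 0 then 0 else TT (wtb b) (lift b))"

text \<open>Two lifts of the same leading form differ by an element of lower weight, which
  \<open>TT\<close> annihilates.\<close>

lemma \<Phi>_top:
  assumes u: "u \<in> ringA" "u \<in> below w \<gamma>"
  shows "\<Phi> (top_part w \<gamma> u) = TT \<gamma> u"
proof (cases "top_part w \<gamma> u = 0")
  case True
  then show ?thesis using TT_zero[OF u] by (simp add: \<Phi>_def)
next
  case False
  define b where "b = top_part w \<gamma> u"
  have b: "b \<in> homog" "b \<noteq> 0" "wtb b = \<gamma>" using top_ringA[OF u] False by (simp_all add: b_def)
  note l = lift[OF b(1,2), unfolded b(3)]
  have "u - lift b \<in> ringA" "u - lift b \<in> below w \<gamma>" "top_part w \<gamma> (u - lift b) = 0"
    using u l by (auto simp: ringA_minus below_diff top_part_def restr_minus b_def)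
  then have "TT \<gamma> (u - lift b) = 0" by (rule TT_zero)
  then have "TT \<gamma> u = TT \<gamma> (lift b)"
    using TT_add[of "u - lift b" "lift b" \<gamma>] l u ringA_minus by simp
  then show ?thesis using b by (simp add: \<Phi>_def flip: b_def)
qed

lemma exists_lift_any:
  assumes "b \<in> homog"
  obtains u where "u \<in> ringA" "u \<in> below w (wtb b)" "top_part w (wtb b) u = b"
proof (cases "b = 0")
  case True
  then show ?thesis using that[of 0] by (simp add: top_part_def)
next
  case False
  then show ?thesis using that lift[OF assms] by blast
qed

lemma \<Phi>_homog: "b \<in> homog \<Longrightarrow> cf (\<Phi> b) j \<in> homog"
  and \<Phi>_0: "b \<in> homog \<Longrightarrow> cf (\<Phi> b) 0 = b"
  and \<Phi>_weight: "b \<in> homog \<Longrightarrow> cf (\<Phi> b) j \<noteq> 0 \<Longrightarrow> wtb (cf (\<Phi> b) j) = wtb b + real j * lam"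
  and \<Phi>_iter: "b \<in> homog \<Longrightarrow> cf (\<Phi> (cf (\<Phi> b) j)) i = of_nat (i + j choose i) * cf (\<Phi> b) (i + j)"
proof -
  assume b: "b \<in> homog"
  obtain u where u: "u \<in> ringA" "u \<in> below w (wtb b)" "top_part w (wtb b) u = b"
    using exists_lift_any[OF b] .
  have \<Phi>b: "\<Phi> b = TT (wtb b) u" using \<Phi>_top[OF u(1,2)] u(3) by simp
  have D: "cf (\<phi> u) j \<in> ringA" "cf (\<phi> u) j \<in> below w (wtb b + real j * lam)" for j
    using \<phi>_ringA[OF u(1)] below_coeff[OF u(1,2)] by auto
  show "cf (\<Phi> b) j \<in> homog" unfolding \<Phi>b cf_TT by (rule top_ringA(1)[OF D])
  show "cf (\<Phi> b) 0 = b" unfolding \<Phi>b cf_TT by (simp add: \<phi>_0 u)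
  show "wtb (cf (\<Phi> b) j) = wtb b + real j * lam" if "cf (\<Phi> b) j \<noteq> 0"
    using that unfolding \<Phi>b cf_TT by (rule top_ringA(2)[OF D])
  have ofn: "of_nat n * x = sc (of_nat n) * x" for n and x :: "'f laurent"
    by (simp add: sc_def)
  have e: "wtb b + real j * lam + real i * lam = wtb b + real (i + j) * lam" by (simp add: algebra_simps)
  show "cf (\<Phi> (cf (\<Phi> b) j)) i = of_nat (i + j choose i) * cf (\<Phi> b) (i + j)"
    unfolding \<Phi>b cf_TT[of _ u] \<Phi>_top[OF D]
    unfolding cf_TT \<phi>_iter[OF u(1)] ofn top_part_sc_mult e ..
qed

lemma \<Phi>_mult:
  assumes "b \<in> homog" "b' \<in> homog"
  shows "\<Phi> (b * b') = \<Phi> b * \<Phi> b'"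
proof -
  obtain u where u: "u \<in> ringA" "u \<in> below w (wtb b)" "top_part w (wtb b) u = b"
    using exists_lift_any[OF assms(1)] .
  obtain v where v: "v \<in> ringA" "v \<in> below w (wtb b')" "top_part w (wtb b') v = b'"
    using exists_lift_any[OF assms(2)] .
  have "b * b' = top_part w (wtb b + wtb b') (u * v)"
    using top_part_mult[OF u(2) v(2)] u(3) v(3) by simp
  then have "\<Phi> (b * b') = TT (wtb b + wtb b') (u * v)"
    using \<Phi>_top[OF ringA_mult[OF u(1) v(1)] below_mult[OF u(2) v(2)]] by simp
  also have "\<dots> = TT (wtb b) u * TT (wtb b') v"
    unfolding TT_def \<phi>_mult[OF u(1) v(1)]
    by (intro top_poly_mult below_coeff u v)
  also have "\<dots> = \<Phi> b * \<Phi> b'"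
    using \<Phi>_top[OF u(1,2)] \<Phi>_top[OF v(1,2)] u(3) v(3) by simp
  finally show ?thesis .
qed

lemma \<Phi>_add:
  assumes "c \<in> form W" "c' \<in> form W"
  shows "\<Phi> (c + c') = \<Phi> c + \<Phi> c'"
proof -
  define \<gamma> where "\<gamma> = \<beta> m * real_of_int W"
  have *: "\<Phi> c = TT \<gamma> c" if "c \<in> form W" for c
  proof -
    have "c \<in> below w \<gamma> \<and> top_part w \<gamma> c = c"
      using form_weight[OF that] unfolding \<gamma>_def by (intro exact_top)
    then show ?thesis using \<Phi>_top[OF ringA_pol[OF form_pol[OF that]], of \<gamma>] by simp
  qed
  show ?thesis using assms by (simp add: * form_add TT_add ringA_pol form_pol)
qed

lemma TT_const: "\<phi> u = [:u:] \<Longrightarrow> TT \<gamma> u = [:top_part w \<gamma> u:]"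
  by (rule poly_eqI) (auto simp: cf_TT coeff_pCons top_part_def split: nat.splits)

lemma \<Phi>_sc: "\<Phi> (sc k) = [:sc k:]"
proof -
  have "sc k \<in> below w 0 \<and> top_part w 0 (sc k) = sc k"
    by (intro exact_top) (auto simp: supp_sc w_0 split: if_splits)
  then show ?thesis using \<Phi>_top[of "sc k" 0] TT_const[OF \<phi>_sc] by simp
qed

text \<open>The leading form of a fixed \<open>h\<close> is fixed, and a negative exponent at
  \<open>i\<close> forces it to contain \<open>yh\<close>, which is then fixed as a divisor. A move
  attaining \<open>lam\<close> keeps \<open>\<Phi>\<close> nontrivial, so the homogeneous
  contradiction applies.\<close>

theorem no_fixed_element:
  assumes h: "h \<in> ringA" "\<phi> h = [:h:]" "h \<noteq> 0" and i: "i < m"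
    and top: "\<And>\<mu>. \<mu> \<in> supp h \<Longrightarrow> (\<forall>\<nu>\<in>supp h. w \<nu> \<le> w \<mu>) \<Longrightarrow> lk \<mu> i < 0"
  shows False
proof -
  obtain \<gamma> where \<gamma>: "h \<in> below w \<gamma>" "top_part w \<gamma> h \<noteq> 0" using exists_order[OF h(3)] by blast
  define b where "b = top_part w \<gamma> h"
  have b: "b \<in> homog" "b \<noteq> 0" using top_ringA[OF h(1) \<gamma>(1)] \<gamma>(2) by (simp_all add: b_def)
  have \<Phi>b: "\<Phi> b = [:b:]" using \<Phi>_top[OF h(1) \<gamma>(1)] TT_const[OF h(2)] by (simp add: b_def)
  obtain a j c W where *: "a \<in> xexps" "c \<in> form W" "b = lmon a * yh ^ j * c" using b(1) by (rule homogE)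
  obtain \<mu> where \<mu>: "\<mu> \<in> supp b" using b(2) by fastforce
  have "lk \<mu> i < 0"
    using \<mu> \<gamma>(1) by (intro top) (auto simp: b_def top_part_def supp_restr below_def)
  moreover have "mdeg \<mu> i = bdeg a j W i"
    using hdeg_homog[OF *(1,2), of j] \<mu> *(3) by (simp add: hdeg_def)
  moreover have "lk a i \<ge> 0" using *(1) by (simp add: xexps_def)
  ultimately have "j \<noteq> 0" using i by (intro notI) (simp add: mdeg_def bdeg_def)
  then obtain j' where j: "j = Suc j'" by (cases j) auto
  define r where "r = lmon a * yh ^ j' * c"
  have r: "r \<in> homog" unfolding r_def by (rule homogI[OF *(1,2)])
  have br: "b = r * yh" by (simp add: *(3) j r_def mult_ac)
  have nz: "\<Phi> u \<noteq> 0" if "u \<in> homog" "u \<noteq> 0" for u using \<Phi>_0[OF that(1)] that(2) by fastforce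
  have "Polynomial.degree (\<Phi> r) + Polynomial.degree (\<Phi> yh) = Polynomial.degree (\<Phi> b)"
    unfolding br \<Phi>_mult[OF r homog_yh] using nz[OF r] nz[OF homog_yh yh_nonzero] b(2) br
    by (subst degree_mult_eq) auto
  then have "Polynomial.degree (\<Phi> yh) = 0" using \<Phi>b by simp
  then have \<Phi>yh: "\<Phi> yh = [:yh:]" using \<Phi>_0[OF homog_yh] by (metis coeff_pCons_0 degree_eq_zeroE)
  obtain x where x: "x \<in> moves" "slope x = lam" using exists_max_move by blast
  obtain b1 j1 where x1: "x = (b1, j1)" by (cases x)
  have b1: "b1 \<in> gens" "j1 > 0" "cf (\<phi> b1) j1 \<noteq> 0" using x(1) by (auto simp: x1 moves_def)
  have b10: "b1 \<noteq> 0" using b1 yy_nonzero by (auto simp: gens_def)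
  define t1 where "t1 = top_part w (ord b1) b1"
  have t1: "t1 \<in> homog" "t1 \<noteq> 0" "\<Phi> t1 = TT (ord b1) b1"
    using top_ringA(1)[OF gens_ringA[OF b1(1)] ord(1)[OF b10]] ord(2)[OF b10]
      \<Phi>_top[OF gens_ringA[OF b1(1)] ord(1)[OF b10]] by (simp_all add: t1_def)
  have "ord (cf (\<phi> b1) j1) = ord b1 + real j1 * lam"
    using x(2) b1(2) by (simp add: x1 slope_def field_simps)
  then have moved: "cf (\<Phi> t1) j1 \<noteq> 0" using ord(2)[OF b1(3)] by (simp add: t1(3) cf_TT)
  \<comment> \<open>The maximal move calibrates the slope: every coefficient shifts the weight by
    \<open>j lam\<close>, hence, by independence, the degree by
    \<open>j \<Delta> / j1\<close>.\<close>
  define \<Delta> where "\<Delta> l = kd (cf (\<Phi> t1) j1) l - kd t1 l" for l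
  have \<Delta>: "WW \<Delta> = real j1 * lam"
    using \<Phi>_weight[OF t1(1) moved] unfolding wtb_def \<Delta>_def
    by (simp add: WW_def right_diff_distrib sum_subtractf)
  interpret homog_exp m p fld \<Phi> j1 \<Delta>
  proof
    fix b j l assume b: "b \<in> homog" "cf (\<Phi> b) j \<noteq> 0" and l: "l \<le> m"
    have "WW (\<lambda>l. kd (cf (\<Phi> b) j) l - kd b l) = real j * lam"
      using \<Phi>_weight[OF b] unfolding wtb_def by (simp add: WW_def right_diff_distrib sum_subtractf)
    moreover have sm: "WW (\<lambda>l. int n * \<theta> l) = real n * WW \<theta>" for n \<theta>
      by (simp add: WW_def sum_distrib_left mult_ac)
    ultimately have "WW (\<lambda>l. int j1 * (kd (cf (\<Phi> b) j) l - kd b l)) = WW (\<lambda>l. int j * \<Delta> l)"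
      unfolding sm \<Delta> by simp
    from WW_inj[OF this l] show "int j1 * (kd (cf (\<Phi> b) j) l - kd b l) = int j * \<Delta> l" .
  next
    have "\<Phi> t1 \<noteq> [:t1:]" using moved b1(2) by (auto simp: coeff_pCons split: nat.splits)
    then show "\<exists>b\<in>homog. \<Phi> b \<noteq> [:b:]" using t1(1) by blast
  qed (use \<Phi>_homog \<Phi>_0 b1(2) \<Phi>_add \<Phi>_mult \<Phi>_sc \<Phi>_iter \<Phi>yh in auto)
  show False by (rule contradiction)
qed

end

text \<open>A negative exponent could be made dominant by a generic weight, against
  \<open>no_fixed_element\<close>. Thus fixed elements of \<open>A\<close> lie in
  \<open>k[X, Z, T]\<close>.\<close>

theorem (in ring_exp) fixed_exponents_nonneg:
  assumes h: "h \<in> ringA" "\<phi> h = [:h:]" and \<mu>: "\<mu> \<in> supp h"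
  shows "lk \<mu> i \<ge> 0"
proof (rule ccontr)
  assume neg: "\<not> lk \<mu> i \<ge> 0"
  have i: "i < m"
    using supp_nonneg[OF h(1), of i] \<mu> neg by (auto simp: nonneg_iff intro: ccontr)
  have fin: "finite (mdeg ` supp h)" by simp
  have mem: "mdeg \<mu> \<in> mdeg ` supp h" using \<mu> by simp
  have "mdeg \<mu> i < 0" using neg i by (simp add: mdeg_def)
  from exists_independent_weights[OF fin mem this i] obtain \<beta> where
    \<beta>: "\<forall>\<theta> :: nat \<Rightarrow> int. (\<Sum>l\<le>m. \<beta> l * real_of_int (\<theta> l)) = 0 \<longrightarrow> (\<forall>l\<le>m. \<theta> l = 0)" "\<beta> m > 0"
    and top: "\<forall>\<theta>\<in>mdeg ` supp h. (\<forall>\<theta>'\<in>mdeg ` supp h. (\<Sum>l\<le>m. \<beta> l * real_of_int (\<theta>' l)) \<le> (\<Sum>l\<le>m. \<beta> l * real_of_int (\<theta> l))) \<longrightarrow> \<theta> i < 0"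
    by blast
  interpret weighted_ring_exp m p fld \<phi> \<beta>
    by standard (use \<beta> in blast)+
  show False
  proof (rule no_fixed_element[OF h _ i])
    show "h \<noteq> 0" using \<mu> by auto
    fix \<nu> assume "\<nu> \<in> supp h" "\<forall>\<mu>\<in>supp h. w \<mu> \<le> w \<nu>"
    then have "mdeg \<nu> i < 0" using top by (auto simp: w_def WW_def)
    then show "lk \<nu> i < 0" using i by (simp add: mdeg_def)
  qed
qed

section \<open>Translations of polynomial rings\<close>

definition lin_ext :: "('f::field \<Rightarrow> 'b::comm_ring_1) \<Rightarrow> (expo \<Rightarrow> 'b) \<Rightarrow> 'f laurent \<Rightarrow> 'b" where
  "lin_ext \<kappa> M a = (\<Sum>\<mu>\<in>supp a. \<kappa> (lk a \<mu>) * M \<mu>)"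

text \<open>Multiplicativity is demanded only on exponents in \<open>S\<close>, because the monomial
  maps in use truncate some exponents by \<open>nat\<close>; additivity of the extension holds
  everywhere.\<close>

locale lin_ext_hom =
  fixes \<kappa> :: "'f::field \<Rightarrow> 'b::comm_ring_1" and M :: "expo \<Rightarrow> 'b" and S :: "expo set"
  assumes \<kappa>_0: "\<kappa> 0 = 0" and \<kappa>_1: "\<kappa> 1 = 1" and \<kappa>_add: "\<kappa> (a + b) = \<kappa> a + \<kappa> b" and \<kappa>_mult: "\<kappa> (a * b) = \<kappa> a * \<kappa> b"
    and M_0: "M 0 = 1" and M_add: "\<mu> \<in> S \<Longrightarrow> \<nu> \<in> S \<Longrightarrow> M (\<mu> + \<nu>) = M \<mu> * M \<nu>"
    and S_0: "0 \<in> S" and S_add: "\<mu> \<in> S \<Longrightarrow> \<nu> \<in> S \<Longrightarrow> \<mu> + \<nu> \<in> S"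
begin

abbreviation "ext \<equiv> lin_ext \<kappa> M"

lemma ext_add: "ext (a + b) = ext a + ext b"
  unfolding lin_ext_def
  by (rule setsum_keys_plus_distrib) (simp_all add: \<kappa>_0 \<kappa>_add distrib_right)

lemma ext_0 [simp]: "ext 0 = 0"
  by (simp add: lin_ext_def)

lemma ext_sum: "ext (sum h I) = (\<Sum>i\<in>I. ext (h i))"
  by (induction I rule: infinite_finite_induct) (simp_all add: ext_add)

lemma ext_single: "ext (sc c * lmon \<mu>) = \<kappa> c * M \<mu>"
  by (simp add: lin_ext_def sc_mult_lmon \<kappa>_0)

lemma ext_lmon: "ext (lmon \<mu>) = M \<mu>"
  using ext_single[of 1 \<mu>] by (simp add: \<kappa>_1)

lemma ext_sc: "ext (sc c) = \<kappa> c"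
  using ext_single[of c 0] by (simp add: M_0)

lemma ext_1 [simp]: "ext 1 = 1"
  using ext_sc[of 1] by (simp add: \<kappa>_1)

lemma ext_minus: "ext (a - b) = ext a - ext b"
  using ext_add[of "a - b" b] by (simp add: algebra_simps)

lemma ext_mult:
  assumes "supp a \<subseteq> S" "supp b \<subseteq> S"
  shows "ext (a * b) = ext a * ext b"
proof -
  have "a * b = (\<Sum>\<mu>\<in>supp a. \<Sum>\<nu>\<in>supp b. sc (lk a \<mu> * lk b \<nu>) * lmon (\<mu> + \<nu>))"
    by (subst (1) laurent_expand[of a], subst (1) laurent_expand[of b])
      (simp add: sum_product sc_mult mult_ac flip: lmon_mult)
  then have "ext (a * b) = (\<Sum>\<mu>\<in>supp a. \<Sum>\<nu>\<in>supp b. \<kappa> (lk a \<mu> * lk b \<nu>) * M (\<mu> + \<nu>))"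
    by (simp only: ext_sum ext_single)
  also have "\<dots> = (\<Sum>\<mu>\<in>supp a. \<Sum>\<nu>\<in>supp b. (\<kappa> (lk a \<mu>) * M \<mu>) * (\<kappa> (lk b \<nu>) * M \<nu>))"
    using assms by (intro sum.cong refl) (auto simp: \<kappa>_mult M_add subset_iff mult_ac)
  finally show ?thesis by (simp add: lin_ext_def sum_product)
qed

definition dom :: "'f laurent set" where "dom = {a. supp a \<subseteq> S}"

lemma dom_mult: "a \<in> dom \<Longrightarrow> b \<in> dom \<Longrightarrow> a * b \<in> dom"
  unfolding dom_def by (auto dest!: supp_add_prod simp: S_add subset_iff)

lemma dom_add: "a \<in> dom \<Longrightarrow> b \<in> dom \<Longrightarrow> a + b \<in> dom"
  unfolding dom_def using keys_add[of a b] by blast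

lemma dom_minus: "a \<in> dom \<Longrightarrow> b \<in> dom \<Longrightarrow> a - b \<in> dom"
  unfolding dom_def using supp_minus[of a b] by blast

lemma dom_sc: "sc c \<in> dom"
  by (simp add: dom_def supp_sc S_0)

lemma dom_power: "a \<in> dom \<Longrightarrow> a ^ n \<in> dom"
  using dom_sc[of 1] by (induction n) (auto intro: dom_mult)

lemma dom_lmon: "\<mu> \<in> S \<Longrightarrow> lmon \<mu> \<in> dom"
  by (simp add: dom_def)

lemma ext_mult': "a \<in> dom \<Longrightarrow> b \<in> dom \<Longrightarrow> ext (a * b) = ext a * ext b"
  by (rule ext_mult) (simp_all add: dom_def)

lemma ext_power: "a \<in> dom \<Longrightarrow> ext (a ^ n) = ext a ^ n"
  by (induction n) (simp_all add: ext_mult' dom_power)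

end

definition polys :: "nat \<Rightarrow> 'f::field laurent set" where
  "polys N = {a. \<forall>\<mu>\<in>supp a. (\<forall>l. lk \<mu> l \<ge> 0) \<and> (\<forall>l\<ge>N. lk \<mu> l = 0)}"

lemma polys_add: "a \<in> polys N \<Longrightarrow> b \<in> polys N \<Longrightarrow> a + b \<in> polys N"
  unfolding polys_def using keys_add[of a b] by blast

lemma polys_minus: "a \<in> polys N \<Longrightarrow> b \<in> polys N \<Longrightarrow> a - b \<in> polys N"
  unfolding polys_def using supp_minus[of a b] by blast

lemma polys_mult: "a \<in> polys N \<Longrightarrow> b \<in> polys N \<Longrightarrow> a * b \<in> polys N"
  unfolding polys_def by (fastforce dest!: supp_add_prod simp: lookup_add)

lemma polys_sc [simp]: "sc c \<in> polys N"
  by (simp add: polys_def supp_sc)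

lemma polys_0 [simp]: "0 \<in> polys N" and polys_1 [simp]: "1 \<in> polys N"
  using polys_sc[of 0] polys_sc[of 1] by simp_all

lemma polys_power: "a \<in> polys N \<Longrightarrow> a ^ n \<in> polys N"
  by (induction n) (auto intro: polys_mult)

lemma polys_var: "l < N \<Longrightarrow> xvar l \<in> polys N"
  by (auto simp: polys_def xvar_def lk_unit_exp)

lemma polys_lmon: "(\<forall>l. lk \<mu> l \<ge> 0) \<Longrightarrow> (\<forall>l\<ge>N. lk \<mu> l = 0) \<Longrightarrow> lmon \<mu> \<in> polys N"
  by (simp add: polys_def)

lemma polys_induct [consumes 1, case_names sc add xvar]:
  assumes a: "a \<in> polys N"
    and sc: "\<And>c. P (sc c)" and add: "\<And>a b. a \<in> polys N \<Longrightarrow> b \<in> polys N \<Longrightarrow> P a \<Longrightarrow> P b \<Longrightarrow> P (a + b)"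
    and xvar: "\<And>a l. a \<in> polys N \<Longrightarrow> P a \<Longrightarrow> l < N \<Longrightarrow> P (xvar l * a)"
  shows "P a"
proof -
  have vp: "P (xvar l ^ n * a) \<and> xvar l ^ n * a \<in> polys N" if "P a" "a \<in> polys N" "l < N" for l n a
    using that by (induction n) (auto simp: mult.assoc intro: xvar polys_mult polys_var)
  have mono: "P (sc c * lmon \<mu>) \<and> sc c * lmon \<mu> \<in> polys N"
    if "n \<le> N" "\<forall>l. lk \<mu> l \<ge> 0" "\<forall>l\<ge>n. lk \<mu> l = 0" for n c \<mu>
    using that
  proof (induction n arbitrary: \<mu>)
    case 0
    then have "\<mu> = 0" by (intro poly_mapping_eqI) auto
    then show ?case using sc by simp
  next
    case (Suc n)
    define \<nu> where "\<nu> = \<mu> - unit_exp n (lk \<mu> n)"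
    have \<nu>: "\<forall>l. lk \<nu> l \<ge> 0" "\<forall>l\<ge>n. lk \<nu> l = 0"
      using Suc.prems by (auto simp: \<nu>_def lookup_minus lk_unit_exp)
    have "sc c * lmon \<mu> = xvar n ^ nat (lk \<mu> n) * (sc c * lmon \<nu>)"
      using Suc.prems by (simp add: xvar_power lmon_mult \<nu>_def mult.left_commute[of _ "sc c"])
    then show ?case using vp[of "sc c * lmon \<nu>" n "nat (lk \<mu> n)"] Suc.IH[OF _ \<nu>] Suc.prems(1) by (simp only: Suc_le_eq less_imp_le)
  qed
  have "P (\<Sum>\<mu>\<in>T. sc (lk a \<mu>) * lmon \<mu>) \<and> (\<Sum>\<mu>\<in>T. sc (lk a \<mu>) * lmon \<mu>) \<in> polys N"
    if "finite T" "T \<subseteq> supp a" for T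
    using that
  proof (induction T rule: finite_induct)
    case empty
    then show ?case using sc[of 0] by simp
  next
    case (insert \<mu> T)
    have "P (sc (lk a \<mu>) * lmon \<mu>) \<and> sc (lk a \<mu>) * lmon \<mu> \<in> polys N"
      using a insert.prems by (intro mono[of N]) (auto simp: polys_def)
    then show ?case using insert by (auto intro: add polys_add)
  qed
  from this[OF finite_keys subset_refl] show ?thesis by (simp flip: laurent_expand)
qed

section \<open>Translation of a single variable\<close>

definition nn_at :: "nat \<Rightarrow> expo set" where "nn_at i = {\<mu>. lk \<mu> i \<ge> 0}"

definition translate_mon :: "nat \<Rightarrow> expo \<Rightarrow> 'f::field laurent poly" where
  "translate_mon i \<mu> = [:lmon (\<mu> - unit_exp i (lk \<mu> i)):] * [:xvar i, 1:] ^ nat (lk \<mu> i)"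

definition translate :: "nat \<Rightarrow> 'f::field laurent \<Rightarrow> 'f laurent poly" where
  "translate i = lin_ext (\<lambda>c. [:sc c:]) (translate_mon i)"

lemma translate_hom: "lin_ext_hom (\<lambda>c. [:sc c:]) (translate_mon i :: expo \<Rightarrow> 'f::field laurent poly) (nn_at i)"
proof
  show "translate_mon i (\<mu> + \<nu>) = (translate_mon i \<mu> * translate_mon i \<nu> :: 'f laurent poly)"
    if "\<mu> \<in> nn_at i" "\<nu> \<in> nn_at i" for \<mu> \<nu>
  proof -
    have "\<mu> + \<nu> - unit_exp i (lk (\<mu> + \<nu>) i) = (\<mu> - unit_exp i (lk \<mu> i)) + (\<nu> - unit_exp i (lk \<nu> i))"
      by (simp add: lookup_add algebra_simps flip: unit_exp_add)
    moreover have "nat (lk (\<mu> + \<nu>) i) = nat (lk \<mu> i) + nat (lk \<nu> i)"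
      using that by (simp add: nn_at_def lookup_add nat_add_distrib)
    ultimately show ?thesis
      by (simp only: translate_mon_def power_add lmon_mult[symmetric]) (simp add: mult_ac)
  qed
qed (simp_all add: sc_add sc_mult translate_mon_def one_pCons nn_at_def lookup_add)

lemma cf_translate_mon:
  assumes "lk \<mu> i \<ge> 0"
  shows "cf (translate_mon i \<mu> :: 'f::field laurent poly) j
    = of_nat (nat (lk \<mu> i) choose j) * lmon (\<mu> - unit_exp i (int j))"
proof (cases "j \<le> nat (lk \<mu> i)")
  case True
  have "\<mu> - unit_exp i (lk \<mu> i) + unit_exp i (int (nat (lk \<mu> i) - j)) = \<mu> - unit_exp i (int j)"
    using True assms by (intro poly_mapping_eqI) (auto simp: lookup_add lookup_minus lk_unit_exp of_nat_diff)
  then have "(lmon (\<mu> - unit_exp i (lk \<mu> i)) :: 'f laurent) * xvar i ^ (nat (lk \<mu> i) - j) = lmon (\<mu> - unit_exp i (int j))"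
    by (simp only: xvar_power lmon_mult)
  moreover have "cf ([:xvar i, 1:] ^ nat (lk \<mu> i) :: 'f laurent poly) j
      = of_nat (nat (lk \<mu> i) choose j) * xvar i ^ (nat (lk \<mu> i) - j)"
    using coeff_linear_poly_power[OF True, of "xvar i :: 'f laurent" 1] by simp
  ultimately show ?thesis by (simp add: translate_mon_def mult.left_commute)
next
  case False
  then have "cf ([:xvar i, 1:] ^ nat (lk \<mu> i) :: 'f laurent poly) j = 0"
    by (intro coeff_eq_0) (simp add: degree_linear_power)
  then show ?thesis using False by (simp add: translate_mon_def binomial_eq_0)
qed

lemma cf_translate_single:
  assumes "lk \<mu> i \<ge> 0"
  shows "cf (translate i (sc c * lmon \<mu>)) j = sc (c * of_nat (nat (lk \<mu> i) choose j)) * lmon (\<mu> - unit_exp i (int j))"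
proof -
  interpret lin_ext_hom "\<lambda>c. [:sc c:]" "translate_mon i" "nn_at i" by (rule translate_hom)
  have ofn: "of_nat n = (sc (of_nat n) :: 'a laurent)" for n by (simp add: sc_def)
  show ?thesis unfolding translate_def ext_single by (simp add: cf_translate_mon[OF assms] sc_mult ofn mult.assoc)
qed

lemma translate_add: "translate i (a + b) = translate i a + translate i b"
proof -
  interpret lin_ext_hom "\<lambda>c. [:sc c:]" "translate_mon i" "nn_at i" by (rule translate_hom)
  show ?thesis unfolding translate_def by (rule ext_add)
qed

lemma translate_sc: "translate i (sc c) = [:sc c:]"
proof -
  interpret lin_ext_hom "\<lambda>c. [:sc c:]" "translate_mon i" "nn_at i" by (rule translate_hom)
  show ?thesis unfolding translate_def by (rule ext_sc)
qed

lemma sc_of_nat: "sc (of_nat n) = of_nat n"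
  by (simp add: sc_def)

lemma translate_zero [simp]: "translate i 0 = 0"
  using translate_sc[of i 0] by simp

lemma translate_mult: "a \<in> polys N \<Longrightarrow> b \<in> polys N \<Longrightarrow> translate i (a * b) = translate i a * translate i b"
proof -
  interpret lin_ext_hom "\<lambda>c. [:sc c:]" "translate_mon i" "nn_at i" by (rule translate_hom)
  show "a \<in> polys N \<Longrightarrow> b \<in> polys N \<Longrightarrow> ?thesis"
    unfolding translate_def by (rule ext_mult) (auto simp: polys_def nn_at_def)
qed

lemma translate_sum: "translate i (sum h I) = (\<Sum>k\<in>I. translate i (h k))"
proof -
  interpret lin_ext_hom "\<lambda>c. [:sc c:]" "translate_mon i" "nn_at i" by (rule translate_hom)
  show ?thesis unfolding translate_def by (rule ext_sum)
qed

lemma translate_expand: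
  "cf (translate i a) j = (\<Sum>\<mu>\<in>supp a. cf (translate i (sc (lk a \<mu>) * lmon \<mu>)) j)"
  by (subst (1) laurent_expand[of a]) (simp add: translate_sum coeff_sum)

lemma translate_polys: "a \<in> polys N \<Longrightarrow> cf (translate i a) j \<in> polys N"
proof -
  assume a: "a \<in> polys N"
  have s: "sum h I \<in> polys N" if "\<And>k. k \<in> I \<Longrightarrow> h k \<in> polys N" for h and I :: "expo set"
    using that by (induction I rule: infinite_finite_induct) (auto intro: polys_add)
  show ?thesis unfolding translate_expand[of i a j]
  proof (rule s)
    fix \<mu> assume "\<mu> \<in> supp a"
    then have \<mu>: "\<forall>l. lk \<mu> l \<ge> 0" "\<forall>l\<ge>N. lk \<mu> l = 0" using a by (auto simp: polys_def)
    show "cf (translate i (sc (lk a \<mu>) * lmon \<mu>)) j \<in> polys N"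
    proof (cases "j \<le> nat (lk \<mu> i)")
      case True
      have "lmon (\<mu> - unit_exp i (int j)) \<in> polys N"
      proof (rule polys_lmon)
        show "\<forall>l. lk (\<mu> - unit_exp i (int j)) l \<ge> 0" using \<mu> True
          by (auto simp: lookup_minus lk_unit_exp nat_le_iff) (metis int_nat_eq of_nat_le_iff)
        show "\<forall>l\<ge>N. lk (\<mu> - unit_exp i (int j)) l = 0" using \<mu> True
          by (auto simp: lookup_minus lk_unit_exp)
      qed
      then have "sc k * lmon (\<mu> - unit_exp i (int j)) \<in> polys N" for k by (rule polys_mult[OF polys_sc])
      then show ?thesis using \<mu> by (simp only: cf_translate_single)
    next
      case False
      then show ?thesis using \<mu> by (simp add: cf_translate_single binomial_eq_0)
    qed
  qed
qed

lemma translate_0: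
  assumes "a \<in> polys N"
  shows "cf (translate i a) 0 = a"
proof -
  have "cf (translate i a) 0 = (\<Sum>\<mu>\<in>supp a. sc (lk a \<mu>) * lmon \<mu>)"
    unfolding translate_expand[of i a 0] using assms by (intro sum.cong refl) (simp add: cf_translate_single polys_def)
  then show ?thesis by (simp flip: laurent_expand)
qed

text \<open>Translating by two parameters in succession is translating by their sum; on monomials
  this is the identity \<open>(n choose j) (n - j choose k) = (k + j choose k) (n choose (k +
  j))\<close>.\<close>

lemma translate_iter:
  fixes a :: "'a::field laurent"
  assumes a: "a \<in> polys N"
  shows "cf (translate i (cf (translate i a) j)) k = of_nat (k + j choose k) * cf (translate i a) (k + j)"
proof -
  have single: "cf (translate i (cf (translate i (sc c * lmon \<mu>)) j)) k = of_nat (k + j choose k) * cf (translate i (sc c * lmon \<mu>)) (k + j)"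
    if \<mu>: "lk \<mu> i \<ge> 0" for c :: 'a and \<mu>
  proof (cases "j \<le> nat (lk \<mu> i)")
    case True
    define n where "n = nat (lk \<mu> i)"
    have \<nu>: "lk (\<mu> - unit_exp i (int j)) i \<ge> 0" "nat (lk (\<mu> - unit_exp i (int j)) i) = n - j"
      using True \<mu> by (auto simp: lookup_minus lk_unit_exp n_def nat_diff_distrib le_nat_iff)
    have e: "\<mu> - unit_exp i (int j) - unit_exp i (int k) = \<mu> - unit_exp i (int (k + j))"
      by (simp add: diff_diff_eq unit_exp_add add.commute)
    have bin: "(n choose j) * (n - j choose k) = (k + j choose k) * (n choose (k + j))"
    proof (cases "k + j \<le> n")
      case True
      have "(n choose (j + k)) * (j + k choose j) = (n choose j) * (n - j choose (j + k - j))"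
        by (rule choose_mult) (use True in auto)
      moreover have "(j + k choose j) = (k + j choose k)"
        by (metis add.commute binomial_symmetric diff_add_inverse le_add1)
      ultimately show ?thesis by (simp add: mult.commute add.commute)
    next
      case False
      then show ?thesis using \<open>j \<le> nat (lk \<mu> i)\<close> by (simp add: binomial_eq_0 n_def)
    qed
    have "cf (translate i (cf (translate i (sc c * lmon \<mu>)) j)) k
       = sc (c * of_nat ((n choose j) * (n - j choose k))) * lmon (\<mu> - unit_exp i (int (k + j)))"
      unfolding cf_translate_single[OF \<mu>] cf_translate_single[OF \<nu>(1)] \<nu>(2) e by (simp add: n_def mult_ac)
    also have "\<dots> = of_nat (k + j choose k) * cf (translate i (sc c * lmon \<mu>)) (k + j)"
      unfolding bin cf_translate_single[OF \<mu>] by (simp add: n_def sc_mult sc_of_nat mult_ac)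
    finally show ?thesis .
  next
    case False
    then show ?thesis using \<mu> by (simp add: cf_translate_single binomial_eq_0)
  qed
  have *: "cf (translate i (cf (translate i (sc (lk a \<mu>) * lmon \<mu>)) j)) k
      = of_nat (k + j choose k) * cf (translate i (sc (lk a \<mu>) * lmon \<mu>)) (k + j)" if "\<mu> \<in> supp a" for \<mu>
    by (rule single) (use a that in \<open>simp add: polys_def\<close>)
  have "cf (translate i (cf (translate i a) j)) k = (\<Sum>\<mu>\<in>supp a. cf (translate i (cf (translate i (sc (lk a \<mu>) * lmon \<mu>)) j)) k)"
    by (simp add: translate_expand[of i a j] translate_sum coeff_sum)
  also have "\<dots> = of_nat (k + j choose k) * cf (translate i a) (k + j)"
    unfolding translate_expand[of i a "k + j"] sum_distrib_left by (intro sum.cong refl *)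
  finally show ?thesis .
qed

lemma translate_var: "translate i (xvar k) = (if k = i then [:xvar k, 1:] else [:xvar k:])"
proof -
  interpret lin_ext_hom "\<lambda>c. [:sc c:]" "translate_mon i" "nn_at i" by (rule translate_hom)
  show ?thesis unfolding translate_def xvar_def ext_lmon
    by (simp add: translate_mon_def lk_unit_exp xvar_def)
qed

section \<open>\<open>A\<close> is not a polynomial ring\<close>

context asanuma
begin

text \<open>As \<open>yy\<close> has negative exponents, so has the image \<open>g (xvar k)\<close>
  of some variable. Translation of another variable, transported to \<open>A\<close>, is a
  nontrivial exponential map fixing \<open>g (xvar k)\<close>, against
  \<open>fixed_exponents_nonneg\<close>.\<close>

theorem ringA_not_iso:
  assumes bij: "bij_betw h ringA (polys (m + 2))"
    and add: "\<And>a b. a \<in> ringA \<Longrightarrow> b \<in> ringA \<Longrightarrow> h (a + b) = h a + h b"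
    and mult: "\<And>a b. a \<in> ringA \<Longrightarrow> b \<in> ringA \<Longrightarrow> h (a * b) = h a * h b"
    and sc: "\<And>k. h (sc k) = sc k"
  shows False
proof -
  define N where "N = m + 2"
  define g where "g = inv_into ringA h"
  have hp: "h a \<in> polys N" if "a \<in> ringA" for a using bij that by (auto simp: bij_betw_def N_def)
  have gh: "g (h a) = a" if "a \<in> ringA" for a
    using bij that by (simp add: g_def bij_betw_def)
  have ga: "g a \<in> ringA" and hg: "h (g a) = a" if "a \<in> polys N" for a
    using bij that unfolding g_def N_def bij_betw_def by (auto intro: inv_into_into f_inv_into_f)
  have gadd: "g (a + b) = g a + g b" if "a \<in> polys N" "b \<in> polys N" for a b
    using gh[of "g a + g b"] add[OF ga ga] ga hg that ringA_add by simp
  have gmult: "g (a * b) = g a * g b" if "a \<in> polys N" "b \<in> polys N" for a b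
    using gh[of "g a * g b"] mult[OF ga ga] ga hg that ringA_mult by simp
  have gsc: "g (sc k) = sc k" for k using gh[of "sc k"] sc by simp
  have g0: "g 0 = 0" using gsc[of 0] by simp
  have gsum: "g (sum f I) = (\<Sum>i\<in>I. g (f i)) \<and> sum f I \<in> polys N" if "\<And>i. i \<in> I \<Longrightarrow> f i \<in> polys N" for f and I :: "nat set"
    using that by (induction I rule: infinite_finite_induct) (auto simp: g0 gadd polys_add)
  have "\<exists>k<N. \<exists>\<mu>\<in>supp (g (xvar k)). \<exists>l. lk \<mu> l < 0"
  proof (rule ccontr)
    assume no: "\<not> ?thesis"
    define Q where "Q u \<longleftrightarrow> (\<forall>\<mu>\<in>supp u. \<forall>l. lk \<mu> l \<ge> 0)" for u :: "'f laurent"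
    have Qm: "Q (a * b)" if "Q a" "Q b" for a b
      using that unfolding Q_def by (fastforce dest!: supp_add_prod simp: lookup_add)
    have Qa: "Q (a + b)" if "Q a" "Q b" for a b
      using that keys_add[of a b] unfolding Q_def by blast
    have "Q (g a)" if "a \<in> polys N" for a
      using that
    proof (induction rule: polys_induct)
      case (xvar a l)
      moreover have "\<forall>\<mu>\<in>supp (g (xvar l)). \<forall>l'. \<not> lk \<mu> l' < 0" using no \<open>l < N\<close> by blast
      then have "Q (g (xvar l))" by (simp add: Q_def not_less)
      ultimately show ?case by (simp add: gmult polys_var Qm)
    qed (simp_all add: gsc gadd Qa, simp add: Q_def supp_sc)
    then have "Q yy" using hp[OF ringA_yy] gh[OF ringA_yy] by metis
    moreover have "\<not> Q yy"
    proof -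
      have "yy \<noteq> 0"
      proof
        assume "yy = 0"
        then have "ff = 0" using lmon_Xexp_yy by simp
        then have e: "tt = gg ^ p" by (simp add: ff_def)
        have "spec (m + 1) tt = 0" by (simp add: tt_def xvar_def spec_lmon lk_unit_exp)
        moreover have "spec (m + 1) (gg ^ p) = (spec (m + 1) gg) ^ p"
          by (rule spec_power[OF pol_nonneg[OF form_pol[OF form_gg]]])
        moreover have "spec (m + 1) gg = zz ^ q"
          using s_ge by (simp add: gg_def spec_minus zz_def tt_def xvar_power spec_lmon lk_unit_exp)
        ultimately have "(zz ^ q) ^ p = 0" using e by simp
        then show False by simp
      qed
      then have "ff \<noteq> 0" using lmon_Xexp_yy by (metis mult_eq_0_iff lmon_nonzero)
      then obtain \<mu> where \<mu>: "\<mu> \<in> supp ff" by fastforce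
      then have "- Xexp + \<mu> \<in> supp yy" by (simp add: yy_def Xinv_def supp_lmon_mult)
      moreover have "lk (- Xexp + \<mu>) 0 < 0"
      proof -
        have "lk \<mu> 0 = 0" using \<mu> ff_pol m_pos by (simp add: pol_def)
        then show ?thesis using m_pos s_ge by (simp add: lookup_minus lk_Xexp)
      qed
      ultimately show ?thesis unfolding Q_def by (metis not_less)
    qed
    ultimately show False by simp
  qed
  then obtain k \<mu> l where k: "k < N" "\<mu> \<in> supp (g (xvar k))" "lk \<mu> l < 0" by blast
  \<comment> \<open>Any index other than \<open>k\<close> would do; \<open>N = m + 2\<close> leaves
    room for one.\<close>
  define i :: nat where "i = (if k = 0 then 1 else 0)"
  have i: "i < N" "i \<noteq> k" by (auto simp: i_def N_def)
  define \<phi> where "\<phi> a = map_poly g (translate i (h a))" for a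
  have cf: "cf (\<phi> a) j = g (cf (translate i (h a)) j)" for a j
    by (simp add: \<phi>_def coeff_map_poly g0)
  have tp: "cf (translate i (h a)) j \<in> polys N" if "a \<in> ringA" for a j
    by (rule translate_polys[OF hp[OF that]])
  have fx: "\<phi> u = [:u:]" if "u \<in> ringA" "translate i (h u) = [:h u:]" for u
    by (rule poly_eqI) (simp add: cf that coeff_pCons gh g0 split: nat.splits)
  interpret ring_exp m p fld \<phi>
  proof
    fix a j assume a: "a \<in> ringA"
    show "cf (\<phi> a) j \<in> ringA" unfolding cf by (rule ga[OF tp[OF a]])
    show "cf (\<phi> a) 0 = a" unfolding cf by (simp add: translate_0[OF hp[OF a]] gh[OF a])
    have ofn: "of_nat x = sc (of_nat x)" for x by (simp add: sc_def)
    show "cf (\<phi> (cf (\<phi> a) j)) i = of_nat (i + j choose i) * cf (\<phi> a) (i + j)" for i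
      unfolding cf hg[OF tp[OF a]] translate_iter[OF hp[OF a]] unfolding ofn
      by (simp add: gmult tp[OF a] gsc)
  next
    fix a b assume a: "a \<in> ringA" and b: "b \<in> ringA"
    show "\<phi> (a + b) = \<phi> a + \<phi> b"
      by (rule poly_eqI) (simp add: cf add a b translate_add gadd tp)
    show "\<phi> (a * b) = \<phi> a * \<phi> b"
    proof (rule poly_eqI)
      fix n
      have "cf (\<phi> (a * b)) n = g (\<Sum>j\<le>n. cf (translate i (h a)) j * cf (translate i (h b)) (n - j))"
        by (simp add: cf mult[OF a b] translate_mult[OF hp[OF a] hp[OF b]] coeff_mult)
      also have "\<dots> = (\<Sum>j\<le>n. g (cf (translate i (h a)) j * cf (translate i (h b)) (n - j)))"
        by (rule conjunct1[OF gsum]) (intro polys_mult tp a b)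
      also have "\<dots> = cf (\<phi> a * \<phi> b) n"
        by (simp add: coeff_mult cf gmult tp a b)
      finally show "cf (\<phi> (a * b)) n = cf (\<phi> a * \<phi> b) n" .
    qed
  next
    show "\<phi> (sc k) = [:sc k:]" for k by (rule fx) (simp_all add: sc translate_sc)
  next
    have "cf (\<phi> (g (xvar i))) 1 = 1"
      using gsc[of 1] by (simp add: cf hg polys_var i translate_var)
    then have "\<phi> (g (xvar i)) \<noteq> [:g (xvar i):]" by auto
    then show "\<exists>a\<in>ringA. \<phi> a \<noteq> [:a:]" using ga[OF polys_var[OF i(1)]] by blast
  qed
  have "lk \<mu> l \<ge> 0"
  proof (rule fixed_exponents_nonneg[OF _ _ k(2)])
    show "g (xvar k) \<in> ringA" by (rule ga[OF polys_var[OF k(1)]])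
    then show "\<phi> (g (xvar k)) = [:g (xvar k):]"
      by (rule fx) (use i in \<open>simp add: hg polys_var k translate_var\<close>)
  qed
  then show False using k(3) by simp
qed

end

section \<open>Stable triviality\<close>

locale subring_set =
  fixes S :: "'a::comm_ring_1 set"
  assumes one_closed: "1 \<in> S" and add_closed: "a \<in> S \<Longrightarrow> b \<in> S \<Longrightarrow> a + b \<in> S"
    and mult_closed: "a \<in> S \<Longrightarrow> b \<in> S \<Longrightarrow> a * b \<in> S" and minus_closed: "a \<in> S \<Longrightarrow> b \<in> S \<Longrightarrow> a - b \<in> S"
begin

lemma zero_closed: "0 \<in> S"
  using minus_closed[OF one_closed one_closed] by simp

lemma power_closed: "a \<in> S \<Longrightarrow> a ^ n \<in> S"
  by (induction n) (auto intro: one_closed mult_closed)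

lemma sum_closed: "(\<And>i. i \<in> I \<Longrightarrow> h i \<in> S) \<Longrightarrow> sum h I \<in> S"
  by (induction I rule: infinite_finite_induct) (auto intro: zero_closed add_closed)

text \<open>The quotient must lie in \<open>S\<close>: in the Laurent ring \<open>XX\<close> is a
  unit, so divisibility there would say nothing.\<close>

definition congr :: "'a \<Rightarrow> 'a \<Rightarrow> 'a \<Rightarrow> bool" where
  "congr d a b \<longleftrightarrow> (\<exists>w\<in>S. a - b = d * w)"

lemma congr_refl [simp]: "congr d a a"
  unfolding congr_def using zero_closed by (intro bexI[of _ 0]) auto

lemma congr_sym: "congr d a b \<Longrightarrow> congr d b a"
  unfolding congr_def using minus_closed[OF zero_closed] by (metis diff_0 minus_diff_eq mult_minus_right)

lemma congr_trans: "congr d a b \<Longrightarrow> congr d b c \<Longrightarrow> congr d a c"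
  unfolding congr_def by (metis add_closed diff_add_cancel add_diff_eq distrib_left)

lemma congr_add: "congr d a b \<Longrightarrow> congr d a' b' \<Longrightarrow> congr d (a + a') (b + b')"
  unfolding congr_def by (metis add_closed add_diff_add distrib_left)

lemma congr_minus: "congr d a b \<Longrightarrow> congr d a' b' \<Longrightarrow> congr d (a - a') (b - b')"
proof -
  assume "congr d a b" "congr d a' b'"
  then obtain w w' where "w \<in> S" "w' \<in> S" "a - b = d * w" "a' - b' = d * w'" unfolding congr_def by blast
  then have "w - w' \<in> S" "a - a' - (b - b') = d * (w - w')" by (auto simp: minus_closed algebra_simps)
  then show ?thesis unfolding congr_def by blast
qed

lemma congr_power:
  assumes "congr d a b" "a \<in> S" "b \<in> S"
  shows "congr d (a ^ n) (b ^ n)"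
proof -
  obtain w where w: "w \<in> S" "a - b = d * w" using assms(1) unfolding congr_def by blast
  have "a ^ n - b ^ n = d * (w * (\<Sum>i<n. b ^ (n - Suc i) * a ^ i))"
    unfolding power_diff_sumr2[of a n b] w(2) by (simp add: mult.assoc)
  moreover have "w * (\<Sum>i<n. b ^ (n - Suc i) * a ^ i) \<in> S"
    by (intro mult_closed w sum_closed power_closed assms)
  ultimately show ?thesis unfolding congr_def by blast
qed

end

lemma polys_subring: "subring_set (polys N)"
  by unfold_locales (auto intro: polys_add polys_mult polys_minus)

section \<open>The line \<open>f = 0\<close> and its parameter\<close>

context asanuma
begin

text \<open>From the point \<open>(zu u, tu u)\<close> the polynomials \<open>Gf\<close>,
  \<open>Qf\<close>, \<open>Pf\<close> recover \<open>u^(p^2)\<close>, \<open>u^p\<close> and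
  \<open>u\<close>, one Frobenius root at a time; \<open>Ff\<close> is the equation of the
  line.\<close>

definition Gf :: "'f laurent \<Rightarrow> 'f laurent \<Rightarrow> 'f laurent" where "Gf a b = a ^ q - b ^ s"
definition Qf :: "'f laurent \<Rightarrow> 'f laurent \<Rightarrow> 'f laurent" where "Qf a b = a ^ p - Gf a b ^ s"
definition Pf :: "'f laurent \<Rightarrow> 'f laurent \<Rightarrow> 'f laurent" where "Pf a b = a - Qf a b ^ s"
definition Ff :: "'f laurent \<Rightarrow> 'f laurent \<Rightarrow> 'f laurent" where "Ff a b = Gf a b ^ p - b"
definition zu :: "'f laurent \<Rightarrow> 'f laurent" where "zu u = u + u ^ (s * p)"
definition tu :: "'f laurent \<Rightarrow> 'f laurent" where "tu u = u ^ (q * p)"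

lemma frob: "((a :: 'f laurent) + b) ^ p = a ^ p + b ^ p"
  by (rule freshmans_dream) (use p CHAR in simp_all)

lemma frob_diff: "((a :: 'f laurent) - b) ^ p = a ^ p - b ^ p"
  using frob[of "a - b" b] by (simp add: algebra_simps)

lemma Gf_line: "Gf (zu u) (tu u) = u ^ q"
proof -
  have "zu u ^ q = (zu u ^ p) ^ p" by (simp add: q_def power2_eq_square power_mult)
  also have "\<dots> = u ^ q + u ^ (s * p * p * p)"
    by (simp add: zu_def frob q_def power2_eq_square flip: power_mult)
  also have "u ^ (s * p * p * p) = tu u ^ s" by (simp add: tu_def q_def power2_eq_square mult_ac flip: power_mult)
  finally show ?thesis by (simp add: Gf_def)
qed

lemma Qf_line: "Qf (zu u) (tu u) = u ^ p"
  unfolding Qf_def Gf_line by (simp add: zu_def frob q_def power2_eq_square mult_ac flip: power_mult)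

lemma Pf_line: "Pf (zu u) (tu u) = u"
  unfolding Pf_def Qf_line by (simp add: zu_def mult_ac flip: power_mult)

lemma Ff_line: "Ff (zu u) (tu u) = 0"
  unfolding Ff_def Gf_line by (simp add: tu_def flip: power_mult)

lemma gg_Gf: "gg = Gf zz tt" and ff_Ff: "ff = Ff zz tt"
  by (simp_all add: gg_def ff_def Gf_def Ff_def)

lemma pol_subring: "subring_set pol"
  by unfold_locales (auto intro: pol_add pol_mult pol_minus)

text \<open>\<open>P0\<close> restricts to the parameter \<open>u\<close> on the line \<open>f = 0\<close>, parametrized by \<open>(zu u, tu u)\<close>.\<close>

definition P0 :: "'f laurent" where "P0 = Pf zz tt"

text \<open>Modulo \<open>f\<close> one has \<open>g ^ p = t\<close>, and the recursion runs back
  through Frobenius: \<open>Q0 ^ p\<close> becomes \<open>g\<close>, then \<open>P0 ^ p\<close>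
  becomes \<open>Q0\<close>. Hence \<open>zu P0\<close> is \<open>P0 + Q0 ^ s = z\<close>, and
  \<open>tu P0 = P0 ^ (p^3)\<close> is \<open>g ^ p\<close>, that is \<open>t\<close>.\<close>

lemma line_congr: "subring_set.congr pol ff zz (zu P0)" "subring_set.congr pol ff tt (tu P0)"
  and P0_pol: "P0 \<in> pol"
proof -
  interpret subring_set pol by (rule pol_subring)
  define Q0 where "Q0 = Qf zz tt"
  have gg: "gg \<in> pol" by (rule form_pol[OF form_gg])
  have Q0: "Q0 \<in> pol" unfolding Q0_def Qf_def gg_Gf[symmetric] by (intro minus_closed power_closed zz_pol gg)
  show P0: "P0 \<in> pol" unfolding P0_def Pf_def Q0_def[symmetric] by (intro minus_closed power_closed zz_pol Q0)
  have 1: "congr ff (gg ^ p) tt"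
    unfolding congr_def using one_closed by (intro bexI[of _ 1]) (simp_all add: ff_def)
  have "Q0 ^ p = zz ^ q - (gg ^ p) ^ s"
    by (simp add: Q0_def Qf_def gg_Gf[symmetric] frob_diff q_def power2_eq_square mult.commute flip: power_mult)
  moreover have "congr ff (zz ^ q - (gg ^ p) ^ s) (zz ^ q - tt ^ s)"
    by (intro congr_minus congr_refl congr_power 1 power_closed gg tt_pol)
  ultimately have 2: "congr ff (Q0 ^ p) gg" by (simp add: gg_def)
  have "P0 ^ p = zz ^ p - (Q0 ^ p) ^ s"
    by (simp add: P0_def Pf_def Q0_def[symmetric] frob_diff mult.commute flip: power_mult)
  moreover have "congr ff (zz ^ p - (Q0 ^ p) ^ s) (zz ^ p - gg ^ s)"
    by (intro congr_minus congr_refl congr_power 2 power_closed gg Q0)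
  ultimately have 3: "congr ff (P0 ^ p) Q0" by (simp add: Q0_def Qf_def gg_Gf)
  have "zu P0 = P0 + (P0 ^ p) ^ s" by (simp add: zu_def mult.commute flip: power_mult)
  moreover have "congr ff (P0 + (P0 ^ p) ^ s) (P0 + Q0 ^ s)"
    by (intro congr_add congr_refl congr_power 3 power_closed P0 Q0)
  ultimately have "congr ff (zu P0) zz" by (simp add: P0_def Pf_def Q0_def)
  then show "congr ff zz (zu P0)" by (rule congr_sym)
  have "congr ff ((P0 ^ p) ^ p) (Q0 ^ p)" by (intro congr_power 3 power_closed P0 Q0)
  then have "congr ff ((P0 ^ p) ^ p) gg" using 2 by (rule congr_trans)
  then have "congr ff (((P0 ^ p) ^ p) ^ p) (gg ^ p)" by (intro congr_power power_closed P0 gg)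
  then have "congr ff (((P0 ^ p) ^ p) ^ p) tt" using 1 by (rule congr_trans)
  then have "congr ff (tu P0) tt" by (simp add: tu_def q_def power2_eq_square flip: power_mult)
  then show "congr ff tt (tu P0)" by (rule congr_sym)
qed

definition vv :: "'f laurent" where "vv = xvar (m + 2)"
definition XX :: "'f laurent" where "XX = lmon Xexp"

lemma XX_Xinv: "XX * Xinv = 1"
  by (simp add: XX_def Xinv_def lmon_mult)

lemma XX_yy: "XX * yy = ff" unfolding XX_def by (rule lmon_Xexp_yy)

section \<open>The polynomial ring \<open>A[v]\<close> and its new coordinates\<close>

definition coeffsA :: "'f laurent poly set" where "coeffsA = {P. \<forall>i. cf P i \<in> ringA}"
definition ringAV :: "'f laurent set" where "ringAV = (\<lambda>P. poly P vv) ` coeffsA"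

lemma coeffsA_add: "P \<in> coeffsA \<Longrightarrow> Q \<in> coeffsA \<Longrightarrow> P + Q \<in> coeffsA"
  and coeffsA_minus: "P \<in> coeffsA \<Longrightarrow> Q \<in> coeffsA \<Longrightarrow> P - Q \<in> coeffsA"
  and coeffsA_mult: "P \<in> coeffsA \<Longrightarrow> Q \<in> coeffsA \<Longrightarrow> P * Q \<in> coeffsA"
  by (auto simp: coeffsA_def ringA_add ringA_minus coeff_mult intro!: ringA_sum ringA_mult)

lemma coeffsA_const: "a \<in> ringA \<Longrightarrow> [:a:] \<in> coeffsA"
  by (auto simp: coeffsA_def coeff_pCons split: nat.splits)

lemma ringAV_ringA: "a \<in> ringA \<Longrightarrow> a \<in> ringAV"
  unfolding ringAV_def by (rule image_eqI[OF _ coeffsA_const]) auto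

lemma ringAV_vv: "vv \<in> ringAV"
proof -
  have "[:0, 1:] \<in> coeffsA" by (auto simp: coeffsA_def coeff_pCons split: nat.splits)
  then show ?thesis unfolding ringAV_def by (intro image_eqI[of _ _ "[:0, 1:]"]) auto
qed

lemma ringAV_subring: "subring_set ringAV"
proof
  show "1 \<in> ringAV" using ringAV_ringA by simp
  fix a b assume "a \<in> ringAV" "b \<in> ringAV"
  then obtain P Q where *: "P \<in> coeffsA" "Q \<in> coeffsA" "a = poly P vv" "b = poly Q vv"
    unfolding ringAV_def by auto
  show "a + b \<in> ringAV"
    unfolding ringAV_def using * by (intro image_eqI[of _ _ "P + Q"] coeffsA_add) simp_all
  show "a * b \<in> ringAV"
    unfolding ringAV_def using * by (intro image_eqI[of _ _ "P * Q"] coeffsA_mult) simp_all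
  show "a - b \<in> ringAV"
    unfolding ringAV_def using * by (intro image_eqI[of _ _ "P - Q"] coeffsA_minus) simp_all
qed

text \<open>Asanuma's trick: \<open>A[v]\<close> is the modification of \<open>k[X, z, t, X v]\<close> along the ideal \<open>(f, X v)\<close>, and
  with \<open>u = X v + P0\<close> that ideal becomes \<open>(z - zu u, t - tu u)\<close> modulo \<open>X\<close>.\<close>

definition UU :: "'f laurent" where "UU = XX * vv + P0"

text \<open>The new coordinates of \<open>A[v]\<close>: the \<open>X\<close> variables, the
  parameter \<open>u\<close>, and the generators of the ideal divided by \<open>X\<close>. That the
  quotients lie in \<open>A[v]\<close> is \<open>img_ringAV\<close>.\<close>

definition img :: "nat \<Rightarrow> 'f laurent" where
  "img l = (if l < m then xvar l else if l = m then UU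
     else if l = m + 1 then (zz - zu UU) * Xinv else (tt - tu UU) * Xinv)"

definition psi_mon :: "expo \<Rightarrow> 'f laurent" where
  "psi_mon \<mu> = (\<Prod>l<m + 3. img l ^ nat (lk \<mu> l))"

definition psi :: "'f laurent \<Rightarrow> 'f laurent" where "psi = lin_ext sc psi_mon"

definition nn_all :: "expo set" where "nn_all = {\<mu>. \<forall>l. lk \<mu> l \<ge> 0}"

sublocale psi: lin_ext_hom sc psi_mon nn_all
proof
  show "psi_mon (\<mu> + \<nu>) = psi_mon \<mu> * psi_mon \<nu>" if "\<mu> \<in> nn_all" "\<nu> \<in> nn_all" for \<mu> \<nu>
    using that by (simp add: psi_mon_def nn_all_def lookup_add nat_add_distrib power_add prod.distrib)
qed (simp_all add: sc_add sc_mult psi_mon_def nn_all_def lookup_add)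

lemma polys_dom: "a \<in> polys N \<Longrightarrow> a \<in> psi.dom"
  unfolding polys_def psi.dom_def by (auto simp: nn_all_def)

lemma psi_add: "psi (a + b) = psi a + psi b" and psi_minus: "psi (a - b) = psi a - psi b"
  and psi_sc: "psi (sc c) = sc c"
  by (simp_all add: psi_def psi.ext_add psi.ext_minus psi.ext_sc)

lemma psi_mult: "a \<in> polys N \<Longrightarrow> b \<in> polys N \<Longrightarrow> psi (a * b) = psi a * psi b"
  unfolding psi_def by (intro psi.ext_mult' polys_dom)

lemma psi_power: "a \<in> polys N \<Longrightarrow> psi (a ^ n) = psi a ^ n"
  unfolding psi_def by (intro psi.ext_power polys_dom)

lemma psi_var: "l < m + 3 \<Longrightarrow> psi (xvar l) = img l"
proof -
  assume l: "l < m + 3"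
  have "psi (xvar l) = (\<Prod>k<m + 3. img k ^ nat (lk (unit_exp l 1) k))"
    unfolding psi_def xvar_def psi.ext_lmon psi_mon_def ..
  also have "\<dots> = (\<Prod>k<m + 3. if k = l then img k else 1)"
    by (intro prod.cong refl) (simp add: lk_unit_exp)
  also have "\<dots> = img l" using l by simp
  finally show ?thesis .
qed

lemma zu_congr: "subring_set S \<Longrightarrow> subring_set.congr S d a b \<Longrightarrow> a \<in> S \<Longrightarrow> b \<in> S \<Longrightarrow> subring_set.congr S d (zu a) (zu b)"
  and tu_congr: "subring_set S \<Longrightarrow> subring_set.congr S d a b \<Longrightarrow> a \<in> S \<Longrightarrow> b \<in> S \<Longrightarrow> subring_set.congr S d (tu a) (tu b)"
  unfolding zu_def tu_def by (intro subring_set.congr_add subring_set.congr_power; assumption)+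

text \<open>Modulo \<open>XX\<close> the element \<open>UU\<close> may be replaced by
  \<open>P0\<close>, and \<open>zz - zu P0\<close> is a multiple of \<open>ff = XX * yy\<close>;
  after division by \<open>XX\<close> only \<open>yy\<close> remains, without a denominator. The
  same works for \<open>tt\<close>.\<close>

lemma img_ringAV: "img l \<in> ringAV"
proof -
  interpret subring_set ringAV by (rule ringAV_subring)
  have X: "XX \<in> ringAV" unfolding XX_def using ringA_lmon[of Xexp] by (intro ringAV_ringA) (simp add: xexps_def lk_Xexp)
  have P: "P0 \<in> ringAV" by (intro ringAV_ringA ringA_pol P0_pol)
  have U: "UU \<in> ringAV" unfolding UU_def by (intro add_closed mult_closed X ringAV_vv P)
  have UP: "congr XX P0 UU"
  proof -
    have "congr XX UU P0" unfolding congr_def UU_def using ringAV_vv by (intro bexI[of _ vv]) auto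
    then show ?thesis by (rule congr_sym)
  qed
  have key: "(a - h UU) * Xinv \<in> ringAV"
    if a: "subring_set.congr pol ff a (h P0)" and h: "congr XX (h P0) (h UU)" for a h
  proof -
    obtain w where w: "w \<in> pol" "a - h P0 = ff * w" using a unfolding subring_set.congr_def[OF pol_subring] by blast
    obtain w' where w': "w' \<in> ringAV" "h P0 - h UU = XX * w'" using h unfolding congr_def by blast
    have "a - h UU = XX * (yy * w + w')"
      using w(2) w'(2) by (simp add: algebra_simps flip: XX_yy)
    then have "(a - h UU) * Xinv = yy * w + w'" using XX_Xinv by (simp add: mult_ac)
    also have "\<dots> \<in> ringAV" by (intro add_closed mult_closed w' ringAV_ringA ringA_yy ringA_pol w)
    finally show ?thesis .
  qed
  have "(zz - zu UU) * Xinv \<in> ringAV" "(tt - tu UU) * Xinv \<in> ringAV"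
    using key[OF line_congr(1) zu_congr[OF ringAV_subring UP P U]] key[OF line_congr(2) tu_congr[OF ringAV_subring UP P U]] .
  then show ?thesis unfolding img_def using U ringAV_ringA ringA_var by auto
qed

lemma psi_ringAV: "a \<in> polys (m + 3) \<Longrightarrow> psi a \<in> ringAV"
proof -
  interpret subring_set ringAV by (rule ringAV_subring)
  assume "a \<in> polys (m + 3)"
  then show ?thesis
  proof (induction rule: polys_induct)
    case (xvar a l)
    then show ?case by (simp add: psi_mult[OF polys_var] psi_var mult_closed img_ringAV)
  qed (simp_all add: psi_sc psi_add add_closed ringAV_ringA)
qed

text \<open>Like \<open>t1\<close>, found by solving the formulas of \<open>img\<close> for
  \<open>zz\<close> and \<open>tt\<close>: these are the preimages of \<open>zz\<close> and
  \<open>tt\<close> under \<open>psi\<close>.\<close>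

definition z1 :: "'f laurent" where "z1 = XX * xvar (m + 1) + zu (xvar m)"
definition t1 :: "'f laurent" where "t1 = XX * xvar (m + 2) + tu (xvar m)"

lemma XX_polys: "XX \<in> polys (m + 3)"
  unfolding XX_def by (intro polys_lmon) (auto simp: lk_Xexp)

lemma zu_polys: "a \<in> polys N \<Longrightarrow> zu a \<in> polys N" and tu_polys: "a \<in> polys N \<Longrightarrow> tu a \<in> polys N"
  by (simp_all add: zu_def tu_def polys_add polys_power)

lemma z1_polys: "z1 \<in> polys (m + 3)" and t1_polys: "t1 \<in> polys (m + 3)"
  unfolding z1_def t1_def by (intro polys_add polys_mult XX_polys zu_polys tu_polys polys_var; simp)+

lemma psi_XX: "psi XX = XX"
proof -
  have "XX = (\<Prod>l<m. xvar l ^ nat (lk Xexp l))"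
    unfolding XX_def by (rule lmon_prod) (simp add: xexps_def lk_Xexp)
  moreover have "psi (\<Prod>l<n. xvar l ^ nat (lk Xexp l)) = (\<Prod>l<n. xvar l ^ nat (lk Xexp l)) \<and>
      (\<Prod>l<n. xvar l ^ nat (lk Xexp l) :: 'f laurent) \<in> polys (m + 3)" if "n \<le> m" for n
    using that
  proof (induction n)
    case 0
    show ?case using psi_sc[of 1] by simp
  next
    case (Suc n)
    have v: "(xvar n :: 'f laurent) \<in> polys (m + 3)" using Suc.prems by (intro polys_var) simp
    have "psi (xvar n) = xvar n" using Suc.prems by (simp add: psi_var img_def)
    have P: "(\<Prod>l<n. xvar l ^ nat (lk Xexp l) :: 'f laurent) \<in> polys (m + 3)"
      "psi (\<Prod>l<n. xvar l ^ nat (lk Xexp l)) = (\<Prod>l<n. xvar l ^ nat (lk Xexp l))" using Suc by auto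
    show ?case
      using psi_mult[OF P(1) polys_power[OF v]] polys_mult[OF P(1) polys_power[OF v]]
      by (simp add: P(2) psi_power[OF v] \<open>psi (xvar n) = xvar n\<close>)
  qed
  ultimately show ?thesis by simp
qed

lemma psi_zu: "a \<in> polys N \<Longrightarrow> psi (zu a) = zu (psi a)" and psi_tu: "a \<in> polys N \<Longrightarrow> psi (tu a) = tu (psi a)"
  by (simp_all add: zu_def tu_def psi_add psi_power)

lemma psi_z1: "psi z1 = zz" and psi_t1: "psi t1 = tt"
proof -
  have v: "xvar k \<in> polys (m + 3)" if "k < m + 3" for k using that by (rule polys_var)
  have X: "XX * (a * Xinv) = a" for a using XX_Xinv by (simp add: mult.left_commute)
  show "psi z1 = zz"
    using psi_mult[OF XX_polys v[of "m + 1"]] psi_zu[OF v[of m]]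
    by (simp add: z1_def psi_add psi_XX psi_var img_def X)
  show "psi t1 = tt"
    using psi_mult[OF XX_polys v[of "m + 2"]] psi_tu[OF v[of m]]
    by (simp add: t1_def psi_add psi_XX psi_var img_def X)
qed

lemma Gf_polys: "a \<in> polys N \<Longrightarrow> b \<in> polys N \<Longrightarrow> Gf a b \<in> polys N"
  by (simp add: Gf_def polys_minus polys_power)
lemma Qf_polys: "a \<in> polys N \<Longrightarrow> b \<in> polys N \<Longrightarrow> Qf a b \<in> polys N"
  by (simp add: Qf_def polys_minus polys_power Gf_polys)

lemma psi_Gf: "a \<in> polys N \<Longrightarrow> b \<in> polys N \<Longrightarrow> psi (Gf a b) = Gf (psi a) (psi b)"
  by (simp add: Gf_def psi_minus psi_power)
lemma psi_Qf: "a \<in> polys N \<Longrightarrow> b \<in> polys N \<Longrightarrow> psi (Qf a b) = Qf (psi a) (psi b)"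
  by (simp add: Qf_def psi_minus psi_power[OF Gf_polys] psi_Gf psi_power)
lemma psi_Pf: "a \<in> polys N \<Longrightarrow> b \<in> polys N \<Longrightarrow> psi (Pf a b) = Pf (psi a) (psi b)"
  by (simp add: Pf_def psi_minus psi_power[OF Qf_polys] psi_Qf)
lemma psi_Ff: "a \<in> polys N \<Longrightarrow> b \<in> polys N \<Longrightarrow> psi (Ff a b) = Ff (psi a) (psi b)"
  by (simp add: Ff_def psi_minus psi_power[OF Gf_polys] psi_Gf)

lemma (in subring_set) congr_shift: "w \<in> S \<Longrightarrow> congr d (d * w + b) b"
  unfolding congr_def by (intro bexI[of _ w]) auto

text \<open>Modulo \<open>XX\<close> the pair \<open>(z1, t1)\<close> is the point of the line with
  parameter \<open>xvar m\<close>; there \<open>Pf\<close> returns the parameter and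
  \<open>Ff\<close> vanishes.\<close>

lemma z1_t1_congr:
  shows "subring_set.congr (polys (m + 3)) XX (Pf z1 t1) (xvar m)" and "subring_set.congr (polys (m + 3)) XX (Ff z1 t1) 0"
proof -
  define R :: "'f laurent set" where "R = polys (m + 3)"
  interpret subring_set R unfolding R_def by (rule polys_subring)
  define u :: "'f laurent" where "u = xvar m"
  have v: "xvar k \<in> R" if "k < m + 3" for k unfolding R_def using that by (rule polys_var)
  have u: "u \<in> R" "zu u \<in> R" "tu u \<in> R" using v[of m] by (auto simp: u_def R_def zu_polys tu_polys)
  have z: "z1 \<in> R" "t1 \<in> R" unfolding R_def by (rule z1_polys t1_polys)+
  have cz: "congr XX z1 (zu u)" "congr XX t1 (tu u)"
    unfolding z1_def t1_def u_def using v[of "m + 1"] v[of "m + 2"] by (simp_all add: congr_shift)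
  have mem: "Gf z1 t1 \<in> R" "Gf (zu u) (tu u) \<in> R" "Qf z1 t1 \<in> R" "Qf (zu u) (tu u) \<in> R"
    using u z unfolding R_def by (simp_all add: Gf_polys Qf_polys)
  have G: "congr XX (Gf z1 t1) (Gf (zu u) (tu u))"
    unfolding Gf_def by (intro congr_minus congr_power cz z u)
  have Q: "congr XX (Qf z1 t1) (Qf (zu u) (tu u))"
    unfolding Qf_def by (intro congr_minus congr_power cz z u G mem)
  have "congr XX (Pf z1 t1) (Pf (zu u) (tu u))"
    unfolding Pf_def by (intro congr_minus congr_power cz z u Q mem)
  then show "subring_set.congr (polys (m + 3)) XX (Pf z1 t1) (xvar m)" by (simp add: Pf_line u_def R_def)
  have "congr XX (Ff z1 t1) (Ff (zu u) (tu u))"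
    unfolding Ff_def by (intro congr_minus congr_power cz z u G mem)
  then show "subring_set.congr (polys (m + 3)) XX (Ff z1 t1) 0" by (simp add: Ff_line R_def)
qed

lemma XX_cancel: "XX * a = XX * b \<Longrightarrow> a = b"
  by (simp add: XX_def)

text \<open>The congruences for \<open>(z1, t1)\<close> provide quotients by \<open>XX\<close> among
  polynomials. Since \<open>XX * vv = UU - P0\<close> and \<open>XX * yy = ff\<close>,
  \<open>psi\<close> maps these quotients to \<open>vv\<close> and \<open>yy\<close> once
  \<open>XX\<close> is cancelled.\<close>

lemma vv_in_image: "vv \<in> psi ` polys (m + 3)" and yy_in_image: "yy \<in> psi ` polys (m + 3)"
proof -
  interpret subring_set "polys (m + 3)" by (rule polys_subring)
  have v: "xvar k \<in> polys (m + 3)" if "k < m + 3" for k using that by (rule polys_var)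
  obtain w where w: "w \<in> polys (m + 3)" "xvar m - Pf z1 t1 = XX * w"
    using congr_sym[OF z1_t1_congr(1)] unfolding congr_def by blast
  have "psi (xvar m) - psi (Pf z1 t1) = XX * psi w"
    using arg_cong[OF w(2), of psi] by (simp add: psi_minus psi_mult[OF XX_polys w(1)] psi_XX)
  then have "XX * vv = XX * psi w"
    by (simp add: psi_Pf[OF z1_polys t1_polys] psi_z1 psi_t1 psi_var img_def UU_def P0_def)
  then have "vv = psi w" by (rule XX_cancel)
  then show "vv \<in> psi ` polys (m + 3)" using w(1) by blast
  obtain w where w: "w \<in> polys (m + 3)" "Ff z1 t1 - 0 = XX * w"
    using z1_t1_congr(2) unfolding congr_def by blast
  have "psi (Ff z1 t1) = XX * psi w"
    using arg_cong[OF w(2), of psi] by (simp add: psi_mult[OF XX_polys w(1)] psi_XX)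
  then have "XX * yy = XX * psi w"
    by (simp add: psi_Ff[OF z1_polys t1_polys] psi_z1 psi_t1 XX_yy ff_Ff)
  then have "yy = psi w" by (rule XX_cancel)
  then show "yy \<in> psi ` polys (m + 3)" using w(1) by blast
qed

lemma psi_image: "psi ` polys (m + 3) = ringAV"
proof
  show "psi ` polys (m + 3) \<subseteq> ringAV" using psi_ringAV by blast
  define T where "T = psi ` polys (m + 3)"
  have Tadd: "a + b \<in> T" and Tmult: "a * b \<in> T" if ab: "a \<in> T" "b \<in> T" for a b
  proof -
    obtain x y where "x \<in> polys (m + 3)" "y \<in> polys (m + 3)" "a = psi x" "b = psi y"
      using ab unfolding T_def by blast
    then have "a + b = psi (x + y)" "a * b = psi (x * y)" "x + y \<in> polys (m + 3)" "x * y \<in> polys (m + 3)"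
      by (simp_all add: psi_add psi_mult polys_add polys_mult)
    then show "a + b \<in> T" "a * b \<in> T" unfolding T_def by blast+
  qed
  have Tsc: "sc c \<in> T" for c
    unfolding T_def by (rule image_eqI[of _ _ "sc c"]) (simp_all add: psi_sc)
  have Tz: "zz \<in> T" "tt \<in> T"
    unfolding T_def using z1_polys t1_polys psi_z1 psi_t1 by (metis image_eqI)+
  have Tv: "xvar l \<in> T" if "l < m + 2" for l
  proof (cases "l < m")
    case True
    then have "psi (xvar l) = xvar l" "xvar l \<in> polys (m + 3)" by (simp_all add: psi_var img_def polys_var)
    then show ?thesis unfolding T_def by (metis image_eqI)
  next
    case False
    then have "l = m \<or> l = m + 1" using that by linarith
    then show ?thesis using Tz by (auto simp: zz_def tt_def)
  qed
  have A: "a \<in> T" if "a \<in> ringA" for a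
    by (rule ringA_generated[OF Tsc Tv _ Tadd Tmult that]) (use yy_in_image in \<open>simp_all add: T_def\<close>)
  show "ringAV \<subseteq> psi ` polys (m + 3)"
  proof
    fix a assume "a \<in> ringAV"
    then obtain P where P: "P \<in> coeffsA" "a = poly P vv" unfolding ringAV_def by auto
    have vp: "vv ^ n \<in> T" for n using vv_in_image Tsc[of 1] by (induction n) (auto simp: T_def[symmetric] Tmult)
    have "(\<Sum>i\<in>I. cf P i * vv ^ i) \<in> T" if "finite I" for I
      using that
    proof (induction I rule: finite_induct)
      case (insert i I)
      have "cf P i \<in> T" using P(1) A by (simp add: coeffsA_def)
      then show ?case using insert Tadd[OF Tmult[OF _ vp] insert(3)] by simp
    qed (use Tsc[of 0] in simp)
    then show "a \<in> psi ` polys (m + 3)" unfolding P(2) poly_altdef T_def by simp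
  qed
qed

section \<open>The inverse of the coordinate change\<close>

definition v1 :: "'f laurent" where "v1 = (xvar m - Pf z1 t1) * Xinv"

text \<open>The \<open>X\<close> variables stay invertible here because the elements
  \<open>img l\<close> involve \<open>Xinv\<close>; nonnegativity is imposed only on the exponents
  of \<open>z, t, v\<close>.\<close>

definition chi_mon :: "expo \<Rightarrow> 'f laurent" where
  "chi_mon \<mu> = lmon (restr (\<lambda>l. l < m) \<mu>) * z1 ^ nat (lk \<mu> m) * t1 ^ nat (lk \<mu> (m + 1)) * v1 ^ nat (lk \<mu> (m + 2))"

definition nn_last :: "expo set" where
  "nn_last = {\<mu>. lk \<mu> m \<ge> 0 \<and> lk \<mu> (m + 1) \<ge> 0 \<and> lk \<mu> (m + 2) \<ge> 0}"

sublocale chi: lin_ext_hom sc chi_mon nn_last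
proof
  show "chi_mon (\<mu> + \<nu>) = chi_mon \<mu> * chi_mon \<nu>" if "\<mu> \<in> nn_last" "\<nu> \<in> nn_last" for \<mu> \<nu>
    using that by (simp add: chi_mon_def nn_last_def lookup_add nat_add_distrib power_add restr_add mult_ac flip: lmon_mult)
qed (simp_all add: sc_add sc_mult chi_mon_def nn_last_def lookup_add)

definition chi :: "'f laurent \<Rightarrow> 'f laurent" where "chi = lin_ext sc chi_mon"

lemma chi_psi: "a \<in> polys (m + 3) \<Longrightarrow> chi (psi a) = a"
proof -
  have x: "\<mu> \<in> nn_last \<and> chi (lmon \<mu>) = lmon \<mu>" if "\<forall>l\<ge>m. lk \<mu> l = 0" for \<mu>
  proof -
    have "restr (\<lambda>l. l < m) \<mu> = \<mu>" using that by (intro restr_all) (auto simp: in_keys_iff not_less[symmetric])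
    then show ?thesis using that unfolding chi_def chi.ext_lmon by (simp add: chi_mon_def nn_last_def)
  qed
  have dX: "XX \<in> chi.dom" "chi XX = XX" "Xinv \<in> chi.dom" "chi Xinv = Xinv"
    unfolding XX_def Xinv_def using x[of Xexp] x[of "- Xexp"] by (auto simp: lk_Xexp intro: chi.dom_lmon)
  have dv: "xvar l \<in> chi.dom" for l
    unfolding xvar_def by (rule chi.dom_lmon) (simp add: nn_last_def lk_unit_exp)
  have r: "restr (\<lambda>l. l < m) (unit_exp k 1) = 0" if "k \<ge> m" for k
    using that by (intro poly_mapping_eqI) (simp add: lk_restr lk_unit_exp)
  have cv: "chi zz = z1" "chi tt = t1" "chi vv = v1"
    unfolding chi_def zz_def tt_def vv_def xvar_def chi.ext_lmon by (simp_all add: chi_mon_def r lk_unit_exp)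
  have cx: "chi (xvar l) = xvar l" if "l < m" for l
    unfolding xvar_def using x[of "unit_exp l 1"] that by (simp add: lk_unit_exp)
  note d = chi.dom_mult chi.dom_add chi.dom_minus chi.dom_power dX(1,3) dv
  have dz: "zz \<in> chi.dom" "tt \<in> chi.dom" "vv \<in> chi.dom" by (simp_all add: zz_def tt_def vv_def dv)
  have dG: "gg \<in> chi.dom" unfolding gg_def by (intro d dz)
  have dQ: "Qf zz tt \<in> chi.dom" unfolding Qf_def gg_Gf[symmetric] by (intro d dz dG)
  have dP: "P0 \<in> chi.dom" unfolding P0_def Pf_def by (intro d dz dQ)
  have dU: "UU \<in> chi.dom" unfolding UU_def by (intro d dz dP)
  have cmult: "chi (a * b) = chi a * chi b" if "a \<in> chi.dom" "b \<in> chi.dom" for a b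
    using that by (simp add: chi_def chi.ext_mult')
  have cpow: "chi (a ^ n) = chi a ^ n" if "a \<in> chi.dom" for a n
    using that by (simp add: chi_def chi.ext_power)
  have cadd: "chi (a + b) = chi a + chi b" "chi (a - b) = chi a - chi b" for a b
    by (simp_all add: chi_def chi.ext_add chi.ext_minus)
  have cG: "chi gg = Gf z1 t1" unfolding gg_def by (simp add: cadd cpow dz cv Gf_def)
  have cQ: "chi (Qf zz tt) = Qf z1 t1" unfolding Qf_def gg_Gf[symmetric] by (simp add: cadd cpow dz dG cv cG)
  have cP: "chi P0 = Pf z1 t1" unfolding P0_def Pf_def by (simp add: cadd cpow dz dQ cv cQ)
  have "XX * v1 = xvar m - Pf z1 t1" unfolding v1_def using XX_Xinv by (simp add: mult.left_commute)
  then have cU: "chi UU = xvar m" unfolding UU_def by (simp add: cadd cmult dX dz cv cP)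
  have dzu: "zu UU \<in> chi.dom" "tu UU \<in> chi.dom" unfolding zu_def tu_def by (intro d dU)+
  have czu: "chi (zu UU) = zu (xvar m)" "chi (tu UU) = tu (xvar m)"
    unfolding zu_def tu_def by (simp_all add: cadd cpow dU cU)
  have X: "XX * a * Xinv = a" for a using XX_Xinv by (simp add: mult_ac)
  have img: "img l \<in> chi.dom \<and> chi (img l) = xvar l" if "l < m + 3" for l
  proof -
    consider "l < m" | "l = m" | "l = m + 1" | "l = m + 2" using \<open>l < m + 3\<close> by linarith
    then show ?thesis
    proof cases
      case 3
      have "(zz - zu UU) * Xinv \<in> chi.dom" by (intro d dz dzu)
      moreover have "chi ((zz - zu UU) * Xinv) = (z1 - zu (xvar m)) * Xinv"
        by (simp add: cmult cadd chi.dom_minus dz dzu dX cv czu)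
      ultimately show ?thesis using 3 X by (simp add: img_def z1_def)
    next
      case 4
      have "(tt - tu UU) * Xinv \<in> chi.dom" by (intro d dz dzu)
      moreover have "chi ((tt - tu UU) * Xinv) = (t1 - tu (xvar m)) * Xinv"
        by (simp add: cmult cadd chi.dom_minus dz dzu dX cv czu)
      ultimately show ?thesis using 4 X by (simp add: img_def t1_def)
    qed (simp_all add: img_def dv cx dU cU)
  qed
  assume "a \<in> polys (m + 3)"
  then have "psi a \<in> chi.dom \<and> chi (psi a) = a"
  proof (induction rule: polys_induct)
    case (sc c)
    show ?case by (simp add: psi_sc chi.dom_sc, simp add: chi_def chi.ext_sc)
  next
    case (add a b)
    then show ?case by (simp add: psi_add cadd chi.dom_add)
  next
    case (xvar a l)
    then show ?case using img[of l] by (simp add: psi_mult[OF polys_var] psi_var cmult chi.dom_mult)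
  qed
  then show ?thesis by simp
qed

lemma ringA_supp_zero: "a \<in> ringA \<Longrightarrow> \<mu> \<in> supp a \<Longrightarrow> l \<ge> m + 2 \<Longrightarrow> lk \<mu> l = 0"
proof -
  assume a: "a \<in> ringA" and \<mu>: "\<mu> \<in> supp a" and l: "l \<ge> m + 2"
  define Q where "Q = {u :: 'f laurent. \<forall>\<mu>\<in>supp u. lk \<mu> l = 0}"
  have Qm: "u * u' \<in> Q" if "u \<in> Q" "u' \<in> Q" for u u'
    using that unfolding Q_def by (fastforce dest!: supp_add_prod simp: lookup_add)
  have Qa: "u + u' \<in> Q" if "u \<in> Q" "u' \<in> Q" for u u'
    using that keys_add[of u u'] unfolding Q_def by blast
  have "ff \<in> Q" using ff_pol l by (auto simp: Q_def pol_def)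
  moreover have "Xinv \<in> Q" using l by (simp add: Q_def Xinv_def lk_Xexp)
  ultimately have "yy \<in> Q" unfolding yy_def by (intro Qm)
  then have "a \<in> Q"
    by (intro ringA_generated[OF _ _ _ Qa Qm a]) (use l in \<open>auto simp: Q_def supp_sc xvar_def lk_unit_exp\<close>)
  then show ?thesis using \<mu> by (auto simp: Q_def)
qed

text \<open>Elements of \<open>A\<close> do not involve the variable \<open>m + 2\<close>, so its
  exponent separates the terms of the evaluated polynomial.\<close>

lemma poly_vv_inj:
  assumes "P \<in> coeffsA" "poly P vv = 0"
  shows "P = 0"
proof (rule poly_eqI)
  fix i
  have part: "restr (\<lambda>\<mu>. lk \<mu> (m + 2) = int i) (cf P j * vv ^ j) = (if j = i then cf P j * vv ^ j else 0)" for j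
  proof -
    have "lk \<mu> (m + 2) = int j" if \<mu>: "\<mu> \<in> supp (cf P j * vv ^ j)" for \<mu>
    proof -
      obtain \<alpha> where \<alpha>: "\<alpha> \<in> supp (cf P j)" "\<mu> = \<alpha> + unit_exp (m + 2) (int j)"
        using supp_add_prod[OF \<mu>] by (auto simp: vv_def xvar_power)
      have "lk \<alpha> (m + 2) = 0"
        using assms(1) \<alpha>(1) by (intro ringA_supp_zero[of "cf P j"]) (auto simp: coeffsA_def)
      then show ?thesis by (simp add: \<alpha>(2) lookup_add lk_unit_exp)
    qed
    then show ?thesis by (auto intro!: restr_all restr_none)
  qed
  have "0 = restr (\<lambda>\<mu>. lk \<mu> (m + 2) = int i) (poly P vv)" using assms(2) by simp
  also have "\<dots> = (\<Sum>j\<le>Polynomial.degree P. if j = i then cf P j * vv ^ j else 0)"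
    unfolding poly_altdef restr_sum part ..
  also have "\<dots> = cf P i * vv ^ i" by (auto simp: coeff_eq_0)
  finally show "cf P i = cf 0 i" by (simp add: vv_def)
qed

text \<open>Evaluation at \<open>vv\<close> followed by \<open>chi\<close>. As \<open>chi\<close>
  inverts \<open>psi\<close> on \<open>ringAV\<close>, the ring laws are inherited from
  \<open>psi\<close>.\<close>

theorem exists_poly_iso:
  "\<exists>\<Theta>. bij_betw \<Theta> coeffsA (polys (m + 3)) \<and>
     (\<forall>P\<in>coeffsA. \<forall>Q\<in>coeffsA. \<Theta> (P + Q) = \<Theta> P + \<Theta> Q \<and> \<Theta> (P * Q) = \<Theta> P * \<Theta> Q) \<and>
     (\<forall>c. \<Theta> [:sc c:] = sc c)"
proof -
  define \<Theta> where "\<Theta> P = chi (poly P vv)" for P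
  have inj: "inj_on psi (polys (m + 3))" by (rule inj_on_inverseI[of _ chi]) (rule chi_psi)
  have th: "\<Theta> P = a" if "a \<in> polys (m + 3)" "poly P vv = psi a" for P a
    using that by (simp add: \<Theta>_def chi_psi)
  have ex: "\<exists>a\<in>polys (m + 3). poly P vv = psi a" if "P \<in> coeffsA" for P
    using that psi_image unfolding ringAV_def by (metis (no_types, lifting) image_iff)
  have bij: "bij_betw \<Theta> coeffsA (polys (m + 3))"
    unfolding bij_betw_def
  proof
    show "inj_on \<Theta> coeffsA"
    proof (rule inj_onI)
      fix P Q assume P: "P \<in> coeffsA" and Q: "Q \<in> coeffsA" and eq: "\<Theta> P = \<Theta> Q"
      have "poly P vv = poly Q vv" using ex[OF P] ex[OF Q] eq th by metis
      then have "poly (P - Q) vv = 0" by simp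
      then have "P - Q = 0" by (rule poly_vv_inj[OF coeffsA_minus[OF P Q]])
      then show "P = Q" by simp
    qed
    show "\<Theta> ` coeffsA = polys (m + 3)"
    proof
      show "\<Theta> ` coeffsA \<subseteq> polys (m + 3)"
      proof (rule image_subsetI)
        fix P assume "P \<in> coeffsA"
        then obtain a where "a \<in> polys (m + 3)" "poly P vv = psi a" using ex by blast
        then show "\<Theta> P \<in> polys (m + 3)" using th by simp
      qed
      show "polys (m + 3) \<subseteq> \<Theta> ` coeffsA"
      proof
        fix a :: "'f laurent" assume a: "a \<in> polys (m + 3)"
        then obtain P where "P \<in> coeffsA" "psi a = poly P vv" using psi_ringAV unfolding ringAV_def by blast
        then show "a \<in> \<Theta> ` coeffsA" using th[OF a, of P] by (metis image_eqI)
      qed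
    qed
  qed
  have hom: "\<Theta> (P + Q) = \<Theta> P + \<Theta> Q \<and> \<Theta> (P * Q) = \<Theta> P * \<Theta> Q" if PQ: "P \<in> coeffsA" "Q \<in> coeffsA" for P Q
  proof -
    obtain a b where ab: "a \<in> polys (m + 3)" "b \<in> polys (m + 3)" "poly P vv = psi a" "poly Q vv = psi b"
      using ex[OF PQ(1)] ex[OF PQ(2)] by blast
    then have "\<Theta> P = a" "\<Theta> Q = b" using th by auto
    moreover have "\<Theta> (P + Q) = a + b" using ab by (intro th) (simp_all add: polys_add psi_add)
    moreover have "\<Theta> (P * Q) = a * b" using ab by (intro th) (simp_all add: polys_mult psi_mult)
    ultimately show ?thesis by simp
  qed
  have "\<Theta> [:sc c:] = sc c" for c by (rule th) (simp_all add: psi_sc)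
  with bij hom show ?thesis by blast
qed

end

section \<open>Algebras over a field given by a carrier\<close>

definition mexp :: "nat multiset \<Rightarrow> expo" where
  "mexp M = Abs_poly_mapping (\<lambda>l. int (count M l))"

lemma lk_mexp: "lk (mexp M) l = int (count M l)"
proof -
  have "{l. int (count M l) \<noteq> 0} = set_mset M" by auto
  then show ?thesis by (simp add: mexp_def)
qed

lemma exists_mset:
  assumes "finite {l. f l \<noteq> 0}"
  shows "\<exists>M. \<forall>l. count M l = (f l :: nat)"
proof -
  have "finite {l. 0 < f l}" using assms by simp
  then show ?thesis by (metis count_Abs_multiset)
qed

lemma mexp_surj: "\<forall>l. lk \<mu> l \<ge> 0 \<Longrightarrow> \<exists>M. mexp M = \<mu>"
proof -
  assume nn: "\<forall>l. lk \<mu> l \<ge> 0"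
  have "{l. nat (lk \<mu> l) \<noteq> 0} \<subseteq> supp \<mu>" by (auto simp: in_keys_iff)
  then have "finite {l. nat (lk \<mu> l) \<noteq> 0}" by (rule finite_subset) simp
  from exists_mset[OF this] obtain M where "\<forall>l. count M l = nat (lk \<mu> l)" by blast
  then have "mexp M = \<mu>" using nn by (intro poly_mapping_eqI) (simp add: lk_mexp)
  then show ?thesis by blast
qed

lemma polys_lk_neg: "a \<in> polys N \<Longrightarrow> lk \<mu> l < 0 \<Longrightarrow> lk a \<mu> = 0"
  unfolding polys_def not_in_keys_iff_lookup_eq_zero[symmetric] by (metis (mono_tags, lifting) mem_Collect_eq not_less)

lemma mexp_inj: "mexp M = mexp N \<Longrightarrow> M = N"
  by (metis lk_mexp multiset_eqI of_nat_eq_iff)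

lemma mexp_0_iff: "mexp M = 0 \<longleftrightarrow> M = {#}"
proof -
  have "mexp {#} = 0" by (intro poly_mapping_eqI) (simp add: lk_mexp)
  then show ?thesis using mexp_inj by metis
qed

text \<open>A surjection from multisets onto all exponents, so that functions on multisets can carry
  Laurent polynomials.\<close>

definition dexp :: "nat multiset \<Rightarrow> expo" where
  "dexp M = Abs_poly_mapping (\<lambda>l. int (count M (2 * l)) - int (count M (2 * l + 1)))"

lemma dexp_surj: "\<exists>M. dexp M = \<mu>"
proof -
  define f where "f x = (if even x then nat (lk \<mu> (x div 2)) else nat (- lk \<mu> (x div 2)))" for x
  have "{x. f x \<noteq> 0} \<subseteq> (\<lambda>l. 2 * l) ` supp \<mu> \<union> (\<lambda>l. 2 * l + 1) ` supp \<mu>"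
  proof
    fix x assume "x \<in> {x. f x \<noteq> 0}"
    then have "x div 2 \<in> supp \<mu>" by (auto simp: f_def in_keys_iff split: if_splits)
    moreover have "x = 2 * (x div 2) \<or> x = 2 * (x div 2) + 1" by presburger
    ultimately show "x \<in> (\<lambda>l. 2 * l) ` supp \<mu> \<union> (\<lambda>l. 2 * l + 1) ` supp \<mu>" by blast
  qed
  then have "finite {x. f x \<noteq> 0}" by (rule finite_subset) simp
  from exists_mset[OF this] obtain M where M: "\<forall>l. count M l = f l" by blast
  have "(\<lambda>l. int (count M (2 * l)) - int (count M (2 * l + 1))) = lk \<mu>"
    by (auto simp: M f_def)
  then have "dexp M = \<mu>" by (simp add: dexp_def)
  then show ?thesis by blast
qed

lemma finite_submultisets: "finite {d. d \<subseteq># M}"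
proof (rule finite_subset)
  show "{d. d \<subseteq># M} \<subseteq> mset ` {xs. set xs \<subseteq> set_mset M \<and> length xs \<le> size M}"
  proof
    fix d assume "d \<in> {d. d \<subseteq># M}"
    moreover obtain xs where "mset xs = d" using ex_mset by blast
    ultimately show "d \<in> mset ` {xs. set xs \<subseteq> set_mset M \<and> length xs \<le> size M}"
      by (auto intro!: image_eqI[of _ _ xs] size_mset_mono dest: mset_subset_eqD simp flip: size_mset)
  qed
qed (simp add: finite_lists_length_le)

text \<open>Links a field given by a carrier set with a type of class \<open>field\<close>, over
  which the Laurent polynomials are formed.\<close>

locale field_transfer = field K for K :: "('k, 'm) ring_scheme" (structure) +
  fixes \<iota> :: "'k \<Rightarrow> 'f::field"
  assumes \<iota>_bij: "bij_betw \<iota> (carrier K) UNIV"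
    and \<iota>_add: "a \<in> carrier K \<Longrightarrow> b \<in> carrier K \<Longrightarrow> \<iota> (a \<oplus> b) = \<iota> a + \<iota> b"
    and \<iota>_mult: "a \<in> carrier K \<Longrightarrow> b \<in> carrier K \<Longrightarrow> \<iota> (a \<otimes> b) = \<iota> a * \<iota> b"
begin

definition \<kappa> :: "'f \<Rightarrow> 'k" where "\<kappa> = inv_into (carrier K) \<iota>"

lemma \<kappa>_closed [simp]: "\<kappa> a \<in> carrier K"
  unfolding \<kappa>_def using \<iota>_bij by (intro inv_into_into) (simp add: bij_betw_def)

lemma \<iota>_\<kappa> [simp]: "\<iota> (\<kappa> a) = a"
  unfolding \<kappa>_def using \<iota>_bij by (intro f_inv_into_f) (simp add: bij_betw_def)

lemma \<kappa>_\<iota> [simp]: "c \<in> carrier K \<Longrightarrow> \<kappa> (\<iota> c) = c"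
  unfolding \<kappa>_def using \<iota>_bij by (simp add: bij_betw_def)

lemma \<kappa>_inj: "\<kappa> a = \<kappa> b \<Longrightarrow> a = b"
  by (metis \<iota>_\<kappa>)

lemma \<kappa>_add: "\<kappa> (a + b) = \<kappa> a \<oplus> \<kappa> b"
  by (metis \<iota>_\<kappa> \<iota>_add \<kappa>_\<iota> \<kappa>_closed add.m_closed)

lemma \<kappa>_mult: "\<kappa> (a * b) = \<kappa> a \<otimes> \<kappa> b"
  by (metis \<iota>_\<kappa> \<iota>_mult \<kappa>_\<iota> \<kappa>_closed m_closed)

lemma \<iota>_zero: "\<iota> \<zero> = 0"
proof -
  have "\<iota> \<zero> = \<iota> \<zero> + \<iota> \<zero>" using \<iota>_add[of \<zero> \<zero>] by (simp only: l_zero zero_closed)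
  then show ?thesis by (metis add_cancel_right_right)
qed

lemma \<iota>_one: "\<iota> \<one> = 1"
proof -
  have "\<iota> \<one> \<noteq> 0"
    by (metis \<iota>_zero \<kappa>_\<iota> one_closed zero_closed one_not_zero)
  then show ?thesis using \<iota>_mult[of \<one> \<one>] by simp
qed

lemma \<kappa>_zero: "\<kappa> 0 = \<zero>" and \<kappa>_one: "\<kappa> 1 = \<one>"
  by (metis \<iota>_zero \<kappa>_\<iota> zero_closed) (metis \<iota>_one \<kappa>_\<iota> one_closed)

lemma \<kappa>_sum: "finite I \<Longrightarrow> \<kappa> (sum h I) = (\<Oplus>i\<in>I. \<kappa> (h i))"
  by (induction I rule: finite_induct) (simp_all add: \<kappa>_zero \<kappa>_add)

lemma CHAR_pos:
  assumes "ring_characteristic K > 0"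
  shows "CHAR('f) > 0"
proof -
  define n where "n = ring_characteristic K"
  have pow: "\<iota> (pow (add_monoid K) \<one> (n :: nat)) = of_nat n \<and> pow (add_monoid K) \<one> n \<in> carrier K" for n
  proof (induction n)
    case 0
    show ?case by (simp add: \<iota>_zero)
  next
    case (Suc n)
    have "pow (add_monoid K) \<one> (Suc n) = pow (add_monoid K) \<one> n \<oplus> \<one>"
      by (subst Group.nat_pow_Suc) simp
    then show ?case using Suc \<iota>_add[of "pow (add_monoid K) \<one> n" \<one>] by (simp only: add.m_closed one_closed \<iota>_one) simp
  qed
  have "pow (add_monoid K) \<one> n = \<zero>"
    unfolding n_def ring_characteristic_def using group.pow_ord_eq_1[OF add.is_group, of \<one>] by simp
  then have "(of_nat n :: 'f) = 0" using pow[of n] \<iota>_zero by (metis)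
  then show ?thesis using assms unfolding CHAR_pos_iff n_def by blast
qed

text \<open>Only nonnegative exponents are visible through \<open>mexp\<close>, which is faithful on
  \<open>polys N\<close>.\<close>

definition enc :: "'f laurent \<Rightarrow> nat multiset \<Rightarrow> 'k" where
  "enc a M = \<kappa> (lk a (mexp M))"

lemma enc_sc: "enc (sc c) = indexed_const (\<kappa> c)"
  unfolding enc_def indexed_const_def sc_def
  by (auto simp: lookup_single when_def \<kappa>_zero mexp_0_iff fun_eq_iff eq_commute[of 0])

lemma enc_add: "enc (a + b) = indexed_padd (enc a) (enc b)"
  by (simp add: enc_def indexed_padd_def lookup_add \<kappa>_add fun_eq_iff)

lemma enc_var: "a \<in> polys N \<Longrightarrow> enc (xvar i * a) = indexed_pmult (enc a) i"
proof
  fix M assume a: "a \<in> polys N"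
  show "enc (xvar i * a) M = indexed_pmult (enc a) i M"
  proof (cases "i \<in># M")
    case True
    have "mexp M - unit_exp i 1 = mexp (M - {#i#})"
    proof (rule poly_mapping_eqI)
      fix l
      have "count M i \<ge> 1" using True by (simp add: Suc_le_eq)
      then show "lk (mexp M - unit_exp i 1) l = lk (mexp (M - {#i#})) l"
        by (cases "l = i") (simp_all add: lookup_minus lk_mexp lk_unit_exp of_nat_diff)
    qed
    then show ?thesis using True by (simp add: enc_def indexed_pmult_def xvar_def lk_lmon_mult)
  next
    case False
    then have "lk (mexp M - unit_exp i 1) i < 0" by (simp add: lookup_minus lk_mexp lk_unit_exp not_in_iff)
    then have "lk a (mexp M - unit_exp i 1) = 0" by (rule polys_lk_neg[OF a])
    then show ?thesis using False by (simp add: enc_def indexed_pmult_def xvar_def lk_lmon_mult \<kappa>_zero)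
  qed
qed

lemma enc_image: "enc ` polys N = indexed_pset {..<N} (carrier K)"
proof
  show "enc ` polys N \<subseteq> indexed_pset {..<N} (carrier K)"
  proof (rule image_subsetI)
    fix a :: "'f laurent" assume "a \<in> polys N"
    then show "enc a \<in> indexed_pset {..<N} (carrier K)"
    proof (induction rule: polys_induct)
      case (xvar a l)
      then show ?case by (simp add: enc_var indexed_pset.indexed_pmult)
    qed (simp_all add: enc_sc enc_add indexed_pset.indexed_const indexed_pset.indexed_padd)
  qed
  show "indexed_pset {..<N} (carrier K) \<subseteq> enc ` polys N"
  proof
    fix P assume "P \<in> indexed_pset {..<N} (carrier K)"
    then show "P \<in> enc ` polys N"
    proof (induction rule: indexed_pset.induct)
      case (indexed_const k)
      then have "indexed_const k = enc (sc (\<iota> k))" by (simp add: enc_sc)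
      then show ?case by simp
    next
      case (indexed_padd P Q)
      then obtain a b where "a \<in> polys N" "b \<in> polys N" "P = enc a" "Q = enc b" by blast
      then have "indexed_padd P Q = enc (a + b)" "a + b \<in> polys N" by (simp_all add: enc_add polys_add)
      then show ?case by blast
    next
      case (indexed_pmult P i)
      then obtain a where "a \<in> polys N" "P = enc a" by blast
      moreover from this have "indexed_pmult P i = enc (xvar i * a)" by (simp add: enc_var)
      moreover have "xvar i * a \<in> polys N" using calculation indexed_pmult by (simp add: polys_mult polys_var)
      ultimately show ?case by blast
    qed
  qed
qed

lemma enc_inj: "inj_on enc (polys N)"
proof (rule inj_onI)
  fix a b :: "'f laurent" assume a: "a \<in> polys N" and b: "b \<in> polys N" and eq: "enc a = enc b"
  show "a = b"
  proof (rule poly_mapping_eqI)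
    fix \<mu>
    show "lk a \<mu> = lk b \<mu>"
    proof (cases "\<forall>l. lk \<mu> l \<ge> 0")
      case True
      then obtain M where "mexp M = \<mu>" using mexp_surj by blast
      then show ?thesis using fun_cong[OF eq, of M] \<kappa>_inj by (auto simp: enc_def)
    next
      case False
      then have "\<mu> \<notin> supp a" "\<mu> \<notin> supp b" using a b by (auto simp: polys_def)
      then show ?thesis by (simp add: in_keys_iff)
    qed
  qed
qed

text \<open>By linearity \<open>a\<close> may be a monomial, and its multiset \<open>D\<close> is
  the only index that contributes. If \<open>D\<close> is not contained in \<open>M\<close>, the
  exponent difference is negative somewhere, where \<open>b\<close> has no term.\<close>

lemma lk_mult_mexp:
  assumes "a \<in> polys N" "b \<in> polys N"
  shows "lk (a * b) (mexp M) = (\<Sum>d\<in>{d. d \<subseteq># M}. lk a (mexp d) * lk b (mexp (M - d)))"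
proof -
  have fin: "finite {d. d \<subseteq># M}" by (rule finite_submultisets) 
  have single: "lk (sc c * lmon \<mu> * b) (mexp M) = (\<Sum>d\<in>{d. d \<subseteq># M}. lk (sc c * lmon \<mu>) (mexp d) * lk b (mexp (M - d)))"
    if "\<forall>l. lk \<mu> l \<ge> 0" for c \<mu>
  proof -
    obtain D where D: "mexp D = \<mu>" using mexp_surj \<open>\<forall>l. lk \<mu> l \<ge> 0\<close> by blast
    have "(\<Sum>d\<in>{d. d \<subseteq># M}. lk (sc c * lmon \<mu>) (mexp d) * lk b (mexp (M - d)))
        = (\<Sum>d\<in>{d. d \<subseteq># M}. if d = D then c * lk b (mexp (M - D)) else 0)"
      using D mexp_inj by (intro sum.cong refl) (auto simp: sc_mult_lmon lookup_single when_def)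
    also have "\<dots> = (if D \<subseteq># M then c * lk b (mexp (M - D)) else 0)" using fin by simp
    also have "\<dots> = c * lk b (mexp M - \<mu>)"
    proof (cases "D \<subseteq># M")
      case True
      then have "mexp (M - D) = mexp M - \<mu>"
        by (intro poly_mapping_eqI) (simp add: D[symmetric] lookup_minus lk_mexp of_nat_diff mset_subset_eq_count)
      then show ?thesis using True by simp
    next
      case False
      then obtain l where "count D l > count M l" unfolding subseteq_mset_def by (meson not_le)
      then have "lk (mexp M - \<mu>) l < 0" by (simp add: D[symmetric] lookup_minus lk_mexp)
      then have "lk b (mexp M - \<mu>) = 0" by (rule polys_lk_neg[OF assms(2)])
      then show ?thesis using False by simp
    qed
    also have "\<dots> = lk (sc c * lmon \<mu> * b) (mexp M)" by (simp add: mult.assoc lk_sc_mult lk_lmon_mult)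
    finally show ?thesis by simp
  qed
  have "lk (a * b) (mexp M) = (\<Sum>\<mu>\<in>supp a. lk (sc (lk a \<mu>) * lmon \<mu> * b) (mexp M))"
    by (subst (1) laurent_expand[of a]) (simp add: sum_distrib_right lookup_sum)
  also have "\<dots> = (\<Sum>\<mu>\<in>supp a. \<Sum>d\<in>{d. d \<subseteq># M}. lk (sc (lk a \<mu>) * lmon \<mu>) (mexp d) * lk b (mexp (M - d)))"
    using assms(1) by (intro sum.cong refl single) (auto simp: polys_def)
  also have "\<dots> = (\<Sum>d\<in>{d. d \<subseteq># M}. \<Sum>\<mu>\<in>supp a. lk (sc (lk a \<mu>) * lmon \<mu>) (mexp d) * lk b (mexp (M - d)))"
    by (rule sum.swap)
  also have "\<dots> = (\<Sum>d\<in>{d. d \<subseteq># M}. lk a (mexp d) * lk b (mexp (M - d)))"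
    by (subst (2) laurent_expand[of a]) (simp add: sum_distrib_right lookup_sum)
  finally show ?thesis .
qed

lemma enc_mult:
  assumes "a \<in> polys N" "b \<in> polys N"
  shows "enc (a * b) = (\<lambda>M. \<Oplus>d\<in>{d. d \<subseteq># M}. enc a d \<otimes> enc b (M - d))"
proof
  fix M :: "nat multiset"
  have "finite {d. d \<subseteq># M}" by (rule finite_submultisets)
  then show "enc (a * b) M = (\<Oplus>d\<in>{d. d \<subseteq># M}. enc a d \<otimes> enc b (M - d))"
    by (simp add: enc_def lk_mult_mexp[OF assms] \<kappa>_sum \<kappa>_mult)
qed

lemma enc_smult: "c \<in> carrier K \<Longrightarrow> enc (sc (\<iota> c) * a) = (\<lambda>M. c \<otimes> enc a M)"
  by (simp add: enc_def lk_sc_mult \<kappa>_mult fun_eq_iff)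

text \<open>Elements of \<open>A\<close> have negative exponents, so \<open>mexp\<close> would lose
  information; through the surjection \<open>dexp\<close> the code is redundant but
  injective.\<close>

definition encA :: "'f laurent \<Rightarrow> nat multiset \<Rightarrow> 'k" where
  "encA a M = \<kappa> (lk a (dexp M))"

definition decA :: "(nat multiset \<Rightarrow> 'k) \<Rightarrow> 'f laurent" where "decA = inv_into UNIV encA"

lemma encA_inj: "inj encA"
proof (rule injI)
  fix a b assume eq: "encA a = encA b"
  show "a = b"
  proof (rule poly_mapping_eqI)
    fix \<mu>
    obtain M where "dexp M = \<mu>" using dexp_surj by blast
    then show "lk a \<mu> = lk b \<mu>" using fun_cong[OF eq, of M] \<kappa>_inj by (auto simp: encA_def)
  qed
qed

lemma decA_encA [simp]: "decA (encA a) = a"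
  unfolding decA_def by (rule inv_f_f[OF encA_inj])

lemma encA_eq_iff [simp]: "encA a = encA b \<longleftrightarrow> a = b"
  using encA_inj by (rule inj_eq)

definition alg_of :: "'f laurent set \<Rightarrow> ('k, nat multiset \<Rightarrow> 'k) module" where
  "alg_of S = \<lparr> carrier = encA ` S, monoid.mult = (\<lambda>x y. encA (decA x * decA y)), one = encA 1,
     zero = encA 0, add = (\<lambda>x y. encA (decA x + decA y)), module.smult = (\<lambda>c x. encA (sc (\<iota> c) * decA x)) \<rparr>"

lemma alg_of_simps [simp]:
  "carrier (alg_of S) = encA ` S" "encA a \<otimes>\<^bsub>alg_of S\<^esub> encA b = encA (a * b)" "\<one>\<^bsub>alg_of S\<^esub> = encA 1"
  "\<zero>\<^bsub>alg_of S\<^esub> = encA 0" "encA a \<oplus>\<^bsub>alg_of S\<^esub> encA b = encA (a + b)" "c \<odot>\<^bsub>alg_of S\<^esub> encA a = encA (sc (\<iota> c) * a)"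
  by (simp_all add: alg_of_def)

lemma alg_of_algebra:
  assumes "subring_set S" and sc: "\<And>c. sc c \<in> S"
  shows "algebra K (alg_of S)"
proof -
  interpret S: subring_set S by fact
  have cr: "cring (alg_of S)"
  proof (rule cringI)
    show "abelian_group (alg_of S)"
    proof (rule abelian_groupI)
      fix x assume "x \<in> carrier (alg_of S)"
      then obtain a where a: "a \<in> S" "x = encA a" by auto
      have "encA (0 - a) \<oplus>\<^bsub>alg_of S\<^esub> x = \<zero>\<^bsub>alg_of S\<^esub>" by (simp add: a)
      moreover have "encA (0 - a) \<in> carrier (alg_of S)"
        using S.minus_closed[OF S.zero_closed a(1)] by simp
      ultimately show "\<exists>y\<in>carrier (alg_of S). y \<oplus>\<^bsub>alg_of S\<^esub> x = \<zero>\<^bsub>alg_of S\<^esub>" by blast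
    qed (auto simp: S.add_closed S.zero_closed add_ac)
    show "comm_monoid (alg_of S)"
      by (rule comm_monoidI) (auto simp: S.mult_closed S.one_closed mult_ac)
  qed (auto simp: distrib_right)
  show ?thesis
    by (rule algebraI[OF is_cring cr])
      (auto simp: S.mult_closed sc \<iota>_add \<iota>_mult sc_add sc_mult distrib_left distrib_right mult.assoc \<iota>_one)
qed

section \<open>Polynomials over the encoded algebra\<close>

definition to_poly :: "(nat \<Rightarrow> nat multiset \<Rightarrow> 'k) \<Rightarrow> 'f laurent poly" where
  "to_poly P = Abs_poly (\<lambda>i. decA (P i))"

lemma up_iff: "P \<in> up (alg_of S) \<longleftrightarrow> (\<forall>i. P i \<in> encA ` S) \<and> (\<exists>n. \<forall>i>n. P i = encA 0)"
  by (auto simp: up_def Pi_iff bound_def)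

lemma cf_to_poly: "P \<in> up (alg_of S) \<Longrightarrow> cf (to_poly P) i = decA (P i)"
proof -
  assume "P \<in> up (alg_of S)"
  then obtain n where n: "\<forall>i>n. P i = encA 0" unfolding up_iff by blast
  then show ?thesis unfolding to_poly_def by (intro coeff_Abs_poly[of n, THEN fun_cong]) simp
qed

lemma up_encA: "P \<in> up (alg_of S) \<Longrightarrow> P i = encA (cf (to_poly P) i)"
  by (simp only: cf_to_poly) (auto simp: up_iff image_iff, metis decA_encA)

lemma to_poly_bij: "bij_betw to_poly (up (alg_of S)) {P. \<forall>i. cf P i \<in> S}" if "0 \<in> S"
  unfolding bij_betw_def
proof
  show "inj_on to_poly (up (alg_of S))"
    by (rule inj_onI) (metis ext up_encA)
  show "to_poly ` up (alg_of S) = {P. \<forall>i. cf P i \<in> S}"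
  proof
    show "to_poly ` up (alg_of S) \<subseteq> {P. \<forall>i. cf P i \<in> S}"
    proof (rule image_subsetI)
      fix P assume P: "P \<in> up (alg_of S)"
      have "cf (to_poly P) i \<in> S" for i
      proof -
        obtain a where "a \<in> S" "P i = encA a" using P by (auto simp: up_iff)
        then show ?thesis using up_encA[OF P, of i] by simp
      qed
      then show "to_poly P \<in> {P. \<forall>i. cf P i \<in> S}" by simp
    qed
    show "{P. \<forall>i. cf P i \<in> S} \<subseteq> to_poly ` up (alg_of S)"
    proof
      fix Q assume Q: "Q \<in> {P. \<forall>i. cf P i \<in> S}"
      have mem: "(\<lambda>i. encA (cf Q i)) \<in> up (alg_of S)"
        unfolding up_iff using Q by (auto intro!: exI[of _ "Polynomial.degree Q"] simp: coeff_eq_0)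
      have "to_poly (\<lambda>i. encA (cf Q i)) = Q"
        by (rule poly_eqI) (simp add: cf_to_poly[OF mem])
      then show "Q \<in> to_poly ` up (alg_of S)" using mem by (metis image_eqI)
    qed
  qed
qed

theorem transfer:
  assumes char: "ring_characteristic K > 0" and n: "n \<ge> 3"
  shows "\<exists>A :: ('k, nat multiset \<Rightarrow> 'k) module.
        finitely_generated_algebra K A \<and>
        algebra_isomorphic K (poly_algebra A) (mpoly_algebra K (n + 1)) \<and>
        \<not> algebra_isomorphic K A (mpoly_algebra K n)"
proof -
  \<comment> \<open>\<open>A\<close> is compared with a polynomial ring in \<open>m + 2\<close>
    variables, so \<open>n \<ge> 3\<close> amounts to having at least one \<open>X\<close>
    variable.\<close>
  define m where "m = n - 2"
  have nm: "n = m + 2" "Suc n = m + 3" using n by (simp_all add: m_def)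
  define p where "p = CHAR('f)"
  interpret asanuma m p "TYPE('f)"
  proof
    show "prime p" unfolding p_def using CHAR_pos[OF char] by (rule prime_CHAR_semidom)
  qed (use n in \<open>simp_all add: p_def m_def\<close>)
  define A where "A = alg_of ringA"
  have sub: "subring_set ringA"
    by unfold_locales (auto intro: ringA_add ringA_mult ringA_minus)
  have alg: "algebra K A" unfolding A_def by (rule alg_of_algebra[OF sub ringA_sc])
  interpret A: algebra K A by (rule alg)
  have carrierA: "carrier A = encA ` ringA" by (simp add: A_def)

  have fg: "finitely_generated_algebra K A"
  proof -
    define G where "G = insert (encA yy) ((\<lambda>l. encA (xvar l)) ` {..<m + 2})"
    define H where "H = (\<lambda>c. c \<odot>\<^bsub>A\<^esub> \<one>\<^bsub>A\<^esub>) ` carrier K \<union> G"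
    have G: "finite G" "G \<subseteq> carrier A" by (auto simp: G_def carrierA ringA_yy ringA_var)
    have H: "H \<subseteq> carrier A" using G(2) by (auto simp: H_def)
    have "generate_ring A H = carrier A"
    proof
      show "generate_ring A H \<subseteq> carrier A" by (rule A.generate_ring_incl[OF H])
      show "carrier A \<subseteq> generate_ring A H"
      proof
        fix x assume "x \<in> carrier A"
        then obtain u where u: "u \<in> ringA" "x = encA u" by (auto simp: carrierA)
        have "u \<in> {u. encA u \<in> generate_ring A H}"
        proof (rule ringA_generated[OF _ _ _ _ _ u(1)])
          fix k
          have "encA (sc k) = \<kappa> k \<odot>\<^bsub>A\<^esub> \<one>\<^bsub>A\<^esub>" by (simp add: A_def)
          then have "encA (sc k) \<in> H" unfolding H_def by (metis UnI1 \<kappa>_closed image_eqI)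
          then show "sc k \<in> {u. encA u \<in> generate_ring A H}" by (simp add: generate_ring.incl)
        next
          fix l assume "l < m + 2"
          then show "xvar l \<in> {u. encA u \<in> generate_ring A H}"
            by (auto simp: H_def G_def intro: generate_ring.incl)
        next
          show "yy \<in> {u. encA u \<in> generate_ring A H}"
            by (auto simp: H_def G_def intro: generate_ring.incl)
        next
          fix a b assume "a \<in> {u. encA u \<in> generate_ring A H}" "b \<in> {u. encA u \<in> generate_ring A H}"
          then have "encA a \<oplus>\<^bsub>A\<^esub> encA b \<in> generate_ring A H" "encA a \<otimes>\<^bsub>A\<^esub> encA b \<in> generate_ring A H"
            by (simp_all add: generate_ring.eng_add generate_ring.eng_mult)
          then show "a + b \<in> {u. encA u \<in> generate_ring A H}" "a * b \<in> {u. encA u \<in> generate_ring A H}"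
            by (simp_all add: A_def)
        qed
        then show "x \<in> generate_ring A H" by (simp add: u)
      qed
    qed
    then show ?thesis unfolding finitely_generated_algebra_def using alg G H_def by blast
  qed

  obtain \<Theta> where \<Theta>: "bij_betw \<Theta> coeffsA (polys (m + 3))"
     "\<And>P Q. P \<in> coeffsA \<Longrightarrow> Q \<in> coeffsA \<Longrightarrow> \<Theta> (P + Q) = \<Theta> P + \<Theta> Q"
     "\<And>P Q. P \<in> coeffsA \<Longrightarrow> Q \<in> coeffsA \<Longrightarrow> \<Theta> (P * Q) = \<Theta> P * \<Theta> Q"
     "\<And>c. \<Theta> [:sc c:] = sc c"
    using exists_poly_iso by blast
  have pos: "algebra_isomorphic K (poly_algebra A) (mpoly_algebra K (n + 1))"
  proof -
    define h where "h P = enc (\<Theta> (to_poly P))" for P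
    have bij1: "bij_betw to_poly (up A) coeffsA"
      unfolding A_def coeffsA_def by (rule to_poly_bij) simp
    have tp: "to_poly P \<in> coeffsA" if "P \<in> up A" for P using bij1 that by (auto simp: bij_betw_def)
    have \<Theta>p: "\<Theta> P \<in> polys (m + 3)" if "P \<in> coeffsA" for P using \<Theta>(1) that by (auto simp: bij_betw_def)
    have eqA: "P i = encA (cf (to_poly P) i)" if "P \<in> up A" for P i
      using up_encA that by (simp add: A_def)
    have to_poly_eq: "to_poly (\<lambda>i. encA (cf P i)) = P" for P
      unfolding to_poly_def by (simp add: coeff_inverse)
    have "bij_betw (enc \<circ> (\<Theta> \<circ> to_poly)) (up A) (enc ` polys (m + 3))"
      by (intro bij_betw_trans[OF bij_betw_trans[OF bij1 \<Theta>(1)]] inj_on_imp_bij_betw enc_inj)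
    then have bij: "bij_betw h (carrier (poly_algebra A)) (carrier (mpoly_algebra K (n + 1)))"
      by (simp add: h_def[abs_def] comp_def poly_algebra_def UP_def mpoly_algebra_def enc_image nm(2))
    have hom: "h \<in> ring_hom (poly_algebra A) (mpoly_algebra K (n + 1))"
    proof (rule ring_hom_memI)
      show "h x \<in> carrier (mpoly_algebra K (n + 1))" if "x \<in> carrier (poly_algebra A)" for x
        using bij that by (auto simp: bij_betw_def)
    next
      fix P Q assume "P \<in> carrier (poly_algebra A)" "Q \<in> carrier (poly_algebra A)"
      then have P: "P \<in> up A" and Q: "Q \<in> up A" by (simp_all add: poly_algebra_def UP_def)
      have fs: "(\<Oplus>\<^bsub>A\<^esub>i\<in>I. encA (f i)) = encA (sum f I)" if "finite I" "\<And>i. i \<in> I \<Longrightarrow> f i \<in> ringA" for f and I :: "nat set"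
        using that
      proof (induction I rule: finite_induct)
        case (insert i I)
        then have "(\<Oplus>\<^bsub>A\<^esub>i\<in>insert i I. encA (f i)) = encA (f i) \<oplus>\<^bsub>A\<^esub> (\<Oplus>\<^bsub>A\<^esub>i\<in>I. encA (f i))"
          by (intro A.finsum_insert) (auto simp: carrierA)
        then show ?case using insert by (simp add: A_def)
      next
        case empty
        show ?case unfolding A.finsum_empty by (simp add: A_def)
      qed
      have "P \<otimes>\<^bsub>poly_algebra A\<^esub> Q = (\<lambda>k. \<Oplus>\<^bsub>A\<^esub>i\<in>{..k}. P i \<otimes>\<^bsub>A\<^esub> Q (k - i))"
        using P Q by (simp add: poly_algebra_def UP_def)
      also have "\<dots> = (\<lambda>k. encA (cf (to_poly P * to_poly Q) k))"
      proof
        fix k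
        have "(\<Oplus>\<^bsub>A\<^esub>i\<in>{..k}. P i \<otimes>\<^bsub>A\<^esub> Q (k - i)) = (\<Oplus>\<^bsub>A\<^esub>i\<in>{..k}. encA (cf (to_poly P) i * cf (to_poly Q) (k - i)))"
          by (subst eqA[OF P], subst eqA[OF Q]) (simp add: A_def)
        also have "\<dots> = encA (\<Sum>i\<le>k. cf (to_poly P) i * cf (to_poly Q) (k - i))"
          using tp[OF P] tp[OF Q] by (intro fs) (auto simp: coeffsA_def ringA_mult)
        finally show "(\<Oplus>\<^bsub>A\<^esub>i\<in>{..k}. P i \<otimes>\<^bsub>A\<^esub> Q (k - i)) = encA (cf (to_poly P * to_poly Q) k)"
          by (simp add: coeff_mult)
      qed
      finally have "to_poly (P \<otimes>\<^bsub>poly_algebra A\<^esub> Q) = to_poly P * to_poly Q" by (simp add: to_poly_eq)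
      then show "h (P \<otimes>\<^bsub>poly_algebra A\<^esub> Q) = h P \<otimes>\<^bsub>mpoly_algebra K (n + 1)\<^esub> h Q"
        using tp[OF P] tp[OF Q] enc_mult[OF \<Theta>p[OF tp[OF P]] \<Theta>p[OF tp[OF Q]]]
        by (simp add: h_def \<Theta>(3) mpoly_algebra_def)
      have "P \<oplus>\<^bsub>poly_algebra A\<^esub> Q = (\<lambda>k. P k \<oplus>\<^bsub>A\<^esub> Q k)"
        using P Q by (simp add: poly_algebra_def UP_def)
      also have "\<dots> = (\<lambda>k. encA (cf (to_poly P + to_poly Q) k))"
        by (subst eqA[OF P], subst eqA[OF Q]) (simp add: A_def)
      finally have "to_poly (P \<oplus>\<^bsub>poly_algebra A\<^esub> Q) = to_poly P + to_poly Q" by (simp only: to_poly_eq)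
      then show "h (P \<oplus>\<^bsub>poly_algebra A\<^esub> Q) = h P \<oplus>\<^bsub>mpoly_algebra K (n + 1)\<^esub> h Q"
        using tp[OF P] tp[OF Q] by (simp add: h_def \<Theta>(2) mpoly_algebra_def enc_add)
    next
      have "\<one>\<^bsub>poly_algebra A\<^esub> = (\<lambda>i. encA (cf [:sc 1:] i))"
        by (auto simp: poly_algebra_def UP_def A_def coeff_pCons fun_eq_iff split: nat.splits)
      then have "to_poly \<one>\<^bsub>poly_algebra A\<^esub> = [:sc 1:]" by (simp only: to_poly_eq)
      then have "h \<one>\<^bsub>poly_algebra A\<^esub> = enc (sc 1)" unfolding h_def by (simp only: \<Theta>(4))
      then show "h \<one>\<^bsub>poly_algebra A\<^esub> = \<one>\<^bsub>mpoly_algebra K (n + 1)\<^esub>"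
        unfolding enc_sc by (simp add: mpoly_algebra_def \<kappa>_one)
    qed
    have "h (c \<odot>\<^bsub>poly_algebra A\<^esub> P) = c \<odot>\<^bsub>mpoly_algebra K (n + 1)\<^esub> h P"
      if c: "c \<in> carrier K" and "P \<in> carrier (poly_algebra A)" for c P
    proof -
      have P: "P \<in> up A" using that by (simp add: poly_algebra_def UP_def)
      have "c \<odot>\<^bsub>poly_algebra A\<^esub> P = (\<lambda>i. c \<odot>\<^bsub>A\<^esub> P i)" by (simp add: poly_algebra_def)
      also have "\<dots> = (\<lambda>i. encA (cf ([:sc (\<iota> c):] * to_poly P) i))"
        by (subst eqA[OF P]) (simp add: A_def)
      finally have "to_poly (c \<odot>\<^bsub>poly_algebra A\<^esub> P) = [:sc (\<iota> c):] * to_poly P" by (simp only: to_poly_eq)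
      then have "h (c \<odot>\<^bsub>poly_algebra A\<^esub> P) = enc (\<Theta> ([:sc (\<iota> c):] * to_poly P))" by (simp add: h_def)
      also have "\<Theta> ([:sc (\<iota> c):] * to_poly P) = sc (\<iota> c) * \<Theta> (to_poly P)"
        using \<Theta>(3)[OF coeffsA_const[OF ringA_sc] tp[OF P]] by (simp only: \<Theta>(4))
      also have "enc \<dots> = c \<odot>\<^bsub>mpoly_algebra K (n + 1)\<^esub> h P"
        using enc_smult[OF c] by (simp add: mpoly_algebra_def h_def)
      finally show ?thesis .
    qed
    then show ?thesis
      unfolding algebra_isomorphic_def ring_iso_def using bij hom by blast
  qed

  have neg: "\<not> algebra_isomorphic K A (mpoly_algebra K n)"
  proof
    assume "algebra_isomorphic K A (mpoly_algebra K n)"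
    then obtain h where hom: "h \<in> ring_hom A (mpoly_algebra K n)" and bij: "bij_betw h (carrier A) (carrier (mpoly_algebra K n))"
      and sm: "\<And>c x. c \<in> carrier K \<Longrightarrow> x \<in> carrier A \<Longrightarrow> h (c \<odot>\<^bsub>A\<^esub> x) = c \<odot>\<^bsub>mpoly_algebra K n\<^esub> h x"
      unfolding algebra_isomorphic_def ring_iso_def by blast
    have cm: "carrier (mpoly_algebra K n) = enc ` polys (m + 2)" by (simp add: mpoly_algebra_def enc_image nm(1))
    define dec where "dec = inv_into (polys (m + 2)) enc"
    have dec_enc: "dec (enc a) = a" if "a \<in> polys (m + 2)" for a
      unfolding dec_def by (rule inv_into_f_f[OF enc_inj that])
    define g where "g u = dec (h (encA u))" for u
    have g: "h (encA u) = enc (g u) \<and> g u \<in> polys (m + 2)" if "u \<in> ringA" for u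
    proof -
      have "h (encA u) \<in> enc ` polys (m + 2)"
        using bij that by (auto simp: bij_betw_def carrierA cm)
      then show ?thesis using dec_enc by (auto simp: g_def)
    qed
    show False
    proof (rule ringA_not_iso[of g])
      have "bij_betw encA ringA (carrier A)"
        using inj_on_subset[OF encA_inj subset_UNIV] by (simp add: bij_betw_def carrierA)
      moreover have "bij_betw dec (enc ` polys (m + 2)) (polys (m + 2))"
        unfolding dec_def by (rule bij_betw_inv_into) (rule inj_on_imp_bij_betw[OF enc_inj])
      ultimately have "bij_betw (dec \<circ> (h \<circ> encA)) ringA (polys (m + 2))"
        using bij unfolding cm by (intro bij_betw_trans)
      then show "bij_betw g ringA (polys (m + 2))" by (simp add: g_def[abs_def] comp_def)
    next
      fix a b assume a: "a \<in> ringA" and b: "b \<in> ringA"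
      have "h (encA a \<oplus>\<^bsub>A\<^esub> encA b) = h (encA a) \<oplus>\<^bsub>mpoly_algebra K n\<^esub> h (encA b)"
        using a b by (intro ring_hom_add[OF hom]) (auto simp: carrierA)
      then have "h (encA (a + b)) = enc (g a + g b)"
        using g[OF a] g[OF b] by (simp add: A_def mpoly_algebra_def enc_add)
      then show "g (a + b) = g a + g b"
        using g[OF a] g[OF b] by (simp add: g_def[of "a + b"] dec_enc polys_add)
      have "h (encA a \<otimes>\<^bsub>A\<^esub> encA b) = h (encA a) \<otimes>\<^bsub>mpoly_algebra K n\<^esub> h (encA b)"
        using a b by (intro ring_hom_mult[OF hom]) (auto simp: carrierA)
      then have "h (encA (a * b)) = enc (g a * g b)"
        using g[OF a] g[OF b] enc_mult[of "g a" "m + 2" "g b"] by (simp add: A_def mpoly_algebra_def)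
      then show "g (a * b) = g a * g b"
        using g[OF a] g[OF b] by (simp add: g_def[of "a * b"] dec_enc polys_mult)
    next
      fix k
      have "h (\<kappa> k \<odot>\<^bsub>A\<^esub> encA 1) = \<kappa> k \<odot>\<^bsub>mpoly_algebra K n\<^esub> h (encA 1)"
        by (rule sm) (simp_all add: carrierA)
      moreover have "h (encA 1) = \<one>\<^bsub>mpoly_algebra K n\<^esub>" using ring_hom_one[OF hom] by (simp add: A_def)
      then have "h (encA 1) = enc 1" using enc_sc[of 1] by (simp add: mpoly_algebra_def \<kappa>_one)
      ultimately have "h (encA (sc k)) = enc (sc k)"
        using enc_smult[of "\<kappa> k" 1] by (simp add: A_def mpoly_algebra_def)
      then show "g (sc k) = sc k" by (simp add: g_def dec_enc)
    qed
  qed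
  show ?thesis using fg pos neg by blast
qed

end

text \<open>A field that violates the claim. As a predicate on all fields over given types it
  depends on no hypothetical field, so a type definition may choose from it.\<close>

definition exceptional :: "('k, 'm) ring_scheme \<Rightarrow> bool" where
  "exceptional K \<longleftrightarrow> field K \<and> ring_characteristic K > 0 \<and> \<not> (\<forall>n::nat. n \<ge> 3 \<longrightarrow>
    (\<exists>A :: ('k, nat multiset \<Rightarrow> 'k) module.
        finitely_generated_algebra K A \<and>
        algebra_isomorphic K (poly_algebra A) (mpoly_algebra K (n + 1)) \<and>
        \<not> algebra_isomorphic K A (mpoly_algebra K n)))"

definition rat_ring :: "rat ring" where
  "rat_ring = \<lparr> carrier = UNIV, monoid.mult = (*), one = 1, zero = 0, add = (+) \<rparr>"

lemma field_rat_ring: "field rat_ring"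
proof -
  interpret cring rat_ring
  proof (rule cringI)
    show "abelian_group rat_ring"
      by (rule abelian_groupI) (auto simp: rat_ring_def intro: exI[of _ "- x" for x])
    show "comm_monoid rat_ring" by (rule comm_monoidI) (auto simp: rat_ring_def)
  qed (auto simp: rat_ring_def distrib_right)
  show ?thesis
    by (rule cring_fieldI2) (auto simp: rat_ring_def intro: exI[of _ "inverse x" for x] right_inverse)
qed

text \<open>Type classes do not apply to a field given by a carrier set, and a type cannot depend on a
  hypothetical field. But a type may depend on a \<^emph>\<open>chosen\<close> exceptional field, with the rationals as
  fallback if there is none.\<close>

definition chosen_ring :: "('k, 'm) ring_scheme itself \<Rightarrow> ('k + rat) ring" where
  "chosen_ring _ = (if \<exists>K :: ('k, 'm) ring_scheme. exceptional K
     then image_ring Inl (SOME K :: ('k, 'm) ring_scheme. exceptional K) else image_ring Inr rat_ring)"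

lemma field_chosen_ring: "field (chosen_ring TYPE(('k, 'm) ring_scheme))"
proof (cases "\<exists>K :: ('k, 'm) ring_scheme. exceptional K")
  case True
  then have "field (SOME K :: ('k, 'm) ring_scheme. exceptional K)"
    using someI_ex[OF True] by (simp add: exceptional_def)
  then show ?thesis using True by (simp add: chosen_ring_def field.inj_imp_image_ring_is_field)
next
  case False
  then show ?thesis using field_rat_ring by (simp add: chosen_ring_def field.inj_imp_image_ring_is_field)
qed

typedef ('k, 'm) chosen_field = "carrier (chosen_ring TYPE(('k, 'm) ring_scheme))"
proof -
  interpret field "chosen_ring TYPE(('k, 'm) ring_scheme)" by (rule field_chosen_ring)
  show ?thesis using zero_closed by blast
qed

instantiation chosen_field :: (type, type) field
begin

definition zero_chosen_field :: "('a, 'b) chosen_field" where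
  "0 = Abs_chosen_field \<zero>\<^bsub>chosen_ring TYPE(('a, 'b) ring_scheme)\<^esub>"
definition one_chosen_field :: "('a, 'b) chosen_field" where
  "1 = Abs_chosen_field \<one>\<^bsub>chosen_ring TYPE(('a, 'b) ring_scheme)\<^esub>"
definition plus_chosen_field :: "('a, 'b) chosen_field \<Rightarrow> ('a, 'b) chosen_field \<Rightarrow> ('a, 'b) chosen_field" where
  "x + y = Abs_chosen_field (Rep_chosen_field x \<oplus>\<^bsub>chosen_ring TYPE(('a, 'b) ring_scheme)\<^esub> Rep_chosen_field y)"
definition times_chosen_field :: "('a, 'b) chosen_field \<Rightarrow> ('a, 'b) chosen_field \<Rightarrow> ('a, 'b) chosen_field" where
  "x * y = Abs_chosen_field (Rep_chosen_field x \<otimes>\<^bsub>chosen_ring TYPE(('a, 'b) ring_scheme)\<^esub> Rep_chosen_field y)"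
definition uminus_chosen_field :: "('a, 'b) chosen_field \<Rightarrow> ('a, 'b) chosen_field" where
  "- x = Abs_chosen_field (\<ominus>\<^bsub>chosen_ring TYPE(('a, 'b) ring_scheme)\<^esub> Rep_chosen_field x)"
definition minus_chosen_field :: "('a, 'b) chosen_field \<Rightarrow> ('a, 'b) chosen_field \<Rightarrow> ('a, 'b) chosen_field" where
  "x - y = x + - (y :: ('a, 'b) chosen_field)"
definition inverse_chosen_field :: "('a, 'b) chosen_field \<Rightarrow> ('a, 'b) chosen_field" where
  "inverse x = (if x = 0 then 0 else Abs_chosen_field (inv\<^bsub>chosen_ring TYPE(('a, 'b) ring_scheme)\<^esub> Rep_chosen_field x))"
definition divide_chosen_field :: "('a, 'b) chosen_field \<Rightarrow> ('a, 'b) chosen_field \<Rightarrow> ('a, 'b) chosen_field" where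
  "x div y = x * inverse (y :: ('a, 'b) chosen_field)"

instance
proof
  fix a b c :: "('a, 'b) chosen_field"
  define R where "R = chosen_ring TYPE(('a, 'b) ring_scheme)"
  interpret R: field R unfolding R_def by (rule field_chosen_ring)
  have Rep [simp]: "Rep_chosen_field x \<in> carrier R" for x :: "('a, 'b) chosen_field"
    using Rep_chosen_field[of x] by (simp add: R_def)
  have Abs [simp]: "Rep_chosen_field (Abs_chosen_field x :: ('a, 'b) chosen_field) = x" if "x \<in> carrier R" for x
    using that by (intro Abs_chosen_field_inverse) (simp add: R_def)
  note defs = plus_chosen_field_def times_chosen_field_def zero_chosen_field_def one_chosen_field_def
    uminus_chosen_field_def minus_chosen_field_def R_def[symmetric]
  note inject = Rep_chosen_field_inject[symmetric]
  show "a + b + c = a + (b + c)" "a + b = b + a" "0 + a = a" "- a + a = 0" "a - b = a + - b"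
    "a * b * c = a * (b * c)" "a * b = b * a" "1 * a = a" "(a + b) * c = a * c + b * c"
    by (simp_all add: defs inject R.a_ac R.m_ac R.l_neg R.r_neg R.r_distr)
  show "(0 :: ('a, 'b) chosen_field) \<noteq> 1"
    by (simp add: defs inject)
  show "inverse (0 :: ('a, 'b) chosen_field) = 0" by (simp add: inverse_chosen_field_def)
  show "inverse a * a = 1" if "a \<noteq> 0"
  proof -
    have "Rep_chosen_field a \<noteq> \<zero>\<^bsub>R\<^esub>" using that by (simp add: defs inject)
    then have "Rep_chosen_field a \<in> Units R" by (simp add: R.field_Units)
    then show ?thesis using that by (simp add: inverse_chosen_field_def times_chosen_field_def one_chosen_field_def R_def[symmetric] R.Units_l_inv)
  qed
  show "a div b = a * inverse b" by (simp add: divide_chosen_field_def)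
qed

end

theorem theorem3p6:
  fixes K :: "('k, 'm) ring_scheme"
  assumes "field K"
    and "ring_characteristic K > 0"
  shows "\<forall>n::nat. n \<ge> 3 \<longrightarrow>
    (\<exists>A :: ('k, nat multiset \<Rightarrow> 'k) module.
        finitely_generated_algebra K A \<and>
        algebra_isomorphic K (poly_algebra A) (mpoly_algebra K (n + 1)) \<and>
        \<not> algebra_isomorphic K A (mpoly_algebra K n))"
proof (rule ccontr)
  assume "\<not> ?thesis"
  then have ex: "\<exists>K :: ('k, 'm) ring_scheme. exceptional K" using assms unfolding exceptional_def by blast
  \<comment> \<open>The chosen field need not be the given \<open>K\<close>; the contradiction is
    drawn for \<open>L\<close>, which is exceptional as well.\<close>
  define L where "L = (SOME K :: ('k, 'm) ring_scheme. exceptional K)"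
  have L: "exceptional L" unfolding L_def by (rule someI_ex[OF ex])
  define R where "R = chosen_ring TYPE(('k, 'm) ring_scheme)"
  have R: "R = image_ring Inl L" using ex by (simp add: R_def chosen_ring_def L_def)
  interpret L: field L using L by (simp add: exceptional_def)
  have iso: "(Inl :: 'k \<Rightarrow> 'k + rat) \<in> ring_iso L R"
    unfolding R by (rule inj_imp_image_ring_iso) simp
  then have hom: "(Inl :: 'k \<Rightarrow> 'k + rat) \<in> ring_hom L R" and bij: "bij_betw (Inl :: 'k \<Rightarrow> 'k + rat) (carrier L) (carrier R)"
    by (auto simp: ring_iso_def)
  define \<iota> :: "'k \<Rightarrow> ('k, 'm) chosen_field" where "\<iota> c = Abs_chosen_field (Inl c)" for c
  have mem: "Inl c \<in> carrier R" if "c \<in> carrier L" for c using bij that by (auto simp: bij_betw_def)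
  have rep: "Rep_chosen_field (\<iota> c) = Inl c" if "c \<in> carrier L" for c
    unfolding \<iota>_def using mem[OF that] by (intro Abs_chosen_field_inverse) (simp add: R_def)
  interpret field_transfer L \<iota>
  proof
    have "bij_betw (Abs_chosen_field :: 'k + rat \<Rightarrow> ('k, 'm) chosen_field) (carrier R) UNIV"
      unfolding R_def
      by (rule bij_betwI[of _ _ _ Rep_chosen_field])
        (auto simp: Rep_chosen_field Rep_chosen_field_inverse Abs_chosen_field_inverse)
    from bij_betw_trans[OF bij this] show "bij_betw \<iota> (carrier L) UNIV"
      by (simp add: \<iota>_def[abs_def] comp_def)
    show "\<iota> (a \<oplus>\<^bsub>L\<^esub> b) = \<iota> a + \<iota> b" "\<iota> (a \<otimes>\<^bsub>L\<^esub> b) = \<iota> a * \<iota> b" if "a \<in> carrier L" "b \<in> carrier L" for a b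
      using that ring_hom_add[OF hom, of a b] ring_hom_mult[OF hom, of a b]
      by (simp_all add: plus_chosen_field_def times_chosen_field_def rep R_def[symmetric]) (simp_all add: \<iota>_def)
  qed
  show False using transfer L by (auto simp: exceptional_def)
qed

end
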